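(* Suppose that $f(X_1,\dots,X_d)\in L^2$ and $\mu>0$. Then, for both choices of sign $\pm$, as $x\to\infty$, $$\frac{N_\pm(x)-(d!/\mu)^{1/d}x^{1/d}}{x^{1/(2d)}}\ \overset{\mathrm d}{\longrightarrow}\ N\Bigl(0,\ (d!/\mu)^{2+1/d}\,d^{-2}\sigma^2\Bigr),$$ where $$\sigma^2:=\sum_{i,j=1}^d\frac{(i+j-2)!\,(2d-i-j)!}{(i-1)!\,(j-1)!\,(d-i)!\,(d-j)!\,(2d-1)!}\,\sigma_{ij}.$$
   Context: $X,X_1,X_2,\dots$ is an i.i.d. sequence of random variables with values in an arbitrary measurable space $(S,\mathcal S)$; $d\ge1$ is a fixed integer and $f:S^d\to\mathbb R$ is measurable (no symmetry assumed). $U_n:=\sum_{1\le i_1<\dots<i_d\le n}f(X_{i_1},\dots,X_{i_d})$ for $n\ge0$ (so $U_n=0$ for $n<d$), $\mu:=\mathbb E f(X_1,\dots,X_d)$; for $i=1,\dots,d$, $f_i(x):=\mathbb E f(X_1,\dots,X_{i-1},x,X_{i+1},\dots,X_d)-\mu$, and $\sigma_{ij}:=\operatorname{Cov}(f_i(X),f_j(X))$. For $x>0$, $$N_-(x):=\sup\{n\ge0:U_n\le x\},\qquad N_+(x):=\inf\{n\ge0:U_n>x\}.$$ $N(0,0)$ denotes the point mass at $0$. *)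

theory Defs
  imports "HOL-Probability.Probability"
begin

text \<open>
  Throughout, \<open>S\<^sup>d\<close> is the product \<open>Pi\<^sub>M {1..d} (\<lambda>_. S)\<close>, and \<open>X\<close> is a family indexed by all
  natural numbers: \<open>X 1, X 2, \<dots>\<close> is the i.i.d. sequence entering the U-statistic and \<open>X 0\<close> is
  the further independent copy written \<open>X\<close> (without index) in the literature.
\<close>

definition iid :: "'a measure \<Rightarrow> 's measure \<Rightarrow> (nat \<Rightarrow> 'a \<Rightarrow> 's) \<Rightarrow> bool" where
  "iid M S X \<longleftrightarrow>
     prob_space.indep_vars M (\<lambda>_. S) X UNIV \<and> (\<forall>i. distr M S (X i) = distr M S (X 0))"

definition cov :: "'a measure \<Rightarrow> ('a \<Rightarrow> real) \<Rightarrow> ('a \<Rightarrow> real) \<Rightarrow> real" where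
  "cov M Y Z = (\<integral>\<omega>. (Y \<omega> - integral\<^sup>L M Y) * (Z \<omega> - integral\<^sup>L M Z) \<partial>M)"

text \<open>Index tuples \<open>1 \<le> i\<^sub>1 < \<dots> < i\<^sub>d \<le> n\<close>, as strictly increasing maps.\<close>

definition incr_tuples :: "nat \<Rightarrow> nat \<Rightarrow> (nat \<Rightarrow> nat) set" where
  "incr_tuples d n = {\<iota> \<in> {1..d} \<rightarrow>\<^sub>E {1..n}. strict_mono_on {1..d} \<iota>}"

definition U_stat ::
  "nat \<Rightarrow> ((nat \<Rightarrow> 's) \<Rightarrow> real) \<Rightarrow> (nat \<Rightarrow> 'a \<Rightarrow> 's) \<Rightarrow> nat \<Rightarrow> 'a \<Rightarrow> real" where
  "U_stat d f X n \<omega> = (\<Sum>\<iota>\<in>incr_tuples d n. f (\<lambda>k\<in>{1..d}. X (\<iota> k) \<omega>))"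

definition U_mean ::
  "'a measure \<Rightarrow> nat \<Rightarrow> ((nat \<Rightarrow> 's) \<Rightarrow> real) \<Rightarrow> (nat \<Rightarrow> 'a \<Rightarrow> 's) \<Rightarrow> real" where
  "U_mean M d f X = (\<integral>\<omega>. f (\<lambda>k\<in>{1..d}. X k \<omega>) \<partial>M)"

definition U_proj ::
  "'a measure \<Rightarrow> nat \<Rightarrow> ((nat \<Rightarrow> 's) \<Rightarrow> real) \<Rightarrow> (nat \<Rightarrow> 'a \<Rightarrow> 's) \<Rightarrow> nat \<Rightarrow> 's \<Rightarrow> real" where
  "U_proj M d f X i x = (\<integral>\<omega>. f ((\<lambda>k\<in>{1..d}. X k \<omega>)(i := x)) \<partial>M) - U_mean M d f X"

definition U_cov ::
  "'a measure \<Rightarrow> nat \<Rightarrow> ((nat \<Rightarrow> 's) \<Rightarrow> real) \<Rightarrow> (nat \<Rightarrow> 'a \<Rightarrow> 's) \<Rightarrow> nat \<Rightarrow> nat \<Rightarrow> real" where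
  "U_cov M d f X i j =
     cov M (\<lambda>\<omega>. U_proj M d f X i (X 0 \<omega>)) (\<lambda>\<omega>. U_proj M d f X j (X 0 \<omega>))"

text \<open>
  In the sum below \<open>1 \<le> i, j \<le> d\<close>, so none of the subtractions on \<^typ>\<open>nat\<close> is truncated.
\<close>

definition U_sigma2 ::
  "'a measure \<Rightarrow> nat \<Rightarrow> ((nat \<Rightarrow> 's) \<Rightarrow> real) \<Rightarrow> (nat \<Rightarrow> 'a \<Rightarrow> 's) \<Rightarrow> real" where
  "U_sigma2 M d f X =
     (\<Sum>i=1..d. \<Sum>j=1..d.
        fact (i + j - 2) * fact (2 * d - i - j)
        / (fact (i - 1) * fact (j - 1) * fact (d - i) * fact (d - j) * fact (2 * d - 1))
        * U_cov M d f X i j)"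

text \<open>
  Passage times of an arbitrary sequence \<open>U\<close>. They take values in \<^typ>\<open>enat\<close>, so that an unbounded
  set has supremum \<open>\<infinity>\<close> and the empty set has infimum \<open>\<infinity>\<close>.
\<close>

definition N_minus :: "(nat \<Rightarrow> 'a \<Rightarrow> real) \<Rightarrow> real \<Rightarrow> 'a \<Rightarrow> enat" where
  "N_minus U x \<omega> = Sup {enat n | n. U n \<omega> \<le> x}"

definition N_plus :: "(nat \<Rightarrow> 'a \<Rightarrow> real) \<Rightarrow> real \<Rightarrow> 'a \<Rightarrow> enat" where
  "N_plus U x \<omega> = Inf {enat n | n. U n \<omega> > x}"

text \<open>
  \<open>normal_law m v\<close> is \<open>N(m, v)\<close>, parametrised by the variance \<open>v \<ge> 0\<close>, whereas the library's
  \<^const>\<open>normal_density\<close> is parametrised by the standard deviation and degenerates at \<open>0\<close>.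
\<close>

definition normal_law :: "real \<Rightarrow> real \<Rightarrow> real measure" where
  "normal_law m v =
     (if v = 0 then return borel m else density lborel (normal_density m (sqrt v)))"

text \<open>
  Convergence in distribution along a filter, to a law on the real line. This is the library's
  \<^const>\<open>weak_conv_m\<close> (pointwise convergence of distribution functions at continuity points of the
  limit), except that the index need not be a natural number and that the variables may take
  infinite values; as the limit has no mass at infinity, it is weak convergence on the extended line.
\<close>

definition conv_in_distr ::
  "'a measure \<Rightarrow> ('i \<Rightarrow> 'a \<Rightarrow> ereal) \<Rightarrow> real measure \<Rightarrow> 'i filter \<Rightarrow> bool" where
  "conv_in_distr M Z \<nu> F \<longleftrightarrow>
     (\<forall>t. isCont (cdf \<nu>) t \<longrightarrow>
        ((\<lambda>i. measure M {\<omega> \<in> space M. Z i \<omega> \<le> ereal t}) \<longlongrightarrow> cdf \<nu> t) F)"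

lemma conv_in_distr_iff_weak_conv_m:
  assumes "\<And>n. Z n \<in> borel_measurable M"
  shows "conv_in_distr M (\<lambda>n \<omega>. ereal (Z n \<omega>)) \<nu> sequentially
           \<longleftrightarrow> weak_conv_m (\<lambda>n. distr M borel (Z n)) \<nu>"
proof -
  have "cdf (distr M borel (Z n)) t = measure M {\<omega> \<in> space M. Z n \<omega> \<le> t}" for n t
  proof -
    have "Z n -` {..t} \<inter> space M = {\<omega> \<in> space M. Z n \<omega> \<le> t}" by auto
    then show ?thesis using assms by (simp add: cdf_def measure_distr)
  qed
  then show ?thesis
    by (simp add: conv_in_distr_def weak_conv_m_def weak_conv_def)
qed

end

theory Submission
  imports Defs "HOL-Real_Asymp.Real_Asymp"
begin

text \<open>
  The event \<open>N\<^sub>+(x) \<le> m\<close> says that \<open>U\<^sub>n > x\<close> for some \<open>n \<le> m\<close>, and \<open>N\<^sub>-(x) \<le> m\<close> says that \<open>U\<^sub>n > x\<close>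
  for all \<open>n > m\<close>. If \<open>U\<close> were increasing, both would reduce to \<open>U\<^sub>m > x\<close> up to a shift of \<open>m\<close> by one,
  and the theorem would be the central limit theorem for \<open>U\<^sub>m\<close> read at
  \<open>m \<approx> (d!/\<mu>)\<^bsup>1/d\<^esup> x\<^bsup>1/d\<^esup> + t x\<^bsup>1/(2d)\<^esup>\<close>. It therefore suffices to prove two things.

  Central limit theorem: subtracting the projections \<open>f\<^sub>i\<close> from \<open>f - \<mu>\<close> leaves a kernel whose values at two
  index tuples are uncorrelated unless the tuples share at least two indices, so its sum is negligible
  in \<open>L\<^sup>2\<close>. What remains is a weighted sum of independent variables, handled by characteristic functions.

  Almost monotonicity: with probability tending to one, \<open>U\<^sub>n\<close> exceeds \<open>U\<^sub>m\<close> by at most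
  \<open>\<epsilon> m\<^bsup>d-1/2\<^esup>\<close> for \<open>n \<le> m\<close> and falls short of it by at most as much for \<open>n \<ge> m\<close>. No maximal inequality is
  needed: Chebyshev's inequality and the drift \<open>\<mu> > 0\<close> control \<open>U\<close> at the grid points \<open>m \<plusminus> k\<^sup>2\<close>, where the
  error probabilities are summable with sum \<open>o(1)\<close>, and between grid points one compares with the sums of
  the positive and the negative part of \<open>f\<close>, which are monotone in \<open>n\<close>.
\<close>

section \<open>Counting index tuples\<close>

text \<open>The grid has to be quadratic. Over a block of length L ending at b, the increment of U
  has mean of order L b^(d-1) and standard deviation at most of order sqrt(L) b^(d-1). With the
  slack \<epsilon> m^(d-1/2) included, Chebyshev's bound is of order L / (L + sqrt m)^2. Summed over
  L = 1, 2, 3, ... this diverges; summed over L = k^2 it converges. In a gap of length 2k + 1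
  between grid points, on the other hand, the sum of the negative parts rises on average by about k
  b^(d-1) only, which is small against (k^2 + sqrt m) b^(d-1). The central limit theorem is stated
  for the mean minus U, so that U_m > x becomes an upper bound on the normalised variable; the limit
  law is symmetric and does not change. The limits are taken in characteristic functions and in
  distribution functions at continuity points, so that the degenerate case \<sigma>^2 = 0 is carried
  along.\<close>

lemma finite_incr_tuples [simp]: "finite (incr_tuples d n)"
  unfolding incr_tuples_def by (rule finite_subset[of _ "{1..d} \<rightarrow>\<^sub>E {1..n}"]) (auto intro: finite_PiE)

lemma incr_tuples_inj_on: "\<iota> \<in> incr_tuples d n \<Longrightarrow> inj_on \<iota> {1..d}"
  unfolding incr_tuples_def by (auto intro: strict_mono_on_imp_inj_on)

lemma incr_tuples_PiE: "\<iota> \<in> incr_tuples d n \<Longrightarrow> \<iota> \<in> {1..d} \<rightarrow>\<^sub>E {1..n}"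
  by (simp add: incr_tuples_def)

lemma incr_tuples_mono: "m \<le> n \<Longrightarrow> incr_tuples d m \<subseteq> incr_tuples d n"
  unfolding incr_tuples_def by (auto simp: PiE_iff)

lemma incr_tuples_0_left: "incr_tuples 0 n = {\<lambda>_. undefined}"
  by (auto simp: incr_tuples_def strict_mono_on_def)

lemma incr_tuples_Suc_0: "incr_tuples (Suc d) 0 = {}"
  by (auto simp: incr_tuples_def PiE_eq_empty_iff PiE_iff)

text \<open>Pascal's recursion at the level of sets: an increasing tuple with values up to
  \<open>Suc n\<close> can take the value \<open>Suc n\<close> only at its last position. The counts
  below are inductions over \<open>n\<close> along this split.\<close>

lemma incr_tuples_Suc_Suc:
  "incr_tuples (Suc d) (Suc n) =
     incr_tuples (Suc d) n \<union> (\<lambda>\<iota>. \<iota>(Suc d := Suc n)) ` incr_tuples d n"  (is "?L = ?R \<union> ?I")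
proof (intro equalityI subsetI)
  fix \<iota> assume \<iota>: "\<iota> \<in> ?L"
  then have P: "\<And>k. k \<in> {1..Suc d} \<Longrightarrow> \<iota> k \<in> {1..Suc n}" "\<And>k. k \<notin> {1..Suc d} \<Longrightarrow> \<iota> k = undefined"
    and mono: "\<And>r s. r \<in> {1..Suc d} \<Longrightarrow> s \<in> {1..Suc d} \<Longrightarrow> r < s \<Longrightarrow> \<iota> r < \<iota> s"
    unfolding incr_tuples_def by (auto simp: PiE_iff extensional_def strict_mono_on_def)
  have lt: "\<iota> k < \<iota> (Suc d)" if "k \<in> {1..d}" for k
    using mono[of k "Suc d"] that by auto
  show "\<iota> \<in> ?R \<union> ?I"
  proof (cases "\<iota> (Suc d) = Suc n")
    case True
    define \<kappa> where "\<kappa> = \<iota>(Suc d := undefined)"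
    have "\<kappa> k \<in> {1..n}" if "k \<in> {1..d}" for k
      using lt[OF that] P(1)[of k] that True by (auto simp: \<kappa>_def)
    moreover have "\<kappa> k = undefined" if "k \<notin> {1..d}" for k
      using P(2)[of k] that by (cases "k = Suc d") (auto simp: \<kappa>_def)
    moreover have "strict_mono_on {1..d} \<kappa>"
      unfolding strict_mono_on_def \<kappa>_def using mono by auto
    ultimately have "\<kappa> \<in> incr_tuples d n"
      unfolding incr_tuples_def PiE_iff extensional_def by blast
    moreover have "\<iota> = \<kappa>(Suc d := Suc n)" using True by (auto simp: \<kappa>_def)
    ultimately show ?thesis by blast
  next
    case False
    then have le: "\<iota> (Suc d) \<le> n" using P(1)[of "Suc d"] by auto
    have "\<iota> k \<in> {1..n}" if "k \<in> {1..Suc d}" for k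
    proof (cases "k = Suc d")
      case False
      then show ?thesis using lt[of k] le P(1)[of k] that by auto
    qed (use le P(1)[of "Suc d"] in auto)
    with \<iota> show ?thesis unfolding incr_tuples_def PiE_iff by auto
  qed
next
  fix \<iota> assume "\<iota> \<in> ?R \<union> ?I"
  then show "\<iota> \<in> ?L"
  proof
    assume "\<iota> \<in> ?I"
    then obtain \<kappa> where \<kappa>: "\<kappa> \<in> incr_tuples d n" and \<iota>: "\<iota> = \<kappa>(Suc d := Suc n)" by auto
    have P: "\<And>k. k \<in> {1..d} \<Longrightarrow> \<kappa> k \<in> {1..n}" "\<And>k. k \<notin> {1..d} \<Longrightarrow> \<kappa> k = undefined"
      and mono: "\<And>r s. r \<in> {1..d} \<Longrightarrow> s \<in> {1..d} \<Longrightarrow> r < s \<Longrightarrow> \<kappa> r < \<kappa> s"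
      using \<kappa> unfolding incr_tuples_def by (auto simp: PiE_iff extensional_def strict_mono_on_def)
    have "\<iota> k \<in> {1..Suc n}" if "k \<in> {1..Suc d}" for k
      using P(1)[of k] that by (cases "k = Suc d") (auto simp: \<iota>)
    moreover have "\<iota> k = undefined" if "k \<notin> {1..Suc d}" for k
      using P(2)[of k] that by (auto simp: \<iota>)
    moreover have "\<iota> r < \<iota> s" if "r \<in> {1..Suc d}" "s \<in> {1..Suc d}" "r < s" for r s
      using mono[of r s] P(1)[of r] that by (cases "s = Suc d") (auto simp: \<iota>)
    ultimately show ?thesis
      unfolding incr_tuples_def PiE_iff extensional_def strict_mono_on_def by blast
  qed (use incr_tuples_mono[of n "Suc n" "Suc d"] in auto)
qed

lemma incr_tuples_Suc_disjoint:
  "\<iota> \<in> incr_tuples (Suc d) n \<Longrightarrow> \<iota> \<notin> (\<lambda>\<iota>. \<iota>(Suc d := Suc n)) ` incr_tuples d m"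
  by (auto simp: incr_tuples_def PiE_iff fun_upd_def Ball_def split: if_splits)

lemma inj_on_incr_tuples_upd: "inj_on (\<lambda>\<iota>. \<iota>(Suc d := a)) (incr_tuples d n)"
proof (rule inj_onI)
  fix \<iota> \<kappa> assume *: "\<iota> \<in> incr_tuples d n" "\<kappa> \<in> incr_tuples d n" "\<iota>(Suc d := a) = \<kappa>(Suc d := a)"
  show "\<iota> = \<kappa>"
  proof
    fix k show "\<iota> k = \<kappa> k"
    proof (cases "k = Suc d")
      case True
      with * show ?thesis by (simp add: incr_tuples_def PiE_iff extensional_def)
    qed (use fun_cong[OF *(3), of k] in simp)
  qed
qed

lemma card_incr_tuples: "card (incr_tuples d n) = n choose d"
proof (induction n arbitrary: d)
  case 0
  show ?case by (cases d) (auto simp: incr_tuples_0_left incr_tuples_Suc_0)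
next
  case (Suc n)
  show ?case
  proof (cases d)
    case (Suc e)
    have "card (incr_tuples (Suc e) (Suc n)) = card (incr_tuples (Suc e) n) + card (incr_tuples e n)"
      unfolding incr_tuples_Suc_Suc
      using incr_tuples_Suc_disjoint[of _ e n n]
      by (subst card_Un_disjoint) (auto simp del: fun_upd_apply simp add: card_image inj_on_incr_tuples_upd)
    then show ?thesis using Suc.IH Suc by simp
  qed (simp add: incr_tuples_0_left)
qed

text \<open>The \<open>i\<close> earlier entries are chosen among the \<open>k\<close> values below
  \<open>Suc k\<close>, the \<open>d - Suc i\<close> later ones among the \<open>n - Suc k\<close>
  values above it.\<close>

lemma card_incr_tuples_fiber:
  assumes "i < d" "k < n"
  shows "card {\<iota> \<in> incr_tuples d n. \<iota> (Suc i) = Suc k} = (k choose i) * ((n - Suc k) choose (d - Suc i))"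
  using assms
proof (induction n arbitrary: d)
  case (Suc n)
  then obtain e where e: "d = Suc e" by (cases d) auto
  let ?up = "\<lambda>\<iota>. \<iota>(Suc e := Suc n)"
  let ?A = "{\<iota> \<in> incr_tuples (Suc e) n. \<iota> (Suc i) = Suc k}"
  let ?B = "{\<iota> \<in> incr_tuples e n. (?up \<iota>) (Suc i) = Suc k}"
  have "{\<iota> \<in> incr_tuples (Suc e) (Suc n). \<iota> (Suc i) = Suc k} = ?A \<union> ?up ` ?B"
    unfolding incr_tuples_Suc_Suc by blast
  moreover have "?A \<inter> ?up ` ?B = {}" using incr_tuples_Suc_disjoint[of _ e n n] by blast
  moreover have "card (?up ` ?B) = card ?B"
    by (intro card_image inj_on_subset[OF inj_on_incr_tuples_upd]) auto
  ultimately have *: "card {\<iota> \<in> incr_tuples (Suc e) (Suc n). \<iota> (Suc i) = Suc k} = card ?A + card ?B"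
    by (simp add: card_Un_disjoint del: fun_upd_apply)
  have le_n: "\<iota> (Suc i) \<le> n" if "\<iota> \<in> incr_tuples c n" "i < c" for \<iota> c
    using that by (auto simp: incr_tuples_def PiE_iff)
  \<comment> \<open>The new value \<open>Suc n\<close> occurs only at the new last position
    \<open>Suc e\<close>, which decides the boundary cases \<open>k = n\<close> and
    \<open>i = e\<close>.\<close>
  have A0: "?A = {}" if "k = n"
    using that Suc.prems(1) e le_n[of _ "Suc e"] by fastforce
  have A1: "card ?A = (k choose i) * ((n - Suc k) choose (e - i))" if "k < n"
    using Suc.IH[of "Suc e"] Suc.prems that e by simp
  have B0: "card ?B = (if k = n then n choose e else 0)" if "i = e"
    using that by (auto simp: card_incr_tuples)
  have B1: "card ?B = (if k = n then 0 else (k choose i) * ((n - Suc k) choose (e - Suc i)))" if "i < e"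
  proof (cases "k = n")
    case True
    have "?B = {}" using True that le_n[of _ e] by fastforce
    then show ?thesis using True by simp
  next
    case False
    then have "k < n" using Suc.prems by simp
    with that Suc.IH[of e] False show ?thesis by simp
  qed
  show ?case
  proof (cases "k = n")
    case True
    show ?thesis
    proof (cases "i = e")
      case False
      then have "i < e" using Suc.prems e by simp
      have "0 < e - i" using \<open>i < e\<close> by simp
      have "card ?A = 0" using A0[OF True] by simp
      moreover have "card ?B = 0" using B1[OF \<open>i < e\<close>] True by simp
      ultimately have "card {\<iota> \<in> incr_tuples d (Suc n). \<iota> (Suc i) = Suc k} = 0"
        unfolding e using * by linarith
      also have "\<dots> = (k choose i) * ((Suc n - Suc k) choose (d - Suc i))"
        using True \<open>0 < e - i\<close> e by simp
      finally show ?thesis .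
    qed (use * A0[OF True] B0 True e in simp)
  next
    case False
    then have kn: "k < n" using Suc.prems by simp
    show ?thesis
    proof (cases "i = e")
      case True
      then show ?thesis using * A1[OF kn] B0 kn e by simp
    next
      case ne: False
      then have "i < e" using Suc.prems e by simp
      \<comment> \<open>With both arguments of the second binomial written as successors, Pascal's
        rule applies to it as a rewrite rule.\<close>
      then obtain j where j: "e - i = Suc j" "e - Suc i = j" by (metis Suc_diff_Suc)
      obtain r where r: "n - k = Suc r" "n - Suc k = r" using kn by (metis Suc_diff_Suc)
      show ?thesis using * A1[OF kn] B1[OF \<open>i < e\<close>] kn e j r by (simp add: algebra_simps)
    qed
  qed
qed simp

text \<open>Turns a sum of one-coordinate functions over tuples into a weighted sum over single
  observations; applied to the projections it produces a sum of independent terms.\<close>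

lemma sum_incr_tuples_by_value:
  fixes h :: "nat \<Rightarrow> real"
  assumes "i < d"
  shows "(\<Sum>\<iota>\<in>incr_tuples d n. h (\<iota> (Suc i))) =
    (\<Sum>k<n. real ((k choose i) * ((n - Suc k) choose (d - Suc i))) * h (Suc k))"
proof -
  have "(\<Sum>\<iota>\<in>incr_tuples d n. h (\<iota> (Suc i))) =
    (\<Sum>k\<in>Suc ` {..<n}. \<Sum>\<iota> | \<iota> \<in> incr_tuples d n \<and> \<iota> (Suc i) = k. h (\<iota> (Suc i)))"
  proof (rule sum.group[symmetric])
    show "(\<lambda>\<iota>. \<iota> (Suc i)) ` incr_tuples d n \<subseteq> Suc ` {..<n}"
    proof safe
      fix \<iota> assume "\<iota> \<in> incr_tuples d n"
      then have "\<iota> (Suc i) \<in> {1..n}" using assms by (auto simp: incr_tuples_def PiE_iff)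
      then show "\<iota> (Suc i) \<in> Suc ` {..<n}" by (cases "\<iota> (Suc i)") auto
    qed
  qed auto
  also have "\<dots> = (\<Sum>k<n. \<Sum>\<iota> | \<iota> \<in> incr_tuples d n \<and> \<iota> (Suc i) = Suc k. h (Suc k))"
    by (subst sum.reindex) auto
  also have "\<dots> = (\<Sum>k<n. real ((k choose i) * ((n - Suc k) choose (d - Suc i))) * h (Suc k))"
    using assms by (intro sum.cong refl) (simp add: card_incr_tuples_fiber)
  finally show ?thesis .
qed

text \<open>A Vandermonde convolution, read off from counting the increasing tuples of length
  \<open>p + q + 1\<close> by their entry at position \<open>Suc p\<close>.\<close>

lemma sum_choose_mult_choose:
  "(\<Sum>k<n. real (k choose p) * real ((n - Suc k) choose q)) = real (n choose (p + q + 1))"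
  using sum_incr_tuples_by_value[of p "p + q + 1" "\<lambda>_. 1" n] by (simp add: card_incr_tuples)

text \<open>Monotonicity of the tuples is dropped: every coordinate outside \<open>J\<close>
  contributes a factor \<open>n\<close>. In the bounds derived from this, the power of
  \<open>n\<close> is what counts.\<close>

lemma card_PiE_constrained:
  assumes "J \<subseteq> {1..d}"
  shows "card {\<kappa> \<in> {1..d} \<rightarrow>\<^sub>E {1..n}. \<forall>k\<in>J. \<kappa> k \<in> C k} \<le> (\<Prod>k\<in>J. card (C k \<inter> {1..n})) * n ^ (d - card J)"
proof -
  let ?D = "\<lambda>k. if k \<in> J then C k \<inter> {1..n} else {1..n}"
  have "card {\<kappa> \<in> {1..d} \<rightarrow>\<^sub>E {1..n}. \<forall>k\<in>J. \<kappa> k \<in> C k} \<le> card (PiE {1..d} ?D)"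
    by (intro card_mono finite_PiE) (auto simp: PiE_iff extensional_def)
  also have "\<dots> = (\<Prod>k\<in>{1..d}. if k \<in> J then card (C k \<inter> {1..n}) else n)"
    by (subst card_PiE) (auto intro!: prod.cong)
  also have "\<dots> = (\<Prod>k\<in>J. card (C k \<inter> {1..n})) * (\<Prod>k\<in>{1..d} - J. n)"
    using assms by (subst prod.If_cases) (auto simp: Int_absorb1 Diff_eq)
  also have "(\<Prod>k\<in>{1..d} - J. n) = n ^ (d - card J)"
    using assms by (simp add: card_Diff_subset finite_subset)
  finally show ?thesis .
qed

text \<open>An increasing tuple that leaves \<open>{1..a}\<close> has its last entry above
  \<open>a\<close>, so membership in the difference constrains the last coordinate.\<close>

lemma card_incr_tuples_diff:
  assumes "a \<le> b" "d \<ge> 1"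
  shows "card (incr_tuples d b - incr_tuples d a) \<le> (b - a) * b ^ (d - 1)"
    and "real (card (incr_tuples d b - incr_tuples d a)) = real (b choose d) - real (a choose d)"
proof -
  have sub: "incr_tuples d b - incr_tuples d a \<subseteq> {\<kappa> \<in> {1..d} \<rightarrow>\<^sub>E {1..b}. \<forall>k\<in>{d}. \<kappa> k \<in> {a<..b}}"
  proof
    fix \<iota> assume "\<iota> \<in> incr_tuples d b - incr_tuples d a"
    then have \<iota>: "\<iota> \<in> incr_tuples d b" "\<iota> \<notin> incr_tuples d a" by auto
    have 1: "\<iota> \<in> {1..d} \<rightarrow>\<^sub>E {1..b}" using \<iota> by (simp add: incr_tuples_def)
    have P: "\<iota> k \<in> {1..b}" if "k \<in> {1..d}" for k using \<iota>(1) that by (auto simp: incr_tuples_def PiE_iff)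
    have "\<exists>k\<in>{1..d}. \<iota> k > a"
    proof (rule ccontr)
      assume "\<not> ?thesis"
      then have "\<iota> \<in> incr_tuples d a" using \<iota>(1) P by (auto simp: incr_tuples_def PiE_iff not_less)
      then show False using \<iota> by simp
    qed
    then obtain k where "k \<in> {1..d}" "\<iota> k > a" by auto
    moreover have "\<iota> k \<le> \<iota> d"
      using \<iota>(1) \<open>k \<in> {1..d}\<close> by (cases "k = d") (auto simp: incr_tuples_def strict_mono_on_def intro!: less_imp_le)
    ultimately have "\<iota> d \<in> {a<..b}" using P[of d] assms by auto
    with 1 show "\<iota> \<in> {\<kappa> \<in> {1..d} \<rightarrow>\<^sub>E {1..b}. \<forall>k\<in>{d}. \<kappa> k \<in> {a<..b}}" by simp
  qed
  have "card (incr_tuples d b - incr_tuples d a) \<le> (\<Prod>k\<in>{d}. card ({a<..b} \<inter> {1..b})) * b ^ (d - card {d})"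
  proof (rule order.trans[OF card_mono[OF _ sub] card_PiE_constrained])
    show "finite {\<kappa> \<in> {1..d} \<rightarrow>\<^sub>E {1..b}. \<forall>k\<in>{d}. \<kappa> k \<in> {a<..b}}"
      by (rule finite_subset[of _ "{1..d} \<rightarrow>\<^sub>E {1..b}"]) (auto intro: finite_PiE)
  qed (use assms in auto)
  also have "{a<..b} \<inter> {1..b} = {a<..b}" by auto
  finally show "card (incr_tuples d b - incr_tuples d a) \<le> (b - a) * b ^ (d - 1)" by simp
  show "real (card (incr_tuples d b - incr_tuples d a)) = real (b choose d) - real (a choose d)"
    using incr_tuples_mono[OF assms(1), of d] assms(1)
    by (subst card_Diff_subset) (auto simp: card_incr_tuples of_nat_diff binomial_right_mono)
qed

text \<open>A union bound over the pairs of positions \<open>i\<close>, \<open>j\<close> with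
  \<open>\<iota> i = \<kappa> j\<close>, each of which pins one coordinate of
  \<open>\<kappa>\<close>.\<close>

lemma card_incr_tuples_meeting:
  "card {\<kappa> \<in> incr_tuples d n. \<iota> ` {1..d} \<inter> \<kappa> ` {1..d} \<noteq> {}} \<le> d\<^sup>2 * n ^ (d - 1)"
proof -
  let ?C = "\<lambda>(i, j). {\<kappa> \<in> {1..d} \<rightarrow>\<^sub>E {1..n}. \<forall>k\<in>{j}. \<kappa> k \<in> {\<iota> i}}"
  have "card {\<kappa> \<in> incr_tuples d n. \<iota> ` {1..d} \<inter> \<kappa> ` {1..d} \<noteq> {}} \<le> card (\<Union>x\<in>{1..d} \<times> {1..d}. ?C x)"
  proof (intro card_mono subsetI)
    show "finite (\<Union>x\<in>{1..d} \<times> {1..d}. ?C x)" by (auto intro!: finite_PiE)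
    fix \<kappa> assume \<kappa>: "\<kappa> \<in> {\<kappa> \<in> incr_tuples d n. \<iota> ` {1..d} \<inter> \<kappa> ` {1..d} \<noteq> {}}"
    then obtain i j where "i \<in> {1..d}" "j \<in> {1..d}" "\<iota> i = \<kappa> j" by blast
    with \<kappa> show "\<kappa> \<in> (\<Union>x\<in>{1..d} \<times> {1..d}. ?C x)"
      by (intro UN_I[of "(i, j)"]) (auto simp: incr_tuples_def)
  qed
  also have "\<dots> \<le> (\<Sum>x\<in>{1..d} \<times> {1..d}. card (?C x))" by (rule card_UN_le) auto
  also have "\<dots> \<le> (\<Sum>x\<in>{1..d} \<times> {1..d}. n ^ (d - 1))"
  proof (rule sum_mono)
    fix x assume "x \<in> {1..d} \<times> {1..d}"
    then obtain i j where x: "x = (i, j)" and j: "j \<in> {1..d}" by auto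
    have "card (?C x) \<le> (\<Prod>k\<in>{j}. card ({\<iota> i} \<inter> {1..n})) * n ^ (d - card {j})"
      unfolding x using j by (simp only: split) (rule card_PiE_constrained, auto)
    also have "\<dots> \<le> 1 * n ^ (d - 1)"
      using card_mono[of "{\<iota> i}" "{\<iota> i} \<inter> {1..n}"] by (intro mult_mono) auto
    finally show "card (?C x) \<le> n ^ (d - 1)" by simp
  qed
  finally show ?thesis by (simp add: power2_eq_square)
qed

text \<open>Two common indices pin two coordinates of \<open>\<kappa>\<close>, with at most
  \<open>d ^ 4\<close> choices of the positions. The factor \<open>n\<^sup>2\<close> stands on the
  left to avoid the exponent \<open>d - 2\<close>, which is truncated for
  \<open>d = 1\<close>.\<close>

lemma card_incr_tuples_meeting_twice:
  "card {\<kappa> \<in> incr_tuples d n. \<not> card (\<iota> ` {1..d} \<inter> \<kappa> ` {1..d}) \<le> 1} * n\<^sup>2 \<le> d ^ 4 * n ^ d"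
proof -
  let ?J = "{1..d} \<times> {1..d}"
  let ?I = "{x \<in> ?J. fst x \<noteq> snd x}"
  let ?C = "\<lambda>((i, i'), (j, j')). {\<kappa> \<in> {1..d} \<rightarrow>\<^sub>E {1..n}. \<forall>k\<in>{j, j'}. \<kappa> k \<in> (if k = j then {\<iota> i} else {\<iota> i'})}"
  have "card {\<kappa> \<in> incr_tuples d n. \<not> card (\<iota> ` {1..d} \<inter> \<kappa> ` {1..d}) \<le> 1} \<le> card (\<Union>x\<in>?J \<times> ?I. ?C x)"
  proof (intro card_mono subsetI)
    show "finite (\<Union>x\<in>?J \<times> ?I. ?C x)"
      by (intro finite_UN_I) (auto intro!: finite_PiE)
    fix \<kappa> assume \<kappa>: "\<kappa> \<in> {\<kappa> \<in> incr_tuples d n. \<not> card (\<iota> ` {1..d} \<inter> \<kappa> ` {1..d}) \<le> 1}"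
    then have "\<not> (\<forall>u\<in>\<iota> ` {1..d} \<inter> \<kappa> ` {1..d}. \<forall>v\<in>\<iota> ` {1..d} \<inter> \<kappa> ` {1..d}. u = v)"
      using card_le_Suc0_iff_eq[of "\<iota> ` {1..d} \<inter> \<kappa> ` {1..d}"] by auto
    then obtain u v where "u \<in> \<iota> ` {1..d} \<inter> \<kappa> ` {1..d}" "v \<in> \<iota> ` {1..d} \<inter> \<kappa> ` {1..d}" "u \<noteq> v"
      by auto
    then obtain i j i' j' where "i \<in> {1..d}" "j \<in> {1..d}" "i' \<in> {1..d}" "j' \<in> {1..d}"
      "\<iota> i = \<kappa> j" "\<iota> i' = \<kappa> j'" "j \<noteq> j'" by (elim IntE imageE) metis
    with \<kappa> show "\<kappa> \<in> (\<Union>x\<in>?J \<times> ?I. ?C x)"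
      by (intro UN_I[of "((i, i'), (j, j'))"]) (auto simp: incr_tuples_def)
  qed
  also have "\<dots> \<le> (\<Sum>x\<in>?J \<times> ?I. card (?C x))" by (rule card_UN_le) auto
  finally have "card {\<kappa> \<in> incr_tuples d n. \<not> card (\<iota> ` {1..d} \<inter> \<kappa> ` {1..d}) \<le> 1} * n\<^sup>2 \<le>
     (\<Sum>x\<in>?J \<times> ?I. card (?C x)) * n\<^sup>2" by (rule mult_right_mono) simp
  also have "\<dots> = (\<Sum>x\<in>?J \<times> ?I. card (?C x) * n\<^sup>2)" by (rule sum_distrib_right)
  also have "\<dots> \<le> (\<Sum>x\<in>?J \<times> ?I. n ^ d)"
  proof (rule sum_mono)
    fix x assume "x \<in> ?J \<times> ?I"
    then obtain i i' j j' where x: "x = ((i, i'), (j, j'))" and j: "j \<in> {1..d}" "j' \<in> {1..d}" "j \<noteq> j'"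
      by auto
    have "d \<ge> 2" using j by auto
    let ?D = "\<lambda>k. if k = j then {\<iota> i} else {\<iota> i'}"
    have "card (?C x) \<le> (\<Prod>k\<in>{j, j'}. card (?D k \<inter> {1..n})) * n ^ (d - card {j, j'})"
      unfolding x using j by (simp only: split) (rule card_PiE_constrained, auto)
    also have "\<dots> \<le> 1 * n ^ (d - 2)"
    proof (rule mult_mono)
      have "card ({c} \<inter> {1..n}) \<le> 1" for c using card_mono[of "{c}" "{c} \<inter> {1..n}"] by auto
      then show "(\<Prod>k\<in>{j, j'}. card (?D k \<inter> {1..n})) \<le> 1" by (intro prod_le_1) auto
      show "n ^ (d - card {j, j'}) \<le> n ^ (d - 2)" using j by (simp add: numeral_2_eq_2)
    qed auto
    finally have "card (?C x) * n\<^sup>2 \<le> n ^ (d - 2) * n\<^sup>2" by (intro mult_right_mono) auto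
    also have "\<dots> = n ^ d" using \<open>d \<ge> 2\<close> by (metis le_add_diff_inverse2 power_add)
    finally show "card (?C x) * n\<^sup>2 \<le> n ^ d" .
  qed
  also have "\<dots> \<le> d ^ 4 * n ^ d"
  proof -
    have "card (?J \<times> ?I) \<le> card (?J \<times> ?J)" by (intro card_mono) auto
    also have "\<dots> = d ^ 4" by (simp add: eval_nat_numeral)
    finally show ?thesis by simp
  qed
  finally show ?thesis .
qed

text \<open>Absorbing one factor in each binomial shows that their quotient is at most
  \<open>a / b\<close>, and \<open>b choose d\<close> is at least \<open>(b / d) ^ d\<close>. The
  bound is expressed through the upper end \<open>b\<close>, so it keeps the right order however
  small \<open>a\<close> is.\<close>

lemma choose_diff_ge:
  assumes "a \<le> b" "d \<le> b" "d \<ge> 1"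
  shows "real (b choose d) - real (a choose d) \<ge> real (b - a) * real b ^ (d - 1) / real d ^ d"
proof -
  have "real b > 0" using assms by simp
  have "real (a choose d) \<le> real a / real b * real (b choose d)"
  proof (cases "a = 0")
    case False
    obtain e where e: "d = Suc e" using assms by (cases d) auto
    obtain a' b' where ab: "a = Suc a'" "b = Suc b'" using assms False by (cases a; cases b) auto
    have "real (Suc e * (Suc a' choose Suc e)) = real (Suc a' * (a' choose e))"
      by (subst Suc_times_binomial_eq) (simp add: mult.commute)
    then have 1: "real (Suc e) * real (a choose d) = real a * real (a' choose e)"
      by (simp only: ab e of_nat_mult)
    have "real (Suc e * (Suc b' choose Suc e)) = real (Suc b' * (b' choose e))"
      by (subst Suc_times_binomial_eq) (simp add: mult.commute)
    then have 2: "real (Suc e) * real (b choose d) = real b * real (b' choose e)"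
      by (simp only: ab e of_nat_mult)
    have "real (a' choose e) \<le> real (b' choose e)"
      using assms ab by (intro of_nat_mono binomial_right_mono) simp
    then have "real (Suc e) * real (a choose d) \<le> real a * (real (Suc e) * real (b choose d) / real b)"
      unfolding 1 2 using \<open>real b > 0\<close> by (simp add: mult_left_mono)
    also have "\<dots> = real (Suc e) * (real a / real b * real (b choose d))" by simp
    finally show ?thesis by (subst (asm) mult_le_cancel_left) simp
  qed (use assms in auto)
  then have "real (b choose d) - real (a choose d) \<ge> (1 - real a / real b) * real (b choose d)"
    by (simp add: algebra_simps)
  moreover have "(1 - real a / real b) * real (b choose d) \<ge> (1 - real a / real b) * (real b / real d) ^ d"
    using binomial_ge_n_over_k_pow_k[of d b, where 'a = real] assms
    by (intro mult_left_mono) (auto simp: divide_simps)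
  moreover have "(1 - real a / real b) * (real b / real d) ^ d = real (b - a) * real b ^ (d - 1) / real d ^ d"
  proof -
    have "real b ^ d = real b * real b ^ (d - 1)" using assms by (cases d) auto
    then show ?thesis using assms \<open>real b > 0\<close> by (simp add: field_simps of_nat_diff power_divide)
  qed
  ultimately show ?thesis by linarith
qed

text \<open>The binomial times \<open>fact p\<close> is a falling factorial, which for
  \<open>p \<le> x\<close> lies between \<open>(x - p) ^ p\<close> and \<open>x ^ p\<close>;
  Bernoulli's inequality bounds the difference. The error is uniform in \<open>x \<le> n\<close>, as
  the later sums over all \<open>k < n\<close> require.\<close>

lemma fact_mult_choose_approx:
  assumes "x \<le> n" "n > 0"
  shows "fact p * real (x choose p) / real n ^ p \<le> 1"
    and "\<bar>fact p * real (x choose p) / real n ^ p - (real x / real n) ^ p\<bar> \<le> real p ^ 2 / real n"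
proof -
  have up: "fact p * real (x choose p) \<le> real x ^ p" for x
    using binomial_fact_pow[of x p] by (metis mult.commute of_nat_fact of_nat_le_iff of_nat_mult of_nat_power)
  have xn: "real x ^ p \<le> real n ^ p" using assms by (intro power_mono) auto
  show "fact p * real (x choose p) / real n ^ p \<le> 1"
    using up[of x] xn assms by (simp add: divide_simps)
  have lo: "real x ^ p - fact p * real (x choose p) \<le> real p ^ 2 * real n ^ (p - 1)"
  proof (cases "p \<le> x \<and> p > 0")
    case True
    then have xpos: "real x > 0" by auto
    have "fact p * real (x choose p) = (\<Prod>i<p. real x - real i)"
      by (simp add: gbinomial_prod_rev binomial_gbinomial atLeast0LessThan)
    also have "\<dots> \<ge> (\<Prod>i<p. real x - real p)"
      using True by (intro prod_mono) auto
    finally have "fact p * real (x choose p) \<ge> (real x - real p) ^ p" by simp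
    moreover have "(1 + (- real p / real x)) ^ p \<ge> 1 + real p * (- real p / real x)"
      using True by (intro Bernoulli_inequality) (auto simp: divide_simps)
    then have "real x ^ p * (1 - real p / real x) ^ p \<ge> real x ^ p * (1 - real p * (real p / real x))"
      by (intro mult_left_mono) auto
    then have "(real x - real p) ^ p \<ge> real x ^ p - real p ^ 2 * (real x ^ p / real x)"
      using xpos by (simp flip: power_mult_distrib add: algebra_simps power2_eq_square)
    moreover have "real x ^ p / real x = real x ^ (p - 1)" using True xpos by (cases p) auto
    moreover have "real p ^ 2 * real x ^ (p - 1) \<le> real p ^ 2 * real n ^ (p - 1)"
      using assms by (intro mult_left_mono power_mono) auto
    ultimately show ?thesis by (smt (verit))
  next
    case False
    show ?thesis
    proof (cases "p = 0")
      case False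
      with \<open>\<not> (p \<le> x \<and> p > 0)\<close> have "x < p" by auto
      \<comment> \<open>For \<open>x < p\<close> the power \<open>x ^ p\<close> alone is within the
        error bound, so the binomial term is dropped.\<close>
      have "real x ^ p = real x * real x ^ (p - 1)" using False by (cases p) auto
      also have "\<dots> \<le> real p ^ 2 * real n ^ (p - 1)"
      proof (intro mult_mono power_mono)
        have "real x \<le> real p * 1" using \<open>x < p\<close> by simp
        also have "\<dots> \<le> real p * real p" using False by (intro mult_left_mono) auto
        finally show "real x \<le> real p ^ 2" by (simp add: power2_eq_square)
      qed (use assms in auto)
      finally show ?thesis by (rule order.trans[rotated]) simp
    qed simp
  qed
  have "\<bar>fact p * real (x choose p) - real x ^ p\<bar> \<le> real p ^ 2 * real n ^ (p - 1)"
    using up[of x] lo by simp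
  moreover have "\<bar>fact p * real (x choose p) / real n ^ p - (real x / real n) ^ p\<bar>
     = \<bar>fact p * real (x choose p) - real x ^ p\<bar> / real n ^ p"
    using assms by (simp add: power_divide diff_divide_distrib[symmetric])
  moreover have "real p ^ 2 * real n ^ (p - 1) / real n ^ p = real p ^ 2 / real n"
    using assms by (cases p) auto
  ultimately show "\<bar>fact p * real (x choose p) / real n ^ p - (real x / real n) ^ p\<bar> \<le> real p ^ 2 / real n"
    using assms by (metis divide_right_mono of_nat_0_le_iff zero_le_power)
qed

section \<open>Kernels evaluated at index tuples\<close>

lemma abs_mult_le_squares: "\<bar>a * b\<bar> \<le> (a\<^sup>2 + b\<^sup>2) / 2" for a b :: real
  using sum_squares_bound[of "\<bar>a\<bar>" "\<bar>b\<bar>"] by (simp add: abs_mult)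

locale iid_sequence = prob_space M for M :: "'a measure" +
  fixes S :: "'s measure" and X :: "nat \<Rightarrow> 'a \<Rightarrow> 's" and d :: nat
  assumes iid: "iid M S X" and d_pos: "d \<ge> 1"
begin

declare One_nat_def [simp del]

abbreviation PS :: "(nat \<Rightarrow> 's) measure" where "PS \<equiv> Pi\<^sub>M {1..d} (\<lambda>_. S)"

definition tup :: "(nat \<Rightarrow> nat) \<Rightarrow> 'a \<Rightarrow> nat \<Rightarrow> 's" where
  "tup \<iota> \<omega> = (\<lambda>k\<in>{1..d}. X (\<iota> k) \<omega>)"

text \<open>The joint law of \<open>d\<close> distinct observations. All expectations of kernels are
  computed under \<open>Q\<close>, so that the index tuple at which a kernel is evaluated
  disappears.\<close>

definition Q :: "(nat \<Rightarrow> 's) measure" where "Q = distr M PS (tup (\<lambda>k. k))"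

lemma indep_X: "indep_vars (\<lambda>_. S) X UNIV"
  and distr_X: "distr M S (X i) = distr M S (X 0)"
  using iid by (auto simp: iid_def)

lemma measurable_X [measurable]: "X i \<in> measurable M S"
  using indep_X by (auto simp: indep_vars_def)

lemma measurable_tup [measurable]: "tup \<iota> \<in> measurable M PS"
  unfolding tup_def by measurable

lemma sets_Q [measurable_cong]: "sets Q = sets PS"
  and space_Q: "space Q = space PS"
  by (auto simp: Q_def)

lemma indep_X_reindex:
  assumes inj: "inj_on \<iota> I"
  shows "indep_vars (\<lambda>_. S) (\<lambda>j. X (\<iota> j)) I"
proof -
  have "indep_vars (\<lambda>j. PiM {\<iota> j} (\<lambda>_. S)) (\<lambda>j \<omega>. restrict (\<lambda>i. X i \<omega>) {\<iota> j}) I"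
    using inj by (intro indep_vars_restrict[OF indep_X]) (auto simp: disjoint_family_on_def dest: inj_onD)
  then have "indep_vars (\<lambda>_. S) (\<lambda>j \<omega>. (\<lambda>x. x (\<iota> j)) (restrict (\<lambda>i. X i \<omega>) {\<iota> j})) I"
    by (rule indep_vars_compose2) auto
  then show ?thesis by simp
qed

text \<open>Stated for injective instead of increasing \<open>\<iota>\<close>, because tuples with
  one index overwritten occur below.\<close>

lemma distr_tup:
  assumes "inj_on \<iota> {1..d}"
  shows "distr M PS (tup \<iota>) = Q"
proof -
  have *: "distr M PS (tup \<iota>) = (\<Pi>\<^sub>M i\<in>{1..d}. distr M S (X 0))" if "inj_on \<iota> {1..d}" for \<iota>
    using indep_X_reindex[OF that] d_pos unfolding tup_def
    by (subst (asm) indep_vars_iff_distr_eq_PiM') (auto simp: distr_X[of "\<iota> _"])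
  show ?thesis using *[OF assms] *[of "\<lambda>k. k"] by (simp add: Q_def)
qed

sublocale Q: prob_space Q
  unfolding Q_def by (rule prob_space_distr) measurable

sublocale QQ: pair_prob_space Q Q ..

lemma distr_tup_pair:
  assumes "inj_on \<iota> {1..d}" "inj_on \<kappa> {1..d}" "\<iota> ` {1..d} \<inter> \<kappa> ` {1..d} = {}"
  shows "distr M (PS \<Otimes>\<^sub>M PS) (\<lambda>\<omega>. (tup \<iota> \<omega>, tup \<kappa> \<omega>)) = Q \<Otimes>\<^sub>M Q"
proof -
  have sel: "(\<lambda>x. \<lambda>k\<in>{1..d}. x (\<iota> k)) \<in> PiM (\<iota> ` {1..d}) (\<lambda>_. S) \<rightarrow>\<^sub>M PS" for \<iota> :: "nat \<Rightarrow> nat"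
    by (rule measurable_restrict) (auto intro!: measurable_component_singleton)
  have eq: "(\<lambda>x. \<lambda>k\<in>{1..d}. x (\<iota> k)) \<circ> (\<lambda>\<omega>. restrict (\<lambda>i. X i \<omega>) (\<iota> ` {1..d})) = tup \<iota>" for \<iota>
    by (auto simp: tup_def fun_eq_iff restrict_def)
  have "indep_var PS (tup \<iota>) PS (tup \<kappa>)"
    using indep_var_compose[OF indep_var_restrict[OF indep_X assms(3)] sel[of \<iota>] sel[of \<kappa>]]
    by (simp only: eq subset_UNIV)
  then have "distr M PS (tup \<iota>) \<Otimes>\<^sub>M distr M PS (tup \<kappa>) = distr M (PS \<Otimes>\<^sub>M PS) (\<lambda>x. (tup \<iota> x, tup \<kappa> x))"
    by (simp add: indep_var_distribution_eq)
  then show ?thesis by (simp only: distr_tup assms)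
qed

section \<open>Square-integrable kernels and second moments of their sums over tuples\<close>

definition sqi :: "((nat \<Rightarrow> 's) \<Rightarrow> real) \<Rightarrow> bool" where
  "sqi g \<longleftrightarrow> g \<in> borel_measurable PS \<and> integrable Q (\<lambda>y. (g y)\<^sup>2)"

lemma sqi_measurable [measurable_dest]: "sqi g \<Longrightarrow> g \<in> borel_measurable PS"
  and sqi_square: "sqi g \<Longrightarrow> integrable Q (\<lambda>y. (g y)\<^sup>2)"
  by (auto simp: sqi_def)

lemma sqi_measurable_Q: "sqi g \<Longrightarrow> g \<in> borel_measurable Q"
  using sqi_measurable measurable_cong_sets[OF sets_Q refl] by blast

lemma sqi_mult:
  assumes "sqi g" "sqi h" shows "integrable Q (\<lambda>y. g y * h y)"
proof (rule Bochner_Integration.integrable_bound)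
  show "integrable Q (\<lambda>y. (g y)\<^sup>2 + (h y)\<^sup>2)" using assms by (auto intro: sqi_square)
  show "(\<lambda>y. g y * h y) \<in> borel_measurable Q"
    using assms by (auto dest: sqi_measurable_Q)
  show "AE y in Q. norm (g y * h y) \<le> norm ((g y)\<^sup>2 + (h y)\<^sup>2)"
  proof (rule AE_I2)
    fix y
    show "norm (g y * h y) \<le> norm ((g y)\<^sup>2 + (h y)\<^sup>2)"
      using abs_mult_le_squares[of "g y" "h y"] by simp
  qed
qed

lemma sqi_const [simp]: "sqi (\<lambda>_. c)" by (simp add: sqi_def)

lemma sqi_integrable: "sqi g \<Longrightarrow> integrable Q g"
  using sqi_mult[of g "\<lambda>_. 1"] by simp

lemma sqi_scale [intro]: "sqi g \<Longrightarrow> sqi (\<lambda>y. c * g y)"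
  by (auto simp: sqi_def power_mult_distrib)

lemma sqi_add [intro]:
  assumes "sqi g" "sqi h" shows "sqi (\<lambda>y. g y + h y)"
  using assms sqi_mult[OF assms] unfolding sqi_def
  by (auto simp: power2_sum mult.assoc)

lemma sqi_diff [intro]: "sqi g \<Longrightarrow> sqi h \<Longrightarrow> sqi (\<lambda>y. g y - h y)"
  using sqi_add[of g "\<lambda>y. (-1) * h y"] sqi_scale[of h "-1"] by simp

lemma sqi_sum [intro]: "(\<And>i. i \<in> A \<Longrightarrow> sqi (g i)) \<Longrightarrow> sqi (\<lambda>y. \<Sum>i\<in>A. g i y)"
  by (induction A rule: infinite_finite_induct) auto

lemma integral_tup:
  assumes "g \<in> borel_measurable PS" "inj_on \<iota> {1..d}"
  shows "(\<integral>\<omega>. g (tup \<iota> \<omega>) \<partial>M) = integral\<^sup>L Q (g :: _ \<Rightarrow> real)"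
  using assms by (simp flip: distr_tup[OF assms(2)] add: integral_distr)

lemma integrable_tup:
  assumes "g \<in> borel_measurable PS" "inj_on \<iota> {1..d}"
  shows "integrable M (\<lambda>\<omega>. g (tup \<iota> \<omega>) :: real) \<longleftrightarrow> integrable Q g"
  using assms by (simp flip: distr_tup[OF assms(2)] add: integrable_distr_eq)

text \<open>By |ab| \<le> (a^2 + b^2)/2 the product is controlled by two squares, each a function of
  a single tuple with law \<open>Q\<close>; the bound does not depend on how the two tuples
  overlap.\<close>

lemma integrable_tup_mult:
  assumes g: "sqi g" and h: "sqi h" and inj: "inj_on \<iota> {1..d}" "inj_on \<kappa> {1..d}"
  shows "integrable M (\<lambda>\<omega>. g (tup \<iota> \<omega>) * h (tup \<kappa> \<omega>))"
    and "\<bar>\<integral>\<omega>. g (tup \<iota> \<omega>) * h (tup \<kappa> \<omega>) \<partial>M\<bar> \<le> ((\<integral>y. (g y)\<^sup>2 \<partial>Q) + (\<integral>y. (h y)\<^sup>2 \<partial>Q)) / 2"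
proof -
  note [measurable] = sqi_measurable[OF g] sqi_measurable[OF h]
  have ig: "integrable M (\<lambda>\<omega>. (g (tup \<iota> \<omega>))\<^sup>2)" and ih: "integrable M (\<lambda>\<omega>. (h (tup \<kappa> \<omega>))\<^sup>2)"
    using integrable_tup[of "\<lambda>y. (g y)\<^sup>2" \<iota>] integrable_tup[of "\<lambda>y. (h y)\<^sup>2" \<kappa>] inj g h
    by (auto dest: sqi_square)
  show int: "integrable M (\<lambda>\<omega>. g (tup \<iota> \<omega>) * h (tup \<kappa> \<omega>))"
  proof (rule Bochner_Integration.integrable_bound)
    show "integrable M (\<lambda>\<omega>. ((g (tup \<iota> \<omega>))\<^sup>2 + (h (tup \<kappa> \<omega>))\<^sup>2) / 2)" using ig ih by auto
    show "AE \<omega> in M. norm (g (tup \<iota> \<omega>) * h (tup \<kappa> \<omega>)) \<le> norm (((g (tup \<iota> \<omega>))\<^sup>2 + (h (tup \<kappa> \<omega>))\<^sup>2) / 2)"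
      using abs_mult_le_squares by (intro AE_I2) simp
  qed measurable
  have "\<bar>\<integral>\<omega>. g (tup \<iota> \<omega>) * h (tup \<kappa> \<omega>) \<partial>M\<bar> \<le> (\<integral>\<omega>. \<bar>g (tup \<iota> \<omega>) * h (tup \<kappa> \<omega>)\<bar> \<partial>M)"
    by (rule integral_abs_bound)
  also have "\<dots> \<le> (\<integral>\<omega>. ((g (tup \<iota> \<omega>))\<^sup>2 + (h (tup \<kappa> \<omega>))\<^sup>2) / 2 \<partial>M)"
    using int ig ih abs_mult_le_squares by (intro integral_mono) auto
  also have "\<dots> = ((\<integral>y. (g y)\<^sup>2 \<partial>Q) + (\<integral>y. (h y)\<^sup>2 \<partial>Q)) / 2"
    using ig ih integral_tup[of "\<lambda>y. (g y)\<^sup>2" \<iota>] integral_tup[of "\<lambda>y. (h y)\<^sup>2" \<kappa>] inj by simp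
  finally show "\<bar>\<integral>\<omega>. g (tup \<iota> \<omega>) * h (tup \<kappa> \<omega>) \<partial>M\<bar> \<le> ((\<integral>y. (g y)\<^sup>2 \<partial>Q) + (\<integral>y. (h y)\<^sup>2 \<partial>Q)) / 2" .
qed

text \<open>\<open>R\<close> marks the pairs that may be correlated. When the square is expanded,
  the other pairs vanish and every marked pair contributes at most the second moment of
  \<open>g\<close>, so the number \<open>N\<close> of partners decides the order. It is applied to
  tuples that meet, for a centred kernel, and to tuples that meet at least twice, for a degenerate
  one.\<close>

lemma second_moment_sum_tup:
  assumes g: "sqi g" and T: "finite T" "\<And>\<iota>. \<iota> \<in> T \<Longrightarrow> inj_on \<iota> {1..d}"
    and zero: "\<And>\<iota> \<kappa>. \<iota> \<in> T \<Longrightarrow> \<kappa> \<in> T \<Longrightarrow> \<not> R \<iota> \<kappa> \<Longrightarrow> (\<integral>\<omega>. g (tup \<iota> \<omega>) * g (tup \<kappa> \<omega>) \<partial>M) = 0"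
    and N: "\<And>\<iota>. \<iota> \<in> T \<Longrightarrow> real (card {\<kappa>\<in>T. R \<iota> \<kappa>}) \<le> N"
  shows "integrable M (\<lambda>\<omega>. (\<Sum>\<iota>\<in>T. g (tup \<iota> \<omega>))\<^sup>2)"
    and "(\<integral>\<omega>. (\<Sum>\<iota>\<in>T. g (tup \<iota> \<omega>))\<^sup>2 \<partial>M) \<le> real (card T) * N * (\<integral>y. (g y)\<^sup>2 \<partial>Q)"
proof -
  let ?V = "\<integral>y. (g y)\<^sup>2 \<partial>Q"
  have V: "?V \<ge> 0" by simp
  have eq: "(\<Sum>\<iota>\<in>T. g (tup \<iota> \<omega>))\<^sup>2 = (\<Sum>\<iota>\<in>T. \<Sum>\<kappa>\<in>T. g (tup \<iota> \<omega>) * g (tup \<kappa> \<omega>))" for \<omega>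
    by (simp add: power2_eq_square sum_product)
  show "integrable M (\<lambda>\<omega>. (\<Sum>\<iota>\<in>T. g (tup \<iota> \<omega>))\<^sup>2)"
    unfolding eq using T g by (intro Bochner_Integration.integrable_sum integrable_tup_mult) auto
  have "(\<integral>\<omega>. (\<Sum>\<iota>\<in>T. g (tup \<iota> \<omega>))\<^sup>2 \<partial>M) = (\<Sum>\<iota>\<in>T. \<Sum>\<kappa>\<in>T. \<integral>\<omega>. g (tup \<iota> \<omega>) * g (tup \<kappa> \<omega>) \<partial>M)"
    unfolding eq using T g
    by (subst Bochner_Integration.integral_sum; (intro Bochner_Integration.integrable_sum integrable_tup_mult sum.cong refl)?)
       (auto intro!: Bochner_Integration.integral_sum integrable_tup_mult)
  also have "\<dots> \<le> (\<Sum>\<iota>\<in>T. \<Sum>\<kappa>\<in>T. if R \<iota> \<kappa> then ?V else 0)"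
  proof (intro sum_mono)
    fix \<iota> \<kappa> assume "\<iota> \<in> T" "\<kappa> \<in> T"
    then show "(\<integral>\<omega>. g (tup \<iota> \<omega>) * g (tup \<kappa> \<omega>) \<partial>M) \<le> (if R \<iota> \<kappa> then ?V else 0)"
      using integrable_tup_mult(2)[OF g g T(2) T(2), of \<iota> \<kappa>] zero[of \<iota> \<kappa>] by auto
  qed
  also have "\<dots> = (\<Sum>\<iota>\<in>T. real (card {\<kappa>\<in>T. R \<iota> \<kappa>}) * ?V)"
    using T by (simp add: sum.If_cases Int_def)
  also have "\<dots> \<le> (\<Sum>\<iota>\<in>T. N * ?V)"
    using N V by (intro sum_mono mult_right_mono) auto
  finally show "(\<integral>\<omega>. (\<Sum>\<iota>\<in>T. g (tup \<iota> \<omega>))\<^sup>2 \<partial>M) \<le> real (card T) * N * ?V" by simp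
qed

section \<open>Replacing one argument of a kernel by an independent copy\<close>

lemma measurable_upd:
  assumes "i \<in> {1..d}" "j \<in> {1..d}"
  shows "(\<lambda>(w, y). y(i := w j)) \<in> PS \<Otimes>\<^sub>M PS \<rightarrow>\<^sub>M PS"
  unfolding split_beta
  using assms by (intro measurable_fun_upd[where J = "{1..d}"]) auto

text \<open>The copy \<open>w\<close> is realised by the indices d + 1, ..., 2d, disjoint from 1,
  ..., d. Overwriting position \<open>i\<close> leaves a tuple of distinct indices, hence again the
  law \<open>Q\<close>.\<close>

lemma distr_upd:
  assumes "i \<in> {1..d}" "j \<in> {1..d}"
  shows "distr (Q \<Otimes>\<^sub>M Q) PS (\<lambda>(w, y). y(i := w j)) = Q"
proof -
  let ?\<kappa> = "\<lambda>k. d + k"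
  have "distr (Q \<Otimes>\<^sub>M Q) PS (\<lambda>(w, y). y(i := w j)) =
    distr (distr M (PS \<Otimes>\<^sub>M PS) (\<lambda>\<omega>. (tup ?\<kappa> \<omega>, tup (\<lambda>k. k) \<omega>))) PS (\<lambda>(w, y). y(i := w j))"
    by (subst distr_tup_pair) auto
  also have "\<dots> = distr M PS ((\<lambda>(w, y). y(i := w j)) \<circ> (\<lambda>\<omega>. (tup ?\<kappa> \<omega>, tup (\<lambda>k. k) \<omega>)))"
    using assms by (intro distr_distr measurable_upd) measurable
  also have "((\<lambda>(w, y). y(i := w j)) \<circ> (\<lambda>\<omega>. (tup ?\<kappa> \<omega>, tup (\<lambda>k. k) \<omega>))) = tup ((\<lambda>k. k)(i := d + j))"
    using assms by (auto simp: tup_def fun_eq_iff)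
  also have "distr M PS \<dots> = Q"
    using assms by (intro distr_tup) (auto intro!: inj_onI split: if_splits)
  finally show ?thesis .
qed

lemma sets_QQ: "sets (Q \<Otimes>\<^sub>M Q) = sets (PS \<Otimes>\<^sub>M PS)"
  by (intro sets_pair_measure_cong sets_Q)

text \<open>Fubini's theorem for the pair of \<open>w\<close> and \<open>y\<close>: the inner
  integral is the conditional expectation of the kernel given its \<open>i\<close>-th argument.
  Inner integrability holds only almost everywhere, and degeneracy is stated in the same sense
  later.\<close>

lemma upd_transfer:
  assumes "i \<in> {1..d}" "j \<in> {1..d}" and g: "integrable Q g" and [measurable]: "g \<in> borel_measurable PS"
  shows "integrable (Q \<Otimes>\<^sub>M Q) (\<lambda>(w, y). g (y(i := w j)) :: real)"
    and "(\<integral>w. \<integral>y. g (y(i := w j)) \<partial>Q \<partial>Q) = integral\<^sup>L Q g"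
    and "AE w in Q. integrable Q (\<lambda>y. g (y(i := w j)))"
    and "integrable Q (\<lambda>w. \<integral>y. g (y(i := w j)) \<partial>Q)"
proof -
  have m: "(\<lambda>(w, y). y(i := w j)) \<in> Q \<Otimes>\<^sub>M Q \<rightarrow>\<^sub>M PS"
    using measurable_upd[OF assms(1,2)] measurable_cong_sets[OF sets_QQ refl] by blast
  show *: "integrable (Q \<Otimes>\<^sub>M Q) (\<lambda>(w, y). g (y(i := w j)))"
    using g integrable_distr_eq[OF m assms(4)] unfolding distr_upd[OF assms(1,2)] by (simp add: case_prod_beta')
  show "AE w in Q. integrable Q (\<lambda>y. g (y(i := w j)))"
    using QQ.AE_integrable_fst'[OF *] by simp
  show "integrable Q (\<lambda>w. \<integral>y. g (y(i := w j)) \<partial>Q)"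
    using QQ.integrable_fst'[OF *] by simp
  have "(\<integral>w. \<integral>y. g (y(i := w j)) \<partial>Q \<partial>Q) = (\<integral>p. (case p of (w, y) \<Rightarrow> g (y(i := w j))) \<partial>(Q \<Otimes>\<^sub>M Q))"
    using QQ.integral_fst'[OF *] by simp
  also have "\<dots> = integral\<^sup>L Q g"
    using integral_distr[OF m assms(4)] unfolding distr_upd[OF assms(1,2)] by (simp add: case_prod_beta')
  finally show "(\<integral>w. \<integral>y. g (y(i := w j)) \<partial>Q \<partial>Q) = integral\<^sup>L Q g" .
qed

lemma integral_tup_mult_disjoint:
  assumes g: "sqi g" and "integral\<^sup>L Q g = 0"
    and inj: "inj_on \<iota> {1..d}" "inj_on \<kappa> {1..d}" "\<iota> ` {1..d} \<inter> \<kappa> ` {1..d} = {}"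
  shows "(\<integral>\<omega>. g (tup \<iota> \<omega>) * g (tup \<kappa> \<omega>) \<partial>M) = 0"
proof -
  note [measurable] = sqi_measurable[OF g]
  have "integrable (Q \<Otimes>\<^sub>M Q) (\<lambda>p. g (fst p) * g (snd p))"
    using integrable_tup_mult(1)[OF g g inj(1,2)]
    by (subst distr_tup_pair[OF inj, symmetric], subst integrable_distr_eq) auto
  then have "(\<integral>w. \<integral>y. g w * g y \<partial>Q \<partial>Q) = (\<integral>p. g (fst p) * g (snd p) \<partial>(Q \<Otimes>\<^sub>M Q))"
    using QQ.integral_fst'[of "\<lambda>p. g (fst p) * g (snd p)"] by simp
  also have "\<dots> = (\<integral>\<omega>. g (tup \<iota> \<omega>) * g (tup \<kappa> \<omega>) \<partial>M)"
    by (subst distr_tup_pair[OF inj, symmetric], subst integral_distr) auto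
  finally show ?thesis using assms by simp
qed

lemma integral_tup_mult_degenerate:
  assumes g: "sqi g" and ij: "i \<in> {1..d}" "j \<in> {1..d}"
    and degen: "AE w in Q. (\<integral>y. g (y(i := w j)) \<partial>Q) = 0"
    and inj: "inj_on \<iota> {1..d}" "inj_on \<kappa> {1..d}" "\<iota> ` {1..d} \<inter> \<kappa> ` {1..d} = {\<iota> i}" "\<iota> i = \<kappa> j"
    and pos: "0 \<notin> \<iota> ` {1..d}" "0 \<notin> \<kappa> ` {1..d}"
  shows "(\<integral>\<omega>. g (tup \<iota> \<omega>) * g (tup \<kappa> \<omega>) \<partial>M) = 0"
proof -
  note [measurable] = sqi_measurable[OF g]
  txt \<open>\<open>X 0\<close> occurs in neither tuple, so it can replace the shared variable and decouple them.\<close>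
  let ?\<iota> = "\<iota>(i := 0)"
  have disj: "\<kappa> ` {1..d} \<inter> ?\<iota> ` {1..d} = {}"
  proof (rule equals0I)
    fix x assume "x \<in> \<kappa> ` {1..d} \<inter> ?\<iota> ` {1..d}"
    then obtain b where b: "b \<in> {1..d}" "x = ?\<iota> b" "x \<in> \<kappa> ` {1..d}" by blast
    then have "b \<noteq> i" using pos(2) by auto
    with b have "x = \<iota> b" by simp
    then have "\<iota> b \<in> \<iota> ` {1..d} \<inter> \<kappa> ` {1..d}" using b(1,3) by auto
    then have "\<iota> b = \<iota> i" using inj(3) by blast
    then show False using inj_onD[OF inj(1) _ b(1) ij(1)] \<open>b \<noteq> i\<close> by simp
  qed
  have "inj_on ?\<iota> {1..d}"
    by (rule inj_on_fun_updI[OF inj(1) pos(1)])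
  note inj' = inj(2) this disj
  \<comment> \<open>Position \<open>i\<close> gets back the observation shared with
    \<open>\<kappa>\<close>, because \<open>\<iota> i = \<kappa> j\<close>.\<close>
  have eq: "(tup ?\<iota> \<omega>)(i := tup \<kappa> \<omega> j) = tup \<iota> \<omega>" for \<omega>
    using ij inj by (auto simp: tup_def fun_eq_iff)
  have [measurable]: "(\<lambda>p. (snd p)(i := fst p j)) \<in> PS \<Otimes>\<^sub>M PS \<rightarrow>\<^sub>M PS"
    using measurable_upd[OF ij] by (simp add: case_prod_beta')
  have "integrable (Q \<Otimes>\<^sub>M Q) (\<lambda>p. g ((snd p)(i := fst p j)) * g (fst p))"
    using integrable_tup_mult(1)[OF g g inj(1,2)]
    by (subst distr_tup_pair[OF inj', symmetric], subst integrable_distr_eq) (auto simp: eq)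
  then have "(\<integral>w. \<integral>y. g (y(i := w j)) * g w \<partial>Q \<partial>Q) = (\<integral>p. g ((snd p)(i := fst p j)) * g (fst p) \<partial>(Q \<Otimes>\<^sub>M Q))"
    using QQ.integral_fst'[of "\<lambda>p. g ((snd p)(i := fst p j)) * g (fst p)"] by simp
  also have "\<dots> = (\<integral>\<omega>. g (tup \<iota> \<omega>) * g (tup \<kappa> \<omega>) \<partial>M)"
    by (subst distr_tup_pair[OF inj', symmetric], subst integral_distr) (auto simp: eq)
  finally have "(\<integral>\<omega>. g (tup \<iota> \<omega>) * g (tup \<kappa> \<omega>) \<partial>M) = (\<integral>w. \<integral>y. g (y(i := w j)) * g w \<partial>Q \<partial>Q)" ..
  \<comment> \<open>For fixed \<open>w\<close> the factor \<open>g w\<close> leaves the inner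
    integral, which then vanishes by degeneracy.\<close>
  also have "\<dots> = 0"
    using degen by (intro integral_eq_zero_AE) auto
  finally show ?thesis .
qed

section \<open>Projections and the remainder of the Hoeffding decomposition\<close>

definition proj :: "((nat \<Rightarrow> 's) \<Rightarrow> real) \<Rightarrow> nat \<Rightarrow> 's \<Rightarrow> real" where
  "proj f i z = (\<integral>y. f (y(i := z)) \<partial>Q) - integral\<^sup>L Q f"

lemma measurable_proj [measurable (raw)]:
  assumes [measurable]: "f \<in> borel_measurable PS" and "i \<in> {1..d}"
  shows "proj f i \<in> borel_measurable S"
proof -
  have [measurable]: "(\<lambda>p. (snd p)(i := fst p)) \<in> S \<Otimes>\<^sub>M PS \<rightarrow>\<^sub>M PS"
    using assms by (intro measurable_fun_upd[where J = "{1..d}"]) auto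
  have [measurable]: "(\<lambda>p. f ((snd p)(i := fst p))) \<in> borel_measurable (S \<Otimes>\<^sub>M PS)"
    by measurable
  have "(\<lambda>(z, y). f (y(i := z))) \<in> borel_measurable (S \<Otimes>\<^sub>M Q)"
    by (simp add: case_prod_beta' cong: measurable_cong_sets sets_pair_measure_cong)
  then have "(\<lambda>z. \<integral>y. f (y(i := z)) \<partial>Q) \<in> borel_measurable S"
    by (intro Q.borel_measurable_lebesgue_integral)
  then show ?thesis unfolding proj_def by measurable
qed

lemma integral_proj:
  assumes f: "sqi f" and ij: "i \<in> {1..d}" "j \<in> {1..d}"
  shows "(\<integral>y. proj f i (y j) \<partial>Q) = 0"
  unfolding proj_def using upd_transfer[OF ij sqi_integrable[OF f] sqi_measurable[OF f]]
  by (simp add: Q.prob_space)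

text \<open>Jensen's inequality for the conditional expectation, in the form that the variance of
  almost every section of \<open>f\<close> is nonnegative.\<close>

lemma sqi_proj:
  assumes f: "sqi f" and ij: "i \<in> {1..d}" "j \<in> {1..d}"
  shows "sqi (\<lambda>y. proj f i (y j))"
proof -
  note [measurable] = sqi_measurable[OF f]
  note m1 = measurable_proj[OF sqi_measurable[OF f] ij(1)]
  have [measurable]: "(\<lambda>y. proj f i (y j)) \<in> borel_measurable PS"
    using ij by (intro measurable_compose[OF _ m1] measurable_component_singleton)
  have [measurable]: "(\<lambda>y. (\<integral>z. f (z(i := y j)) \<partial>Q)) \<in> borel_measurable PS"
  proof -
    have "(\<lambda>y. proj f i (y j) + integral\<^sup>L Q f) \<in> borel_measurable PS" by measurable
    then show ?thesis by (simp add: proj_def)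
  qed
  have sq: "integrable Q (\<lambda>y. (f y)\<^sup>2)" using f by (rule sqi_square)
  note A = upd_transfer[OF ij sqi_integrable[OF f] sqi_measurable[OF f]]
  note B = upd_transfer[OF ij sq, simplified]
  have "integrable Q (\<lambda>y. (\<integral>z. f (z(i := y j)) \<partial>Q)\<^sup>2)"
  proof (rule Bochner_Integration.integrable_bound[OF B(4)])
    show "AE y in Q. norm ((\<integral>z. f (z(i := y j)) \<partial>Q)\<^sup>2) \<le> norm (\<integral>z. (f (z(i := y j)))\<^sup>2 \<partial>Q)"
      using A(3) B(3)
    proof eventually_elim
      case (elim y)
      have "0 \<le> Q.variance (\<lambda>z. f (z(i := y j)))" by (rule Q.variance_positive)
      also have "\<dots> = (\<integral>z. (f (z(i := y j)))\<^sup>2 \<partial>Q) - (\<integral>z. f (z(i := y j)) \<partial>Q)\<^sup>2"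
        using elim by (rule Q.variance_eq)
      finally show ?case by simp
    qed
  qed measurable
  then have "sqi (\<lambda>y. (\<integral>z. f (z(i := y j)) \<partial>Q))" by (simp add: sqi_def)
  then show ?thesis unfolding proj_def by auto
qed

text \<open>The part of order two and higher in the Hoeffding decomposition of
  \<open>f\<close>.\<close>

definition rem :: "((nat \<Rightarrow> 's) \<Rightarrow> real) \<Rightarrow> (nat \<Rightarrow> 's) \<Rightarrow> real" where
  "rem f y = f y - integral\<^sup>L Q f - (\<Sum>i=1..d. proj f i (y i))"

lemma sqi_rem: "sqi f \<Longrightarrow> sqi (rem f)"
  unfolding rem_def by (intro sqi_diff sqi_sum sqi_proj) auto

lemma integral_rem: "sqi f \<Longrightarrow> integral\<^sup>L Q (rem f) = 0"
  unfolding rem_def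
  by (subst Bochner_Integration.integral_diff)
     (auto intro!: Bochner_Integration.integrable_sum Bochner_Integration.integrable_diff
       simp: Bochner_Integration.integral_sum sqi_integrable sqi_proj integral_proj Q.prob_space)

text \<open>When all arguments but the \<open>i\<close>-th are integrated out, the projections with
  \<open>k \<noteq> i\<close> have mean zero, and the one with \<open>k = i\<close> cancels the
  centred conditional mean of \<open>f\<close>.\<close>

lemma rem_degenerate:
  assumes f: "sqi f" and ij: "i \<in> {1..d}" "j \<in> {1..d}"
  shows "AE w in Q. (\<integral>y. rem f (y(i := w j)) \<partial>Q) = 0"
  using upd_transfer(3)[OF ij sqi_integrable[OF f] sqi_measurable[OF f]]
proof eventually_elim
  case (elim w)
  let ?p = "\<lambda>k y. proj f k ((y(i := w j)) k)"
  have int: "integrable Q (?p k)" and zero: "integral\<^sup>L Q (?p k) = (if k = i then proj f i (w j) else 0)"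
    if "k \<in> {1..d}" for k
    using that f by (cases "k = i"; simp add: Q.prob_space integral_proj sqi_integrable sqi_proj)+
  have "(\<integral>y. rem f (y(i := w j)) \<partial>Q) =
     (\<integral>y. f (y(i := w j)) \<partial>Q) - integral\<^sup>L Q f - (\<integral>y. (\<Sum>k=1..d. ?p k y) \<partial>Q)"
  proof -
    have "integrable Q (\<lambda>y. \<Sum>k=1..d. ?p k y)" using int by (rule Bochner_Integration.integrable_sum)
    then show ?thesis unfolding rem_def using elim by (simp add: Q.prob_space del: fun_upd_apply)
  qed
  also have "(\<integral>y. (\<Sum>k=1..d. ?p k y) \<partial>Q) = (\<Sum>k=1..d. integral\<^sup>L Q (?p k))"
    by (rule Bochner_Integration.integral_sum) (rule int)
  also have "\<dots> = (\<Sum>k=1..d. if k = i then proj f i (w j) else 0)"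
    by (intro sum.cong refl zero)
  also have "\<dots> = proj f i (w j)" using ij by simp
  finally have "(\<integral>y. rem f (y(i := w j)) \<partial>Q) =
    (\<integral>y. f (y(i := w j)) \<partial>Q) - integral\<^sup>L Q f - proj f i (w j)" .
  then show ?case unfolding proj_def by (simp del: fun_upd_apply)
qed

text \<open>Moves integrals of functions of one observation between \<open>X k\<close>,
  \<open>X 0\<close> and the first coordinate under \<open>Q\<close>, where the facts about
  projections are available.\<close>

lemma integral_proj_X:
  assumes [measurable]: "h \<in> borel_measurable S"
  shows "(\<integral>\<omega>. h (X k \<omega>) \<partial>M) = (\<integral>\<omega>. (h (X 0 \<omega>) :: real) \<partial>M)"
    and "integrable M (\<lambda>\<omega>. h (X k \<omega>)) \<longleftrightarrow> integrable M (\<lambda>\<omega>. h (X 0 \<omega>))"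
    and "(\<integral>\<omega>. h (X 0 \<omega>) \<partial>M) = (\<integral>y. h (y 1) \<partial>Q)"
    and "integrable M (\<lambda>\<omega>. h (X 0 \<omega>)) \<longleftrightarrow> integrable Q (\<lambda>y. h (y 1))"
proof -
  have *: "(\<integral>\<omega>. h (X k \<omega>) \<partial>M) = (\<integral>z. h z \<partial>distr M S (X 0))"
    "integrable M (\<lambda>\<omega>. h (X k \<omega>)) \<longleftrightarrow> integrable (distr M S (X 0)) h" for k
    by (simp_all flip: distr_X[of k] add: integral_distr integrable_distr_eq)
  show "(\<integral>\<omega>. h (X k \<omega>) \<partial>M) = (\<integral>\<omega>. h (X 0 \<omega>) \<partial>M)"
    and "integrable M (\<lambda>\<omega>. h (X k \<omega>)) \<longleftrightarrow> integrable M (\<lambda>\<omega>. h (X 0 \<omega>))"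
    using *[of k] *[of 0] by auto
  have 1: "1 \<in> {1..d}" using d_pos by simp
  have [measurable]: "(\<lambda>y. h (y 1)) \<in> borel_measurable PS"
    by (rule measurable_compose[OF measurable_component_singleton[OF 1]]) measurable
  show "(\<integral>\<omega>. h (X 0 \<omega>) \<partial>M) = (\<integral>y. h (y 1) \<partial>Q)"
    using integral_tup[of "\<lambda>y. h (y 1)" "\<lambda>k. k"] *[of 0] *[of 1] 1 by (simp add: tup_def)
  show "integrable M (\<lambda>\<omega>. h (X 0 \<omega>)) \<longleftrightarrow> integrable Q (\<lambda>y. h (y 1))"
    using integrable_tup[of "\<lambda>y. h (y 1)" "\<lambda>k. k"] *[of 0] *[of 1] 1 by (simp add: tup_def)
qed

section \<open>Identification with the given definitions\<close>

lemma U_stat_tup: "U_stat d f X n \<omega> = (\<Sum>\<iota>\<in>incr_tuples d n. f (tup \<iota> \<omega>))"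
  by (simp add: U_stat_def tup_def)

lemma U_mean_eq: "f \<in> borel_measurable PS \<Longrightarrow> U_mean M d f X = integral\<^sup>L Q f"
  using integral_tup[of f "\<lambda>k. k"] by (simp add: U_mean_def tup_def)

lemma U_proj_eq:
  assumes [measurable]: "f \<in> borel_measurable PS" and "i \<in> {1..d}" "x \<in> space S"
  shows "U_proj M d f X i x = proj f i x"
proof -
  have [measurable]: "(\<lambda>y. y(i := x)) \<in> PS \<rightarrow>\<^sub>M PS"
    using assms by (intro measurable_fun_upd[where J = "{1..d}"]) auto
  show ?thesis
    using integral_tup[of "\<lambda>y. f (y(i := x))" "\<lambda>k. k"]
    by (simp add: U_proj_def proj_def U_mean_eq tup_def)
qed

end

section \<open>Almost monotonicity\<close>

text \<open>The shape of Chebyshev's bound at the \<open>k\<close>-th grid point, with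
  \<open>s\<close> the square root of \<open>m\<close>: the numerator bounds the variance of the
  increments, the denominator is the square of drift \<open>k\<^sup>2\<close> plus slack
  \<open>s\<close>. A common power of the block end has cancelled.\<close>

definition grid_weight :: "real \<Rightarrow> nat \<Rightarrow> real" where
  "grid_weight s k = (real k + 1)\<^sup>2 / ((real k)\<^sup>2 + s)\<^sup>2"

lemma grid_weight_nonneg: "grid_weight s k \<ge> 0"
  by (simp add: grid_weight_def)

text \<open>From (k - 1)^2 \<ge> 0 one gets 2(k^2 + 1) \<ge> (k + 1)^2. The majorant is the same for
  all \<open>s \<ge> 1\<close>, so it serves for summability and for domination.\<close>

lemma grid_weight_le:
  assumes "s \<ge> 1"
  shows "grid_weight s k \<le> 4 / (real (Suc k))\<^sup>2"
proof -
  have "2 * ((real k)\<^sup>2 + s) \<ge> (real k + 1)\<^sup>2"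
    using assms zero_le_power2[of "real k - 1"] by (simp add: power2_eq_square algebra_simps)
  then have "((real k + 1)\<^sup>2)\<^sup>2 \<le> (2 * ((real k)\<^sup>2 + s))\<^sup>2" by (intro power_mono) auto
  then have "(real k + 1)\<^sup>2 * (real k + 1)\<^sup>2 \<le> 4 * ((real k)\<^sup>2 + s)\<^sup>2"
    by (simp add: power2_eq_square algebra_simps)
  then show ?thesis
    using assms by (simp add: grid_weight_def divide_simps add_pos_nonneg add.commute add_nonneg_eq_0_iff)
qed

lemma summable_inverse_squares: "summable (\<lambda>k. 4 / (real (Suc k))\<^sup>2)"
proof -
  have "summable (\<lambda>k. inverse (real k ^ 2))" using inverse_power_summable[of 2, where 'a = real] by simp
  then have "summable (\<lambda>k. inverse (real (Suc k) ^ 2))" by (subst summable_Suc_iff)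
  then show ?thesis by (simp only: divide_inverse summable_mult)
qed

lemma summable_grid_weight: "s \<ge> 1 \<Longrightarrow> summable (grid_weight s)"
  using grid_weight_le grid_weight_nonneg
  by (intro summable_comparison_test'[OF summable_inverse_squares, where N = 0]) simp

text \<open>Dominated convergence for series (Tannery's theorem): every single term tends to
  zero.\<close>

lemma suminf_grid_weight_tendsto:
  assumes "filterlim s at_top sequentially"
  shows "(\<lambda>n. \<Sum>k. grid_weight (s n) k) \<longlonglongrightarrow> 0"
proof -
  have lim: "(\<lambda>n. grid_weight (s n) k) \<longlonglongrightarrow> 0" for k
  proof -
    have "filterlim (\<lambda>n. (real k)\<^sup>2 + s n) at_top sequentially"
      by (rule filterlim_tendsto_add_at_top[OF tendsto_const assms])
    then have "filterlim (\<lambda>n. ((real k)\<^sup>2 + s n)\<^sup>2) at_top sequentially"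
      by (intro filterlim_pow_at_top) auto
    then show ?thesis unfolding grid_weight_def
      by (intro tendsto_divide_0[OF tendsto_const] filterlim_at_top_imp_at_infinity)
  qed
  have ev: "eventually (\<lambda>n. s n \<ge> 1) sequentially"
    using assms by (simp add: filterlim_at_top)
  have "eventually (\<lambda>(k, n). norm (grid_weight (s n) k) \<le> 4 / (real (Suc k))\<^sup>2) (at_top \<times>\<^sub>F sequentially)"
    unfolding eventually_prod_filter using ev
    by (intro exI[of _ "\<lambda>_. True"] exI[of _ "\<lambda>n. s n \<ge> 1"]) (auto simp: grid_weight_nonneg grid_weight_le simp del: of_nat_Suc)
  then show ?thesis
    using tannerys_theorem[OF lim _ summable_inverse_squares] by simp
qed

lemma ex_square_between: "\<exists>k. k\<^sup>2 \<le> n \<and> n < (Suc k)\<^sup>2" for n :: nat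
proof (induction n)
  case (Suc n)
  then obtain k where k: "k\<^sup>2 \<le> n" "n < (Suc k)\<^sup>2" by auto
  show ?case
  proof (cases "Suc n < (Suc k)\<^sup>2")
    case False
    then have "Suc n = (Suc k)\<^sup>2" using k by simp
    then show ?thesis by (intro exI[of _ "Suc k"]) (simp add: power2_eq_square)
  qed (use k in \<open>auto intro!: exI[of _ k]\<close>)
qed (auto intro!: exI[of _ 0])

section \<open>Chebyshev and union bounds\<close>

context prob_space
begin

text \<open>The centres satisfy a - b \<ge> \<delta> - \<tau>, so the event forces \<open>A\<close>
  or \<open>B\<close> to be at least \<open>\<delta> / 2\<close> away from its centre; halving
  \<open>\<delta>\<close> produces the factor 4.\<close>

lemma prob_diff_less_le:
  assumes [measurable]: "A \<in> borel_measurable M" "B \<in> borel_measurable M"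
    and iA: "integrable M (\<lambda>\<omega>. (A \<omega> - a)\<^sup>2)" and iB: "integrable M (\<lambda>\<omega>. (B \<omega> - b)\<^sup>2)"
    and A: "expectation (\<lambda>\<omega>. (A \<omega> - a)\<^sup>2) \<le> VA" and B: "expectation (\<lambda>\<omega>. (B \<omega> - b)\<^sup>2) \<le> VB"
    and \<delta>: "\<delta> > 0" "a - b + \<tau> \<ge> \<delta>"
  shows "prob {\<omega> \<in> space M. A \<omega> - B \<omega> < - \<tau>} \<le> 4 * (VA + VB) / \<delta>\<^sup>2"
proof -
  have M: "prob {\<omega> \<in> space M. (Y \<omega> - y)\<^sup>2 \<ge> (\<delta> / 2)\<^sup>2} \<le> V * 4 / \<delta>\<^sup>2"
    if "integrable M (\<lambda>\<omega>. (Y \<omega> - y)\<^sup>2)" "expectation (\<lambda>\<omega>. (Y \<omega> - y)\<^sup>2) \<le> V" for Y y V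
  proof -
    have "prob {\<omega> \<in> space M. (Y \<omega> - y)\<^sup>2 \<ge> (\<delta> / 2)\<^sup>2} \<le> expectation (\<lambda>\<omega>. (Y \<omega> - y)\<^sup>2) / (\<delta> / 2)\<^sup>2"
      using \<delta> by (intro integral_Markov_inequality_measure[OF that(1), of "{}"]) auto
    also have "\<dots> \<le> V / (\<delta> / 2)\<^sup>2" using that by (intro divide_right_mono) auto
    finally show ?thesis by (simp add: power_divide)
  qed
  have "prob {\<omega> \<in> space M. A \<omega> - B \<omega> < - \<tau>} \<le>
    prob ({\<omega> \<in> space M. (A \<omega> - a)\<^sup>2 \<ge> (\<delta> / 2)\<^sup>2} \<union> {\<omega> \<in> space M. (B \<omega> - b)\<^sup>2 \<ge> (\<delta> / 2)\<^sup>2})"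
  proof (rule finite_measure_mono)
    show "{\<omega> \<in> space M. A \<omega> - B \<omega> < - \<tau>} \<subseteq>
      {\<omega> \<in> space M. (A \<omega> - a)\<^sup>2 \<ge> (\<delta> / 2)\<^sup>2} \<union> {\<omega> \<in> space M. (B \<omega> - b)\<^sup>2 \<ge> (\<delta> / 2)\<^sup>2}"
    proof
      fix \<omega> assume \<omega>: "\<omega> \<in> {\<omega> \<in> space M. A \<omega> - B \<omega> < - \<tau>}"
      then have "\<bar>A \<omega> - a\<bar> \<ge> \<delta> / 2 \<or> \<bar>B \<omega> - b\<bar> \<ge> \<delta> / 2"
        using \<delta> unfolding mem_Collect_eq by argo
      then have "(A \<omega> - a)\<^sup>2 \<ge> (\<delta> / 2)\<^sup>2 \<or> (B \<omega> - b)\<^sup>2 \<ge> (\<delta> / 2)\<^sup>2"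
        using \<delta> power_mono[of "\<delta> / 2" "\<bar>A \<omega> - a\<bar>" 2] power_mono[of "\<delta> / 2" "\<bar>B \<omega> - b\<bar>" 2] by auto
      with \<omega> show "\<omega> \<in> {\<omega> \<in> space M. (A \<omega> - a)\<^sup>2 \<ge> (\<delta> / 2)\<^sup>2} \<union> {\<omega> \<in> space M. (B \<omega> - b)\<^sup>2 \<ge> (\<delta> / 2)\<^sup>2}"
        by auto
    qed
  qed measurable
  also have "\<dots> \<le> prob {\<omega> \<in> space M. (A \<omega> - a)\<^sup>2 \<ge> (\<delta> / 2)\<^sup>2} + prob {\<omega> \<in> space M. (B \<omega> - b)\<^sup>2 \<ge> (\<delta> / 2)\<^sup>2}"
    by (intro measure_Un_le) measurable
  also have "\<dots> \<le> 4 * (VA + VB) / \<delta>\<^sup>2"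
    using add_mono[OF M[OF iA A] M[OF iB B]] by (simp only: add_divide_distrib distrib_left distrib_right mult.commute)
  finally show ?thesis .
qed

lemma prob_UN_grid_le:
  assumes E: "\<And>k. E k \<in> events" "\<And>k. prob (E k) \<le> C * grid_weight s k" and s: "s \<ge> 1"
  shows "prob (\<Union>k. E k) \<le> C * (\<Sum>k. grid_weight s k)"
proof -
  have sum: "summable (\<lambda>k. C * grid_weight s k)" by (intro summable_mult summable_grid_weight s)
  then have "summable (\<lambda>k. prob (E k))"
    using E by (intro summable_comparison_test'[OF sum, of 0]) auto
  then have "prob (\<Union>k. E k) \<le> (\<Sum>k. prob (E k))"
    using E by (intro finite_measure_subadditive_countably) auto
  also have "\<dots> \<le> (\<Sum>k. C * grid_weight s k)"
    by (intro suminf_le E sum \<open>summable (\<lambda>k. prob (E k))\<close>)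
  also have "\<dots> = C * (\<Sum>k. grid_weight s k)"
    by (intro suminf_mult summable_grid_weight s)
  finally show ?thesis .
qed

end

section \<open>Increments of the U-statistic\<close>

context iid_sequence
begin

lemma measurable_U_stat [measurable (raw)]:
  "f \<in> borel_measurable PS \<Longrightarrow> U_stat d f X n \<in> borel_measurable M"
  unfolding U_stat_tup[abs_def]
  by (intro borel_measurable_sum measurable_compose[OF measurable_tup])

text \<open>The factor \<open>(real d)\<^sup>2\<close> is the number of pairs of positions in
  \<open>card_incr_tuples_meeting\<close>.\<close>

definition var_bound :: "((nat \<Rightarrow> 's) \<Rightarrow> real) \<Rightarrow> real" where
  "var_bound f = (real d)\<^sup>2 * (\<integral>y. (f y - integral\<^sup>L Q f)\<^sup>2 \<partial>Q)"

lemma var_bound_nonneg: "var_bound f \<ge> 0"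
  by (simp add: var_bound_def)

text \<open>The increment runs over at most \<open>(b - a) * b ^ (d - 1)\<close> new tuples, and a
  centred kernel value is correlated only with those at the at most
  \<open>d\<^sup>2 * b ^ (d - 1)\<close> tuples meeting its own. The linear dependence on
  \<open>b - a\<close> is what the quadratic grid exploits.\<close>

lemma increment_second_moment:
  fixes f :: "(nat \<Rightarrow> 's) \<Rightarrow> real"
  defines "\<mu> \<equiv> integral\<^sup>L Q f"
  assumes f: "sqi f" and ab: "a \<le> b"
  shows "integrable M (\<lambda>\<omega>. (U_stat d f X b \<omega> - U_stat d f X a \<omega> - \<mu> * (real (b choose d) - real (a choose d)))\<^sup>2)"
    and "expectation (\<lambda>\<omega>. (U_stat d f X b \<omega> - U_stat d f X a \<omega> - \<mu> * (real (b choose d) - real (a choose d)))\<^sup>2)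
      \<le> var_bound f * real (b - a) * (real b ^ (d - 1))\<^sup>2"
proof -
  define g where "g = (\<lambda>y. f y - \<mu>)"
  define T where "T = incr_tuples d b - incr_tuples d a"
  let ?R = "\<lambda>\<iota> \<kappa>. \<iota> ` {1..d} \<inter> \<kappa> ` {1..d} \<noteq> {}"
  have g: "sqi g" unfolding g_def using f by auto
  have g0: "integral\<^sup>L Q g = 0" unfolding g_def \<mu>_def using f by (simp add: sqi_integrable Q.prob_space)
  have inj: "inj_on \<iota> {1..d}" if "\<iota> \<in> T" for \<iota> using that incr_tuples_inj_on by (auto simp: T_def)
  have eq: "U_stat d f X b \<omega> - U_stat d f X a \<omega> - \<mu> * (real (b choose d) - real (a choose d)) = (\<Sum>\<iota>\<in>T. g (tup \<iota> \<omega>))" for \<omega>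
    using incr_tuples_mono[OF ab] unfolding T_def g_def
    by (simp add: U_stat_tup sum_diff sum_subtractf card_incr_tuples_diff[OF ab d_pos, unfolded One_nat_def])
  have zero: "expectation (\<lambda>\<omega>. g (tup \<iota> \<omega>) * g (tup \<kappa> \<omega>)) = 0" if "\<iota> \<in> T" "\<kappa> \<in> T" "\<not> ?R \<iota> \<kappa>" for \<iota> \<kappa>
    using that inj by (intro integral_tup_mult_disjoint g g0) auto
  have N: "real (card {\<kappa> \<in> T. ?R \<iota> \<kappa>}) \<le> real (d\<^sup>2 * b ^ (d - 1))" for \<iota>
  proof -
    have "card {\<kappa> \<in> T. ?R \<iota> \<kappa>} \<le> card {\<kappa> \<in> incr_tuples d b. ?R \<iota> \<kappa>}"
      by (intro card_mono) (auto simp: T_def)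
    also have "\<dots> \<le> d\<^sup>2 * b ^ (d - 1)" by (rule card_incr_tuples_meeting)
    finally show ?thesis by (simp only: of_nat_le_iff)
  qed
  have fin: "finite T" by (simp add: T_def)
  note * = second_moment_sum_tup[where R = ?R, OF g fin inj zero N]
  show "integrable M (\<lambda>\<omega>. (U_stat d f X b \<omega> - U_stat d f X a \<omega> - \<mu> * (real (b choose d) - real (a choose d)))\<^sup>2)"
    unfolding eq by (rule *(1))
  have "expectation (\<lambda>\<omega>. (\<Sum>\<iota>\<in>T. g (tup \<iota> \<omega>))\<^sup>2) \<le> real (card T) * real (d\<^sup>2 * b ^ (d - 1)) * (\<integral>y. (g y)\<^sup>2 \<partial>Q)"
    by (rule *(2))
  also have "\<dots> \<le> real ((b - a) * b ^ (d - 1)) * real (d\<^sup>2 * b ^ (d - 1)) * (\<integral>y. (g y)\<^sup>2 \<partial>Q)"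
    using card_incr_tuples_diff(1)[OF ab d_pos] unfolding T_def
    by (intro mult_right_mono of_nat_mono) auto
  also have "\<dots> = var_bound f * real (b - a) * (real b ^ (d - 1))\<^sup>2"
    unfolding var_bound_def g_def \<mu>_def by (simp add: power2_eq_square)
  finally show "expectation (\<lambda>\<omega>. (U_stat d f X b \<omega> - U_stat d f X a \<omega> - \<mu> * (real (b choose d) - real (a choose d)))\<^sup>2)
      \<le> var_bound f * real (b - a) * (real b ^ (d - 1))\<^sup>2" unfolding eq .
qed

text \<open>Compares the rise of the sum of \<open>f\<close> over a block of length
  \<open>k\<^sup>2\<close> with the rise of the sum of \<open>g\<close>, later the negative part of
  \<open>f\<close>, over a gap of length at most \<open>2 * k + 1\<close>. Leaving \<open>a\<close>,
  \<open>b\<close>, \<open>p\<close>, \<open>q\<close> free covers both directions: \<open>b\<close>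
  is \<open>m + k\<^sup>2\<close> to the right of \<open>m\<close> and \<open>m\<close> itself to
  the left.\<close>

lemma increment_prob:
  assumes f: "sqi f" and g: "sqi g" and \<mu>: "integral\<^sup>L Q f > 0" and \<epsilon>: "\<epsilon> > 0"
  shows "\<exists>C s0. C \<ge> 0 \<and> s0 > 0 \<and> (\<forall>a b p q k m.
       a + k\<^sup>2 = b \<and> p \<le> q \<and> q \<le> p + 2 * k + 1 \<and> q \<le> 4 * b \<and> d \<le> b \<and> b \<le> m + k\<^sup>2 \<and> s0 \<le> sqrt (real m) \<longrightarrow>
       prob {\<omega> \<in> space M. (U_stat d f X b \<omega> - U_stat d f X a \<omega>) - (U_stat d g X q \<omega> - U_stat d g X p \<omega>)
          < - (\<epsilon> * sqrt (real m) * real m ^ (d - 1))} \<le> C * grid_weight (sqrt (real m)) k)"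
proof -
  \<comment> \<open>\<open>c\<close> is the drift rate supplied by \<open>choose_diff_ge\<close>;
    \<open>c1\<close> is a rate that drift and slack together achieve against k^2 + sqrt m, with
    \<open>2 ^ (d - 1)\<close> coming from b \<le> 2m.\<close>
  define c where "c = integral\<^sup>L Q f / real d ^ d"
  define c1 where "c1 = min (c / 2) (\<epsilon> / 2 ^ (d - 1))"
  define K where "K = \<bar>integral\<^sup>L Q g\<bar> * 4 ^ (d - 1)"
  \<comment> \<open>\<open>\<eta>\<close> is chosen so that the mean rise of the sum of
    \<open>g\<close> uses up at most half of the margin \<open>c1 * r * s\<close>; from sqrt m \<ge>
    \<open>s0\<close> on, \<open>2 * k + 1 \<le> \<eta> * r\<close> holds for every
    \<open>k\<close>.\<close>
  define \<eta> where "\<eta> = c1 / (2 * (K + 1))"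
  define s0 where "s0 = (1 + 1 / \<eta>) / \<eta>"
  \<comment> \<open>16 is the 4 of the Chebyshev bound times the 4 from halving \<open>c1\<close>;
    \<open>16 ^ (d - 1)\<close> is the square of \<open>4 ^ (d - 1)\<close>, which comes from
    \<open>q \<le> 4 * b\<close>.\<close>
  define C where "C = 16 * (var_bound f + var_bound g * 16 ^ (d - 1)) / c1\<^sup>2"
  have "c > 0" "K \<ge> 0" using \<mu> d_pos by (auto simp: c_def K_def)
  moreover from this have "c1 > 0" using \<epsilon> by (simp add: c1_def)
  moreover from calculation have "\<eta> > 0" by (simp add: \<eta>_def)
  moreover from this have "s0 > 0" by (simp add: s0_def add_pos_pos)
  ultimately have pos: "c > 0" "c1 > 0" "K \<ge> 0" "\<eta> > 0" "s0 > 0" by blast+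
  have c1: "c1 \<le> c / 2" "c1 \<le> c" "c1 \<le> \<epsilon> / 2 ^ (d - 1)" using pos unfolding c1_def by linarith+
  have C0: "C \<ge> 0" by (simp add: C_def var_bound_nonneg)
  have main: "prob {\<omega> \<in> space M. (U_stat d f X b \<omega> - U_stat d f X a \<omega>) - (U_stat d g X q \<omega> - U_stat d g X p \<omega>)
          < - (\<epsilon> * sqrt (real m) * real m ^ (d - 1))} \<le> C * grid_weight (sqrt (real m)) k"
    if H: "a + k\<^sup>2 = b" "p \<le> q" "q \<le> p + 2 * k + 1" "q \<le> 4 * b" "d \<le> b" "b \<le> m + k\<^sup>2" "s0 \<le> sqrt (real m)"
    for a b p q k m
  proof -
    define s where "s = real b ^ (d - 1)"
    define r where "r = (real k)\<^sup>2 + sqrt (real m)"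
    have b: "real b > 0" using H d_pos by simp
    then have s: "s > 0" by (simp add: s_def)
    have m: "sqrt (real m) > 0" "real m \<ge> 1" using H pos
      by (simp_all) (use H pos in \<open>cases m; simp\<close>)+
    have r: "r > 0" using m by (simp add: r_def add_nonneg_pos)
    have drift: "integral\<^sup>L Q f * (real (b choose d) - real (a choose d)) \<ge> c * (real k)\<^sup>2 * s"
    proof -
      have "b - a = k\<^sup>2" using H by simp
      then have "(real k)\<^sup>2 * s / real d ^ d \<le> real (b choose d) - real (a choose d)"
        using choose_diff_ge[of a b d] H d_pos by (simp add: s_def)
      then show ?thesis using \<mu> mult_left_mono[of "(real k)\<^sup>2 * s / real d ^ d" _ "integral\<^sup>L Q f"]
        by (simp add: c_def mult.assoc)
    qed
    \<comment> \<open>For k^2 \<le> m the block ends at most at 2m and the slack pays for sqrt m.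
      For k^2 > m half of the drift pays for it, since sqrt m \<le> m \<le> k^2.\<close>
    have \<tau>: "c * (real k)\<^sup>2 * s + \<epsilon> * sqrt (real m) * real m ^ (d - 1) \<ge> c1 * r * s"
    proof (cases "k\<^sup>2 \<le> m")
      case True
      then have "real b \<le> 2 * real m" using H by (simp flip: of_nat_power)
      then have "s \<le> 2 ^ (d - 1) * real m ^ (d - 1)"
        unfolding s_def power_mult_distrib[symmetric] by (intro power_mono) auto
      then have "c1 * sqrt (real m) * s \<le> (\<epsilon> / 2 ^ (d - 1)) * sqrt (real m) * (2 ^ (d - 1) * real m ^ (d - 1))"
        using \<epsilon> pos s c1 by (intro mult_mono) auto
      also have "\<dots> = \<epsilon> * sqrt (real m) * real m ^ (d - 1)" by simp
      finally have 1: "c1 * sqrt (real m) * s \<le> \<epsilon> * sqrt (real m) * real m ^ (d - 1)" .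
      have "c1 * ((real k)\<^sup>2 * s) \<le> c * ((real k)\<^sup>2 * s)"
        using pos s c1 by (intro mult_right_mono) auto
      then show ?thesis using 1 by (simp add: r_def algebra_simps)
    next
      case False
      then have "real m \<le> real (k\<^sup>2)" by linarith
      then have "real m \<le> (real k)\<^sup>2" by simp
      moreover have "sqrt (real m) \<le> real m" using m by (simp add: real_sqrt_le_iff sqrt_le_D real_le_lsqrt power2_eq_square)
      ultimately have "r \<le> 2 * (real k)\<^sup>2" unfolding r_def by linarith
      then have "c1 * r * s \<le> (c / 2) * (2 * (real k)\<^sup>2) * s"
        using pos s r c1 by (intro mult_mono) auto
      moreover have "\<epsilon> * sqrt (real m) * real m ^ (d - 1) \<ge> 0" using \<epsilon> by simp
      ultimately show ?thesis by simp
    qed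
    have K: "integral\<^sup>L Q g * (real (q choose d) - real (p choose d)) \<le> c1 / 2 * r * s"
    proof -
      have "real (q choose d) - real (p choose d) \<le> real (q - p) * real q ^ (d - 1)"
        using card_incr_tuples_diff[OF H(2) d_pos] by (metis of_nat_le_iff of_nat_mult of_nat_power)
      also have "\<dots> \<le> (2 * real k + 1) * (4 ^ (d - 1) * s)"
        unfolding s_def power_mult_distrib[symmetric] using H by (intro mult_mono power_mono) auto
      finally have 1: "real (q choose d) - real (p choose d) \<le> (2 * real k + 1) * (4 ^ (d - 1) * s)" .
      have 0: "real (q choose d) - real (p choose d) \<ge> 0" using H by (simp add: binomial_right_mono)
      have "integral\<^sup>L Q g * (real (q choose d) - real (p choose d))
         \<le> \<bar>integral\<^sup>L Q g\<bar> * ((2 * real k + 1) * (4 ^ (d - 1) * s))"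
        using 0 1 by (intro mult_mono) auto
      also have "\<dots> = K * (2 * real k + 1) * s" by (simp add: K_def)
      also have "\<dots> \<le> (K + 1) * (\<eta> * r) * s"
      proof (intro mult_mono)
        \<comment> \<open>The gap is linear in \<open>k\<close> and the margin quadratic: 2k \<le>
          \<eta> k^2 + 1/\<eta>, and the constant is left to sqrt m.\<close>
        have "0 \<le> (\<eta> * real k - 1)\<^sup>2" by simp
        then have "2 * real k * \<eta> \<le> \<eta>\<^sup>2 * (real k)\<^sup>2 + 1" by (simp add: power2_eq_square algebra_simps)
        then have "2 * real k \<le> \<eta> * (real k)\<^sup>2 + 1 / \<eta>"
          using pos by (simp add: divide_simps power2_eq_square algebra_simps)
        moreover have "1 + 1 / \<eta> \<le> \<eta> * sqrt (real m)"
          using H(7) pos by (simp add: s0_def divide_simps mult.commute)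
        ultimately show "2 * real k + 1 \<le> \<eta> * r" by (simp add: r_def algebra_simps)
      qed (use pos s r in auto)
      also have "\<dots> = ((K + 1) * \<eta>) * r * s" by (simp only: mult.assoc)
      also have "(K + 1) * \<eta> = c1 / 2" unfolding \<eta>_def using pos(3) by (auto simp: divide_simps)
      finally show ?thesis .
    qed
    have meas: "U_stat d f X n \<in> borel_measurable M" "U_stat d g X n \<in> borel_measurable M" for n
      using f g by (auto intro: measurable_U_stat sqi_measurable)
    have "prob {\<omega> \<in> space M. (U_stat d f X b \<omega> - U_stat d f X a \<omega>) - (U_stat d g X q \<omega> - U_stat d g X p \<omega>)
          < - (\<epsilon> * sqrt (real m) * real m ^ (d - 1))}
      \<le> 4 * (var_bound f * (real k)\<^sup>2 * s\<^sup>2 + var_bound g * (2 * real k + 1) * (16 ^ (d - 1) * s\<^sup>2)) / (c1 / 2 * r * s)\<^sup>2"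
    proof (rule prob_diff_less_le)
      show "integrable M (\<lambda>\<omega>. (U_stat d f X b \<omega> - U_stat d f X a \<omega> - integral\<^sup>L Q f * (real (b choose d) - real (a choose d)))\<^sup>2)"
        using H by (intro increment_second_moment f) auto
      show "integrable M (\<lambda>\<omega>. (U_stat d g X q \<omega> - U_stat d g X p \<omega> - integral\<^sup>L Q g * (real (q choose d) - real (p choose d)))\<^sup>2)"
        using H by (intro increment_second_moment g) auto
      have "expectation (\<lambda>\<omega>. (U_stat d f X b \<omega> - U_stat d f X a \<omega> - integral\<^sup>L Q f * (real (b choose d) - real (a choose d)))\<^sup>2)
        \<le> var_bound f * real (b - a) * s\<^sup>2"
        unfolding s_def using H by (intro increment_second_moment f) auto
      also have "real (b - a) = (real k)\<^sup>2" using H by (simp flip: of_nat_power)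
      finally show "expectation (\<lambda>\<omega>. (U_stat d f X b \<omega> - U_stat d f X a \<omega> - integral\<^sup>L Q f * (real (b choose d) - real (a choose d)))\<^sup>2)
        \<le> var_bound f * (real k)\<^sup>2 * s\<^sup>2" .
      have "expectation (\<lambda>\<omega>. (U_stat d g X q \<omega> - U_stat d g X p \<omega> - integral\<^sup>L Q g * (real (q choose d) - real (p choose d)))\<^sup>2)
        \<le> var_bound g * real (q - p) * (real q ^ (d - 1))\<^sup>2"
        using H by (intro increment_second_moment g) auto
      also have "\<dots> \<le> var_bound g * (2 * real k + 1) * ((4 ^ (d - 1) * s)\<^sup>2)"
      proof (intro mult_mono power_mono)
        show "real q ^ (d - 1) \<le> 4 ^ (d - 1) * s"
          unfolding s_def power_mult_distrib[symmetric] using H by (intro power_mono) auto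
      qed (use H var_bound_nonneg in auto)
      also have "(4 ^ (d - 1) * s)\<^sup>2 = 16 ^ (d - 1) * s\<^sup>2"
        by (simp add: power_mult_distrib power2_eq_square flip: power_mult_distrib[of 4 4])
      finally show "expectation (\<lambda>\<omega>. (U_stat d g X q \<omega> - U_stat d g X p \<omega> - integral\<^sup>L Q g * (real (q choose d) - real (p choose d)))\<^sup>2)
        \<le> var_bound g * (2 * real k + 1) * (16 ^ (d - 1) * s\<^sup>2)" .
      show "c1 / 2 * r * s \<le> integral\<^sup>L Q f * (real (b choose d) - real (a choose d)) -
         integral\<^sup>L Q g * (real (q choose d) - real (p choose d)) + \<epsilon> * sqrt (real m) * real m ^ (d - 1)"
        using drift \<tau> K by simp
      show "0 < c1 / 2 * r * s" using pos r s by simp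
    qed (use meas in measurable)
    \<comment> \<open>Both variances are brought to multiples of (k + 1)^2 times
      \<open>s\<^sup>2\<close>, and \<open>s\<^sup>2\<close> cancels against the square of the
      margin.\<close>
    also have "\<dots> \<le> 4 * (var_bound f * (real k + 1)\<^sup>2 * s\<^sup>2 + var_bound g * (real k + 1)\<^sup>2 * (16 ^ (d - 1) * s\<^sup>2)) / (c1 / 2 * r * s)\<^sup>2"
    proof (intro divide_right_mono mult_left_mono add_mono mult_right_mono)
      show "(real k)\<^sup>2 \<le> (real k + 1)\<^sup>2" "2 * real k + 1 \<le> (real k + 1)\<^sup>2"
        by (auto simp: power2_eq_square algebra_simps)
    qed (auto intro: var_bound_nonneg)
    also have "\<dots> = C * grid_weight (sqrt (real m)) k"
      using pos r s unfolding C_def grid_weight_def r_def[symmetric]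
      by (simp add: power_mult_distrib power_divide divide_simps) (simp add: algebra_simps)
    finally show ?thesis .
  qed
  show ?thesis
  proof (rule exI[of _ C], rule exI[of _ s0], intro conjI allI impI)
    show "C \<ge> 0" "s0 > 0" by fact+
  qed (elim conjE, rule main)
qed

text \<open>Both \<open>V\<close> and the sum of the positive parts, which is
  \<open>U_stat d f X\<close> plus \<open>V\<close>, increase with \<open>n\<close>. Inside a gap
  the statistic can therefore go the wrong way by at most the rise of \<open>V\<close> over the
  gap.\<close>

lemma U_stat_between:
  fixes f :: "(nat \<Rightarrow> 's) \<Rightarrow> real"
  assumes "p \<le> n" "n \<le> q"
  defines "V \<equiv> U_stat d (\<lambda>y. max (- f y) 0) X"
  shows "U_stat d f X n \<omega> \<ge> U_stat d f X p \<omega> - (V q \<omega> - V p \<omega>)"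
    and "U_stat d f X n \<omega> \<le> U_stat d f X q \<omega> + (V q \<omega> - V p \<omega>)"
proof -
  have mono: "U_stat d h X i \<omega> \<le> U_stat d h X j \<omega>" if "i \<le> j" "\<And>y. h y \<ge> 0" for h i j
    unfolding U_stat_def using that incr_tuples_mono by (intro sum_mono2) auto
  have add: "U_stat d (\<lambda>y. max (f y) 0) X j \<omega> = U_stat d f X j \<omega> + V j \<omega>" for j
    unfolding V_def U_stat_def sum.distrib[symmetric] by (intro sum.cong) auto
  have "V p \<omega> \<le> V n \<omega>" "V n \<omega> \<le> V q \<omega>" unfolding V_def using assms by (auto intro!: mono)
  moreover have "U_stat d f X p \<omega> + V p \<omega> \<le> U_stat d f X n \<omega> + V n \<omega>"
    "U_stat d f X n \<omega> + V n \<omega> \<le> U_stat d f X q \<omega> + V q \<omega>"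
    unfolding add[symmetric] using assms by (auto intro!: mono)
  ultimately show "U_stat d f X n \<omega> \<ge> U_stat d f X p \<omega> - (V q \<omega> - V p \<omega>)"
    "U_stat d f X n \<omega> \<le> U_stat d f X q \<omega> + (V q \<omega> - V p \<omega>)" by linarith+
qed

lemma sqi_neg_part:
  assumes f: "sqi f" shows "sqi (\<lambda>y. max (- f y) 0)"
proof -
  note [measurable] = sqi_measurable[OF f]
  have "(\<lambda>y. (max (- f y) 0)\<^sup>2) \<in> borel_measurable PS" by measurable
  then have [measurable]: "(\<lambda>y. (max (- f y) 0)\<^sup>2) \<in> borel_measurable Q"
    using measurable_cong_sets[OF sets_Q refl] by blast
  have "integrable Q (\<lambda>y. (max (- f y) 0)\<^sup>2)"
    by (rule Bochner_Integration.integrable_bound[OF sqi_square[OF f]]) (auto simp: max_def)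
  then show ?thesis by (simp add: sqi_def)
qed

text \<open>Infinitely many \<open>n\<close> are handled at once: each lies in a gap from
  \<open>m + k\<^sup>2\<close> to \<open>m + (Suc k)\<^sup>2\<close>, and the errors over all
  \<open>k\<close> form a convergent series whose sum vanishes as \<open>m\<close> grows.\<close>

lemma no_late_descent:
  assumes f: "sqi f" and \<mu>: "integral\<^sup>L Q f > 0" and \<epsilon>: "\<epsilon> > 0"
  shows "(\<lambda>m. prob {\<omega> \<in> space M. \<exists>n\<ge>m. U_stat d f X n \<omega> < U_stat d f X m \<omega> - \<epsilon> * sqrt (real m) * real m ^ (d - 1)}) \<longlonglongrightarrow> 0"
    (is "(\<lambda>m. prob (?B m)) \<longlonglongrightarrow> 0")
proof -
  let ?U = "U_stat d f X"
  let ?V = "U_stat d (\<lambda>y. max (- f y) 0) X"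
  obtain C s0 where C: "C \<ge> 0" "s0 > 0" and
    inc: "\<forall>a b p q k m. a + k\<^sup>2 = b \<and> p \<le> q \<and> q \<le> p + 2 * k + 1 \<and> q \<le> 4 * b \<and> d \<le> b \<and> b \<le> m + k\<^sup>2 \<and>
       s0 \<le> sqrt (real m) \<longrightarrow> prob {\<omega> \<in> space M. (?U b \<omega> - ?U a \<omega>) - (?V q \<omega> - ?V p \<omega>)
          < - (\<epsilon> * sqrt (real m) * real m ^ (d - 1))} \<le> C * grid_weight (sqrt (real m)) k"
    using increment_prob[OF f sqi_neg_part[OF f] \<mu> \<epsilon>] by blast
  have meas: "?U n \<in> borel_measurable M" "?V n \<in> borel_measurable M" for n
    using f sqi_neg_part[OF f] by (auto intro: measurable_U_stat sqi_measurable)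
  have lim: "filterlim (\<lambda>m. sqrt (real m)) at_top sequentially"
    by (intro filterlim_compose[OF sqrt_at_top] filterlim_real_sequentially)
  have bound: "prob (?B m) \<le> C * (\<Sum>k. grid_weight (sqrt (real m)) k)"
    if m: "max s0 1 \<le> sqrt (real m)" "d \<le> m" for m
  proof -
    define E where "E k = {\<omega> \<in> space M. (?U (m + k\<^sup>2) \<omega> - ?U m \<omega>) - (?V (m + (Suc k)\<^sup>2) \<omega> - ?V (m + k\<^sup>2) \<omega>)
          < - (\<epsilon> * sqrt (real m) * real m ^ (d - 1))}" for k
    have "?B m \<subseteq> (\<Union>k. E k)"
    proof
      fix \<omega> assume "\<omega> \<in> ?B m"
      then obtain n where n: "\<omega> \<in> space M" "n \<ge> m" "?U n \<omega> < ?U m \<omega> - \<epsilon> * sqrt (real m) * real m ^ (d - 1)" by auto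
      obtain k where "k\<^sup>2 \<le> n - m" "n - m < (Suc k)\<^sup>2" using ex_square_between by blast
      then have "?U n \<omega> \<ge> ?U (m + k\<^sup>2) \<omega> - (?V (m + (Suc k)\<^sup>2) \<omega> - ?V (m + k\<^sup>2) \<omega>)"
        using n by (intro U_stat_between) auto
      then have "\<omega> \<in> E k" using n by (simp add: E_def)
      then show "\<omega> \<in> (\<Union>k. E k)" by auto
    qed
    moreover have E: "E k \<in> events" for k unfolding E_def using meas by measurable
    ultimately have "prob (?B m) \<le> prob (\<Union>k. E k)" by (intro finite_measure_mono) auto
    also have "\<dots> \<le> C * (\<Sum>k. grid_weight (sqrt (real m)) k)"
    proof (rule prob_UN_grid_le[OF E])
      show "prob (E k) \<le> C * grid_weight (sqrt (real m)) k" for k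
      proof -
        have "m \<ge> 1" using m d_pos by simp
        \<comment> \<open>Together with \<open>m \<ge> 1\<close> this gives
          \<open>q \<le> 4 * b\<close> for q = m + (k + 1)^2 and b = m + k^2.\<close>
        moreover have "(Suc k)\<^sup>2 \<le> 4 * k\<^sup>2 + 1" by (cases k) (auto simp: power2_eq_square)
        ultimately have "m + (Suc k)\<^sup>2 \<le> 4 * (m + k\<^sup>2)" unfolding distrib_left by linarith
        then show ?thesis unfolding E_def using m
          by (intro inc[rule_format]) (auto simp: power2_eq_square)
      qed
    qed (use m in simp)
    finally show ?thesis .
  qed
  have ev: "eventually (\<lambda>m. max s0 1 \<le> sqrt (real m) \<and> d \<le> m) sequentially"
    using lim[unfolded filterlim_at_top, rule_format, of "max s0 1"] eventually_ge_at_top[of d]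
    by eventually_elim blast
  show ?thesis
  proof (rule tendsto_sandwich[where f = "\<lambda>_. 0"])
    show "eventually (\<lambda>m. prob (?B m) \<le> C * (\<Sum>k. grid_weight (sqrt (real m)) k)) sequentially"
      using ev by eventually_elim (use bound in auto)
    show "(\<lambda>m. C * (\<Sum>k. grid_weight (sqrt (real m)) k)) \<longlonglongrightarrow> 0"
      using tendsto_mult[OF tendsto_const[of C] suminf_grid_weight_tendsto[OF lim]] by simp
  qed auto
qed

lemma no_early_excess:
  assumes f: "sqi f" and \<mu>: "integral\<^sup>L Q f > 0" and \<epsilon>: "\<epsilon> > 0"
  shows "(\<lambda>m. prob {\<omega> \<in> space M. \<exists>n\<le>m. U_stat d f X n \<omega> > U_stat d f X m \<omega> + \<epsilon> * sqrt (real m) * real m ^ (d - 1)}) \<longlonglongrightarrow> 0"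
    (is "(\<lambda>m. prob (?B m)) \<longlonglongrightarrow> 0")
proof -
  let ?U = "U_stat d f X"
  let ?V = "U_stat d (\<lambda>y. max (- f y) 0) X"
  obtain C s0 where C: "C \<ge> 0" "s0 > 0" and
    inc: "\<forall>a b p q k m. a + k\<^sup>2 = b \<and> p \<le> q \<and> q \<le> p + 2 * k + 1 \<and> q \<le> 4 * b \<and> d \<le> b \<and> b \<le> m + k\<^sup>2 \<and>
       s0 \<le> sqrt (real m) \<longrightarrow> prob {\<omega> \<in> space M. (?U b \<omega> - ?U a \<omega>) - (?V q \<omega> - ?V p \<omega>)
          < - (\<epsilon> * sqrt (real m) * real m ^ (d - 1))} \<le> C * grid_weight (sqrt (real m)) k"
    using increment_prob[OF f sqi_neg_part[OF f] \<mu> \<epsilon>] by blast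
  have meas: "?U n \<in> borel_measurable M" "?V n \<in> borel_measurable M" for n
    using f sqi_neg_part[OF f] by (auto intro: measurable_U_stat sqi_measurable)
  have lim: "filterlim (\<lambda>m. sqrt (real m)) at_top sequentially"
    by (intro filterlim_compose[OF sqrt_at_top] filterlim_real_sequentially)
  have bound: "prob (?B m) \<le> C * (\<Sum>k. grid_weight (sqrt (real m)) k)"
    if m: "max s0 1 \<le> sqrt (real m)" "d \<le> m" for m
  proof -
    \<comment> \<open>Going down, the grid stops at 0: for k^2 > m there is no event, and in the
      last block \<open>m - (Suc k)\<^sup>2\<close> may be truncated to 0, which only shortens the
      gap.\<close>
    define E where "E k = (if k\<^sup>2 \<le> m then
       {\<omega> \<in> space M. (?U m \<omega> - ?U (m - k\<^sup>2) \<omega>) - (?V (m - k\<^sup>2) \<omega> - ?V (m - (Suc k)\<^sup>2) \<omega>)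
          < - (\<epsilon> * sqrt (real m) * real m ^ (d - 1))} else {})" for k
    have "?B m \<subseteq> (\<Union>k. E k)"
    proof
      fix \<omega> assume "\<omega> \<in> ?B m"
      then obtain n where n: "\<omega> \<in> space M" "n \<le> m" "?U n \<omega> > ?U m \<omega> + \<epsilon> * sqrt (real m) * real m ^ (d - 1)" by auto
      obtain k where k: "k\<^sup>2 \<le> m - n" "m - n < (Suc k)\<^sup>2" using ex_square_between by blast
      then have "?U n \<omega> \<le> ?U (m - k\<^sup>2) \<omega> + (?V (m - k\<^sup>2) \<omega> - ?V (m - (Suc k)\<^sup>2) \<omega>)"
        using n by (intro U_stat_between) auto
      then have "\<omega> \<in> E k" using n k by (simp add: E_def)
      then show "\<omega> \<in> (\<Union>k. E k)" by auto
    qed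
    moreover have E: "E k \<in> events" for k
      using meas by (cases "k\<^sup>2 \<le> m") (simp_all add: E_def del: One_nat_def, measurable)
    ultimately have "prob (?B m) \<le> prob (\<Union>k. E k)" by (intro finite_measure_mono) auto
    also have "\<dots> \<le> C * (\<Sum>k. grid_weight (sqrt (real m)) k)"
    proof (rule prob_UN_grid_le[OF E])
      show "prob (E k) \<le> C * grid_weight (sqrt (real m)) k" for k
      proof (cases "k\<^sup>2 \<le> m")
        case True
        then show ?thesis unfolding E_def using m
          by simp (intro inc[rule_format]; auto simp: power2_eq_square)
      qed (simp add: E_def C grid_weight_nonneg)
    qed (use m in simp)
    finally show ?thesis .
  qed
  have ev: "eventually (\<lambda>m. max s0 1 \<le> sqrt (real m) \<and> d \<le> m) sequentially"
    using lim[unfolded filterlim_at_top, rule_format, of "max s0 1"] eventually_ge_at_top[of d]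
    by eventually_elim blast
  show ?thesis
  proof (rule tendsto_sandwich[where f = "\<lambda>_. 0"])
    show "eventually (\<lambda>m. prob (?B m) \<le> C * (\<Sum>k. grid_weight (sqrt (real m)) k)) sequentially"
      using ev by eventually_elim (use bound in auto)
    show "(\<lambda>m. C * (\<Sum>k. grid_weight (sqrt (real m)) k)) \<longlonglongrightarrow> 0"
      using tendsto_mult[OF tendsto_const[of C] suminf_grid_weight_tendsto[OF lim]] by simp
  qed auto
qed

end

section \<open>The central limit theorem\<close>

lemma abs_exp_minus_approx: "x \<ge> 0 \<Longrightarrow> \<bar>exp (- x) - (1 - x)\<bar> \<le> x\<^sup>2" for x :: real
proof -
  assume x: "x \<ge> 0"
  have "exp (- x) = 1 / exp x" by (simp add: exp_minus inverse_eq_divide)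
  also have "\<dots> \<le> 1 / (1 + x)" using x by (intro divide_left_mono) auto
  also have "\<dots> \<le> 1 - x + x\<^sup>2"
    using x by (simp add: divide_simps) (simp add: algebra_simps power2_eq_square)
  finally show ?thesis using exp_ge_add_one_self[of "- x"] by auto
qed

lemma abs_mult_diff_le:
  fixes a b c e :: real
  assumes "\<bar>a\<bar> \<le> 1" "\<bar>e\<bar> \<le> 1"
  shows "\<bar>a * b - c * e\<bar> \<le> \<bar>a - c\<bar> + \<bar>b - e\<bar>"
proof -
  have "a * b - c * e = a * (b - e) + (a - c) * e" by (simp add: algebra_simps)
  also have "\<bar>\<dots>\<bar> \<le> \<bar>a\<bar> * \<bar>b - e\<bar> + \<bar>a - c\<bar> * \<bar>e\<bar>"
    by (rule order.trans[OF abs_triangle_ineq]) (simp add: abs_mult)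
  also have "\<dots> \<le> 1 * \<bar>b - e\<bar> + \<bar>a - c\<bar> * 1"
    using assms by (intro add_mono mult_mono) auto
  finally show ?thesis by simp
qed

section \<open>Asymptotics of the weights\<close>

context
  fixes u :: "nat \<Rightarrow> nat \<Rightarrow> nat \<Rightarrow> real"
  defines "u \<equiv> \<lambda>n p x. fact p * real (x choose p) / real n ^ p"
begin

text \<open>Each \<open>u n p x\<close> is within O(1/n) of the power \<open>(x / n) ^ p\<close>, so
  it is multiplicative in \<open>p\<close> up to O(1/n), uniformly in
  \<open>x \<le> n\<close>.\<close>

lemma choose_ratio_bounds:
  assumes "x \<le> n" "n > 0"
  shows "0 \<le> u n p x" "u n p x \<le> 1"
    and "\<bar>u n p x * u n q x - u n (p + q) x\<bar> \<le> ((real p)\<^sup>2 + (real q)\<^sup>2 + (real (p + q))\<^sup>2) / real n"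
proof -
  let ?\<xi> = "real x / real n"
  have \<xi>: "0 \<le> ?\<xi>" "?\<xi> \<le> 1" using assms by auto
  show 0: "0 \<le> u n p x" for p by (simp add: u_def)
  show 1: "u n p x \<le> 1" for p using fact_mult_choose_approx(1)[OF assms] by (simp add: u_def)
  have ap: "\<bar>u n p x - ?\<xi> ^ p\<bar> \<le> (real p)\<^sup>2 / real n" for p
    using fact_mult_choose_approx(2)[OF assms] by (simp add: u_def)
  have "\<bar>u n p x * u n q x - ?\<xi> ^ p * ?\<xi> ^ q\<bar> \<le> \<bar>u n p x - ?\<xi> ^ p\<bar> + \<bar>u n q x - ?\<xi> ^ q\<bar>"
    using 0[of p] 1[of p] \<xi> by (intro abs_mult_diff_le) (auto simp: power_le_one)
  then have "\<bar>u n p x * u n q x - ?\<xi> ^ (p + q)\<bar> \<le> (real p)\<^sup>2 / real n + (real q)\<^sup>2 / real n"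
    using ap[of p] ap[of q] unfolding power_add by linarith
  then have "\<bar>u n p x * u n q x - u n (p + q) x\<bar> \<le> (real p)\<^sup>2 / real n + (real q)\<^sup>2 / real n + (real (p + q))\<^sup>2 / real n"
    using ap[of "p + q"] by linarith
  then show "\<bar>u n p x * u n q x - u n (p + q) x\<bar> \<le> ((real p)\<^sup>2 + (real q)\<^sup>2 + (real (p + q))\<^sup>2) / real n"
    by (simp only: add_divide_distrib)
qed

lemma choose_ratio_tendsto: "(\<lambda>n. real (n choose p) / real n ^ p) \<longlonglongrightarrow> 1 / fact p"
proof -
  have "(\<lambda>n. u n p n - 1) \<longlonglongrightarrow> 0"
  proof (rule Lim_null_comparison)
    show "(\<lambda>n. (real p)\<^sup>2 / real n) \<longlonglongrightarrow> 0" by real_asymp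
    show "eventually (\<lambda>n. norm (u n p n - 1) \<le> (real p)\<^sup>2 / real n) sequentially"
      using eventually_gt_at_top[of 0]
    proof eventually_elim
      case (elim n)
      then show ?case using fact_mult_choose_approx(2)[of n n p] by (simp add: u_def)
    qed
  qed
  then have "(\<lambda>n. (u n p n - 1 + 1) / fact p) \<longlonglongrightarrow> (0 + 1) / fact p"
    by (intro tendsto_intros) auto
  then show ?thesis by (simp add: u_def)
qed

text \<open>
  Replacing products of binomial coefficients with the same upper index by a single one costs
  \<open>O(1/n)\<close>; the remaining sum is a Vandermonde convolution, so the Beta integral is not needed.
\<close>

lemma sum_weights_tendsto:
  fixes e :: nat
  assumes "i \<le> e" "j \<le> e"
  defines "w \<equiv> \<lambda>n i k. real (k choose i) * real ((n - Suc k) choose (e - i)) / real n ^ e"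
  shows "(\<lambda>n. (\<Sum>k<n. w n i k * w n j k) / real n) \<longlonglongrightarrow>
    fact (i + j) * fact (2 * e - i - j) / (fact i * fact j * fact (e - i) * fact (e - j) * fact (2 * e + 1))"
proof -
  \<comment> \<open>\<open>D\<close> clears the factorials by which the weights differ from the
    ratios \<open>u\<close>; \<open>K\<close> collects the constants of the two O(1/n)
    errors.\<close>
  define D :: real where "D = fact i * fact j * fact (e - i) * fact (e - j)"
  define K where "K = (real i)\<^sup>2 + (real j)\<^sup>2 + (real (i + j))\<^sup>2 + ((real (e - i))\<^sup>2 + (real (e - j))\<^sup>2 + (real (e - i + (e - j)))\<^sup>2)"
  define s where "s n k = u n (i + j) k * u n (e - i + (e - j)) (n - Suc k)" for n k
  have D: "D > 0" by (simp add: D_def)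
  have w: "w n i k = u n i k * u n (e - i) (n - Suc k) / (fact i * fact (e - i))" if "i \<le> e" for i n k
  proof -
    have "real n ^ e = real n ^ i * real n ^ (e - i)" using that by (simp flip: power_add)
    then show ?thesis by (simp add: w_def u_def)
  qed
  have diff: "\<bar>D * (w n i k * w n j k) - s n k\<bar> \<le> K / real n" if k: "k < n" for n k
  proof -
    let ?y = "n - Suc k"
    have y: "?y \<le> n" "k \<le> n" "n > 0" using k by auto
    have b: "\<bar>u n p x\<bar> \<le> 1" if "x \<le> n" for p x using choose_ratio_bounds[OF that y(3), of p] by simp
    have "D * (w n i k * w n j k) = (u n i k * u n j k) * (u n (e - i) ?y * u n (e - j) ?y)"
      unfolding w[OF assms(1)] w[OF assms(2)] D_def by simp
    also have "\<bar>\<dots> - s n k\<bar> \<le> \<bar>u n i k * u n j k - u n (i + j) k\<bar> +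
        \<bar>u n (e - i) ?y * u n (e - j) ?y - u n (e - i + (e - j)) ?y\<bar>"
      unfolding s_def using b y by (intro abs_mult_diff_le) (auto simp: abs_mult intro!: mult_le_one)
    also have "\<dots> \<le> K / real n"
      using choose_ratio_bounds(3)[OF y(2,3), of i j] choose_ratio_bounds(3)[OF y(1,3), of "e - i" "e - j"]
      unfolding K_def add_divide_distrib by linarith
    finally show ?thesis .
  qed
  have ij: "2 * e - i - j = e - i + (e - j)" "i + j + (e - i + (e - j)) = 2 * e" using assms by auto
  \<comment> \<open>No error occurs here: the convolution evaluates the sum exactly, and the
    resulting \<open>n choose (2 * e + 1)\<close> is the source of \<open>fact (2 * e + 1)\<close>
    in the limit.\<close>
  have s: "(\<Sum>k<n. s n k) / real n = fact (i + j) * fact (2 * e - i - j) * (real (n choose (2 * e + 1)) / real n ^ (2 * e + 1))" for n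
  proof -
    have "(\<Sum>k<n. s n k) = (\<Sum>k<n. fact (i + j) * fact (2 * e - i - j) / real n ^ (2 * e) *
      (real (k choose (i + j)) * real ((n - Suc k) choose (e - i + (e - j)))))"
      unfolding s_def u_def ij(1) ij(2)[symmetric] power_add by (intro sum.cong refl) (simp add: mult_ac)
    also have "\<dots> = fact (i + j) * fact (2 * e - i - j) / real n ^ (2 * e) * real (n choose (2 * e + 1))"
      unfolding sum_distrib_left[symmetric] sum_choose_mult_choose ij(2) ..
    finally show ?thesis by simp
  qed
  have "(\<lambda>n. (\<Sum>k<n. D * (w n i k * w n j k)) / real n - (\<Sum>k<n. s n k) / real n) \<longlonglongrightarrow> 0"
  proof (rule Lim_null_comparison)
    show "(\<lambda>n. K / real n) \<longlonglongrightarrow> 0" by real_asymp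
    show "eventually (\<lambda>n. norm ((\<Sum>k<n. D * (w n i k * w n j k)) / real n - (\<Sum>k<n. s n k) / real n) \<le> K / real n) sequentially"
      using eventually_gt_at_top[of 0]
    proof eventually_elim
      case (elim n)
      have "\<bar>\<Sum>k<n. D * (w n i k * w n j k) - s n k\<bar> \<le> (\<Sum>k<n. K / real n)"
        using diff by (intro order.trans[OF sum_abs] sum_mono) auto
      also have "\<dots> = K" using elim by simp
      finally show ?case using elim
        by (simp add: sum_subtractf diff_divide_distrib[symmetric] divide_right_mono)
    qed
  qed
  moreover have "(\<lambda>n. (\<Sum>k<n. s n k) / real n) \<longlonglongrightarrow> fact (i + j) * fact (2 * e - i - j) * (1 / fact (2 * e + 1))"
    unfolding s by (intro tendsto_intros choose_ratio_tendsto)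
  ultimately have "(\<lambda>n. ((\<Sum>k<n. D * (w n i k * w n j k)) / real n - (\<Sum>k<n. s n k) / real n + (\<Sum>k<n. s n k) / real n) / D)
      \<longlonglongrightarrow> (0 + fact (i + j) * fact (2 * e - i - j) * (1 / fact (2 * e + 1))) / D"
    using D by (intro tendsto_intros) auto
  moreover have "((\<Sum>k<n. D * (w n i k * w n j k)) / real n) / D = (\<Sum>k<n. w n i k * w n j k) / real n" for n
    unfolding sum_distrib_left[symmetric] using D by simp
  ultimately show ?thesis by (simp add: D_def mult_ac)
qed

end

section \<open>Characteristic functions of sums\<close>

context prob_space
begin

lemma char_distr_scale:
  assumes [measurable]: "A \<in> borel_measurable M"
  shows "char (distr M borel (\<lambda>\<omega>. c * A \<omega>)) t = char (distr M borel A) (t * c)"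
  by (simp add: char_def integral_distr mult.assoc)

text \<open>Takes the place of Slutsky's lemma: |exp(itB) - 1| \<le> |tB|, and the first absolute
  moment is at most the root of the second. A perturbation that is small in mean square leaves the
  limit of the characteristic functions unchanged.\<close>

lemma norm_char_distr_add_diff_le:
  assumes [measurable]: "A \<in> borel_measurable M" "B \<in> borel_measurable M"
    and B2: "integrable M (\<lambda>\<omega>. (B \<omega>)\<^sup>2)"
  shows "norm (char (distr M borel (\<lambda>\<omega>. A \<omega> + B \<omega>)) t - char (distr M borel A) t)
    \<le> \<bar>t\<bar> * sqrt (expectation (\<lambda>\<omega>. (B \<omega>)\<^sup>2))"
proof -
  have iB: "integrable M B" by (rule square_integrable_imp_integrable[OF _ B2]) simp
  have int: "integrable M (\<lambda>\<omega>. iexp (t * Y \<omega>))" if [measurable]: "Y \<in> borel_measurable M" for Y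
    by (intro integrable_iexp) auto
  have "char (distr M borel (\<lambda>\<omega>. A \<omega> + B \<omega>)) t - char (distr M borel A) t =
      (CLINT \<omega>|M. iexp (t * (A \<omega> + B \<omega>)) - iexp (t * A \<omega>))"
    using int[of "\<lambda>\<omega>. A \<omega> + B \<omega>"] int[of A] by (simp add: char_def integral_distr)
  also have "norm \<dots> \<le> (\<integral>\<omega>. norm (iexp (t * (A \<omega> + B \<omega>)) - iexp (t * A \<omega>)) \<partial>M)"
    by (rule integral_norm_bound)
  also have "\<dots> \<le> (\<integral>\<omega>. \<bar>t\<bar> * \<bar>B \<omega>\<bar> \<partial>M)"
  proof (rule integral_mono)
    fix \<omega>
    have "iexp (t * (A \<omega> + B \<omega>)) - iexp (t * A \<omega>) = iexp (t * A \<omega>) * (iexp (t * B \<omega>) - 1)"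
      by (simp add: algebra_simps exp_add[symmetric])
    also have "norm \<dots> = norm (iexp (t * B \<omega>) - 1)" by (simp add: norm_mult)
    also have "\<dots> \<le> \<bar>t * B \<omega>\<bar>" using iexp_approx1[of "t * B \<omega>" 0] by simp
    finally show "norm (iexp (t * (A \<omega> + B \<omega>)) - iexp (t * A \<omega>)) \<le> \<bar>t\<bar> * \<bar>B \<omega>\<bar>" by (simp add: abs_mult)
  next
    show "integrable M (\<lambda>\<omega>. norm (iexp (t * (A \<omega> + B \<omega>)) - iexp (t * A \<omega>)))"
      using int[of "\<lambda>\<omega>. A \<omega> + B \<omega>"] int[of A] by (intro integrable_norm Bochner_Integration.integrable_diff) auto
  qed (use iB in auto)
  also have "\<dots> = \<bar>t\<bar> * expectation (\<lambda>\<omega>. \<bar>B \<omega>\<bar>)" by simp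
  also have "expectation (\<lambda>\<omega>. \<bar>B \<omega>\<bar>) \<le> sqrt (expectation (\<lambda>\<omega>. (B \<omega>)\<^sup>2))"
  proof (rule real_le_rsqrt)
    have "0 \<le> variance (\<lambda>\<omega>. \<bar>B \<omega>\<bar>)" by (rule variance_positive)
    also have "\<dots> = expectation (\<lambda>\<omega>. (B \<omega>)\<^sup>2) - (expectation (\<lambda>\<omega>. \<bar>B \<omega>\<bar>))\<^sup>2"
      using iB B2 by (subst variance_eq) auto
    finally show "(expectation (\<lambda>\<omega>. \<bar>B \<omega>\<bar>))\<^sup>2 \<le> expectation (\<lambda>\<omega>. (B \<omega>)\<^sup>2)" by simp
  qed
  finally show ?thesis by (simp add: mult_left_mono)
qed

text \<open>A central limit theorem for rows of independent, differently distributed terms. In place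
  of Lindeberg's condition, \<open>dom\<close> bounds the error term of the Taylor expansion of each
  characteristic function by that of one fixed square-integrable \<open>F\<close>; of the variances,
  only the averages have to converge.\<close>

lemma char_normalized_sum_tendsto:
  fixes Y :: "nat \<Rightarrow> nat \<Rightarrow> 'a \<Rightarrow> real" and F :: "'a \<Rightarrow> real"
  assumes indep: "\<And>n. indep_vars (\<lambda>_. borel) (Y n) {..<n}"
    and sq: "\<And>n k. k < n \<Longrightarrow> integrable M (\<lambda>\<omega>. (Y n k \<omega>)\<^sup>2)"
    and mean: "\<And>n k. k < n \<Longrightarrow> expectation (Y n k) = 0"
    and var: "\<And>n k. k < n \<Longrightarrow> expectation (\<lambda>\<omega>. (Y n k \<omega>)\<^sup>2) \<le> B"
    and F: "F \<in> borel_measurable M" "integrable M (\<lambda>\<omega>. (F \<omega>)\<^sup>2)"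
    and dom: "\<And>n k s. k < n \<Longrightarrow> s \<ge> 0 \<Longrightarrow>
      expectation (\<lambda>\<omega>. min (6 * (Y n k \<omega>)\<^sup>2) (s * \<bar>Y n k \<omega>\<bar> ^ 3)) \<le> expectation (\<lambda>\<omega>. min (6 * (F \<omega>)\<^sup>2) (s * \<bar>F \<omega>\<bar> ^ 3))"
    and avg: "(\<lambda>n. (\<Sum>k<n. expectation (\<lambda>\<omega>. (Y n k \<omega>)\<^sup>2)) / real n) \<longlonglongrightarrow> v"
  shows "(\<lambda>n. char (distr M borel (\<lambda>\<omega>. (1 / sqrt (real n)) * (\<Sum>k<n. Y n k \<omega>))) t) \<longlonglongrightarrow> complex_of_real (exp (- (v * t\<^sup>2 / 2)))"
proof -
  define u where "u n = t / sqrt (real n)" for n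
  define V where "V n k = expectation (\<lambda>\<omega>. (Y n k \<omega>)\<^sup>2)" for n k
  define \<delta> where "\<delta> n = expectation (\<lambda>\<omega>. min (6 * (F \<omega>)\<^sup>2) (\<bar>u n\<bar> * \<bar>F \<omega>\<bar> ^ 3))" for n
  have meas: "Y n k \<in> borel_measurable M" if "k < n" for n k
    using indep[of n] that by (auto simp: indep_vars_def)
  have V0: "V n k \<ge> 0" for n k by (simp add: V_def)
  have "u \<longlonglongrightarrow> 0" unfolding u_def by real_asymp
  \<comment> \<open>The minimum makes second moments suffice: the cubic term gives the pointwise
    limit, the quadratic one the integrable majorant.\<close>
  have "(\<lambda>n. LINT \<omega>|M. min (6 * (F \<omega>)\<^sup>2) (\<bar>u n\<bar> * \<bar>F \<omega>\<bar> ^ 3)) \<longlonglongrightarrow> (LINT \<omega>|M. 0)"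
  proof (rule integral_dominated_convergence[where w = "\<lambda>\<omega>. 6 * (F \<omega>)\<^sup>2"])
    show "AE \<omega> in M. (\<lambda>n. min (6 * (F \<omega>)\<^sup>2) (\<bar>u n\<bar> * \<bar>F \<omega>\<bar> ^ 3)) \<longlonglongrightarrow> 0"
    proof (rule AE_I2)
      fix \<omega>
      have "(\<lambda>n. min (6 * (F \<omega>)\<^sup>2) (\<bar>u n\<bar> * \<bar>F \<omega>\<bar> ^ 3)) \<longlonglongrightarrow> min (6 * (F \<omega>)\<^sup>2) (\<bar>0\<bar> * \<bar>F \<omega>\<bar> ^ 3)"
        by (intro tendsto_intros \<open>u \<longlonglongrightarrow> 0\<close>)
      then show "(\<lambda>n. min (6 * (F \<omega>)\<^sup>2) (\<bar>u n\<bar> * \<bar>F \<omega>\<bar> ^ 3)) \<longlonglongrightarrow> 0" by (simp add: min_absorb2)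
    qed
  qed (use F in \<open>auto simp: min_def\<close>)
  then have \<delta>: "\<delta> \<longlonglongrightarrow> 0" by (simp add: \<delta>_def[abs_def])
  have main: "norm (char (distr M borel (\<lambda>\<omega>. (1 / sqrt (real n)) * (\<Sum>k<n. Y n k \<omega>))) t
      - complex_of_real (exp (- (((\<Sum>k<n. V n k) / real n) * t\<^sup>2 / 2)))) \<le> t\<^sup>2 / 6 * \<delta> n + (t\<^sup>2 * B / 2)\<^sup>2 / real n"
    if n: "n > 0" for n
  proof -
    have u2: "(u n)\<^sup>2 = t\<^sup>2 / real n" by (simp add: u_def power_divide)
    have "char (distr M borel (\<lambda>\<omega>. (1 / sqrt (real n)) * (\<Sum>k<n. Y n k \<omega>))) t
       = char (distr M borel (\<lambda>\<omega>. \<Sum>k<n. Y n k \<omega>)) (u n)"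
      using meas by (subst char_distr_scale) (auto simp: u_def)
    also have "\<dots> = (\<Prod>k<n. char (distr M borel (Y n k)) (u n))"
      by (rule char_distr_sum[OF indep])
    \<comment> \<open>All factors lie in the unit disc, so the products differ by at most the sum of
      the differences of the factors. Each term is compared with a centred Gaussian of the same
      variance.\<close>
    also have "norm (\<dots> - (\<Prod>k<n. complex_of_real (exp (- (V n k * (u n)\<^sup>2 / 2)))))
       \<le> (\<Sum>k<n. norm (char (distr M borel (Y n k)) (u n) - complex_of_real (exp (- (V n k * (u n)\<^sup>2 / 2)))))"
    proof (rule norm_prod_diff)
      fix k assume "k \<in> {..<n}"
      then interpret Y: real_distribution "distr M borel (Y n k)" using meas by auto
      show "norm (char (distr M borel (Y n k)) (u n)) \<le> 1" by (rule Y.cmod_char_le_1)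
      show "norm (complex_of_real (exp (- (V n k * (u n)\<^sup>2 / 2)))) \<le> 1" using V0 by simp
    qed
    also have "\<dots> \<le> (\<Sum>k<n. (u n)\<^sup>2 / 6 * \<delta> n + (B * (u n)\<^sup>2 / 2)\<^sup>2)"
    proof (rule sum_mono)
      fix k assume "k \<in> {..<n}"
      then have k: "k < n" by simp
      let ?c = "char (distr M borel (Y n k)) (u n)"
      have "integrable M (Y n k)" by (rule square_integrable_imp_integrable[OF meas[OF k] sq[OF k]])
      then have "cmod (?c - (1 - (u n)\<^sup>2 * V n k / 2)) \<le> (u n)\<^sup>2 / 6 * expectation (\<lambda>\<omega>. min (6 * (Y n k \<omega>)\<^sup>2) (\<bar>u n\<bar> * \<bar>Y n k \<omega>\<bar> ^ 3))"
        using meas[OF k] sq[OF k] mean[OF k] by (intro char_approx3') (auto simp: V_def)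
      also have "\<dots> \<le> (u n)\<^sup>2 / 6 * \<delta> n"
        unfolding \<delta>_def using k by (intro mult_left_mono dom) auto
      finally have 1: "cmod (?c - (1 - (u n)\<^sup>2 * V n k / 2)) \<le> (u n)\<^sup>2 / 6 * \<delta> n" .
      have "cmod ((1 - (u n)\<^sup>2 * V n k / 2) - complex_of_real (exp (- (V n k * (u n)\<^sup>2 / 2)))) =
        \<bar>exp (- (V n k * (u n)\<^sup>2 / 2)) - (1 - V n k * (u n)\<^sup>2 / 2)\<bar>"
      proof -
        have "(1 - (u n)\<^sup>2 * V n k / 2) - complex_of_real (exp (- (V n k * (u n)\<^sup>2 / 2))) =
          complex_of_real (- (exp (- (V n k * (u n)\<^sup>2 / 2)) - (1 - V n k * (u n)\<^sup>2 / 2)))"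
          by (simp add: mult.commute)
        then show ?thesis by (simp only: norm_of_real abs_minus_cancel)
      qed
      also have "\<dots> \<le> (V n k * (u n)\<^sup>2 / 2)\<^sup>2"
        using V0 by (intro abs_exp_minus_approx) auto
      also have "\<dots> \<le> (B * (u n)\<^sup>2 / 2)\<^sup>2"
        using V0 var[OF k] by (intro power_mono divide_right_mono mult_right_mono) (auto simp: V_def)
      finally have 2: "cmod ((1 - (u n)\<^sup>2 * V n k / 2) - complex_of_real (exp (- (V n k * (u n)\<^sup>2 / 2)))) \<le> (B * (u n)\<^sup>2 / 2)\<^sup>2" .
      show "norm (?c - complex_of_real (exp (- (V n k * (u n)\<^sup>2 / 2)))) \<le> (u n)\<^sup>2 / 6 * \<delta> n + (B * (u n)\<^sup>2 / 2)\<^sup>2"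
        using norm_triangle_ineq[of "?c - (1 - (u n)\<^sup>2 * V n k / 2)" "(1 - (u n)\<^sup>2 * V n k / 2) - complex_of_real (exp (- (V n k * (u n)\<^sup>2 / 2)))"] 1 2
        by simp
    qed
    \<comment> \<open>As (u n)^2 = t^2 / n, the \<open>n\<close> first summands add up to a multiple
      of \<open>\<delta> n\<close> and the \<open>n\<close> squared ones to O(1/n).\<close>
    also have "\<dots> = t\<^sup>2 / 6 * \<delta> n + (t\<^sup>2 * B / 2)\<^sup>2 / real n"
      unfolding u2 using n by (simp add: field_simps power2_eq_square)
    also have "(\<Prod>k<n. complex_of_real (exp (- (V n k * (u n)\<^sup>2 / 2)))) = complex_of_real (exp (- (((\<Sum>k<n. V n k) / real n) * t\<^sup>2 / 2)))"
      unfolding of_real_prod[symmetric] exp_sum[symmetric, OF finite_lessThan] u2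
      by (simp add: sum_negf sum_divide_distrib sum_distrib_right)
    finally show ?thesis .
  qed
  have "(\<lambda>n. char (distr M borel (\<lambda>\<omega>. (1 / sqrt (real n)) * (\<Sum>k<n. Y n k \<omega>))) t
      - complex_of_real (exp (- (((\<Sum>k<n. V n k) / real n) * t\<^sup>2 / 2)))) \<longlonglongrightarrow> 0"
  proof (rule Lim_null_comparison)
    have "(\<lambda>n. t\<^sup>2 / 6 * \<delta> n + (t\<^sup>2 * B / 2)\<^sup>2 / real n) \<longlonglongrightarrow> t\<^sup>2 / 6 * 0 + 0"
      by (intro tendsto_intros \<delta> lim_const_over_n)
    then show "(\<lambda>n. t\<^sup>2 / 6 * \<delta> n + (t\<^sup>2 * B / 2)\<^sup>2 / real n) \<longlonglongrightarrow> 0" by simp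
  qed (use main in \<open>auto intro!: eventually_mono[OF eventually_gt_at_top[of 0]]\<close>)
  moreover have "(\<lambda>n. complex_of_real (exp (- (((\<Sum>k<n. V n k) / real n) * t\<^sup>2 / 2)))) \<longlonglongrightarrow> complex_of_real (exp (- (v * t\<^sup>2 / 2)))"
    using avg unfolding V_def by (intro tendsto_intros) auto
  ultimately show ?thesis by (rule Lim_transform[rotated])
qed

end

section \<open>The normal law, including the point mass\<close>

lemma real_distribution_normal_law:
  assumes "v \<ge> 0" shows "real_distribution (normal_law 0 v)"
proof (cases "v = 0")
  case True
  interpret prob_space "return borel (0::real)" by (rule prob_space_return) simp
  show ?thesis using True by (simp add: normal_law_def real_distribution_def real_distribution_axioms_def prob_space_axioms)
next
  case False
  then interpret prob_space "density lborel (normal_density 0 (sqrt v))"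
    using assms by (intro prob_space_normal_density) simp
  show ?thesis using False by (simp add: normal_law_def real_distribution_def real_distribution_axioms_def prob_space_axioms)
qed

text \<open>At \<open>v = 0\<close> both sides are 1, so Levy's continuity theorem also covers a
  vanishing limit variance.\<close>

lemma char_normal_law:
  assumes "v \<ge> 0" shows "char (normal_law 0 v) t = complex_of_real (exp (- (v * t\<^sup>2 / 2)))"
proof (cases "v = 0")
  case True
  then show ?thesis by (simp add: normal_law_def char_def integral_return)
next
  case False
  with assms have v: "v > 0" by simp
  interpret N: real_distribution std_normal_distribution by (rule real_dist_normal_dist)
  have "distributed std_normal_distribution lborel (\<lambda>x. x) std_normal_density"
    unfolding distributed_def by (auto intro!: distr_id2)
  from N.normal_density_affine[OF this, of "sqrt v" 0] v
  have "distributed std_normal_distribution lborel (\<lambda>x. sqrt v * x) (normal_density 0 (sqrt v))" by simp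
  then have "normal_law 0 v = distr std_normal_distribution lborel (\<lambda>x. sqrt v * x)"
    using v by (simp add: normal_law_def distributed_def)
  also have "\<dots> = distr std_normal_distribution borel (\<lambda>x. sqrt v * x)"
    by (intro distr_cong) auto
  finally have "char (normal_law 0 v) t = char std_normal_distribution (t * sqrt v)"
    using N.char_distr_scale[of "\<lambda>x. x" "sqrt v" t] by (simp add: distr_id2)
  then show ?thesis
    using v by (simp add: char_std_normal_distribution power_mult_distrib mult.commute)
qed

section \<open>Hoeffding decomposition and the central limit theorem for U-statistics\<close>

context iid_sequence
begin

text \<open>What observation \<open>Suc k\<close> contributes to the sum of the projections, divided
  by \<open>n ^ (d - 1)\<close>: the product of binomials counts the tuples with that index at
  position \<open>Suc i\<close>.\<close>

definition linear_part :: "((nat \<Rightarrow> 's) \<Rightarrow> real) \<Rightarrow> nat \<Rightarrow> nat \<Rightarrow> 's \<Rightarrow> real" where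
  "linear_part f n k z = (\<Sum>i<d. real (k choose i) * real ((n - Suc k) choose (d - Suc i)) / real n ^ (d - 1) * proj f (Suc i) z)"

text \<open>The projections are regrouped by observation through
  \<open>sum_incr_tuples_by_value\<close>, so that the first sum has independent terms.\<close>

lemma U_stat_decomposition:
  assumes "n > 0"
  shows "U_stat d f X n \<omega> - real (n choose d) * integral\<^sup>L Q f =
    real n ^ (d - 1) * (\<Sum>k<n. linear_part f n k (X (Suc k) \<omega>)) + (\<Sum>\<iota>\<in>incr_tuples d n. rem f (tup \<iota> \<omega>))"
proof -
  have "(\<Sum>\<iota>\<in>incr_tuples d n. \<Sum>i=1..d. proj f i (tup \<iota> \<omega> i)) = (\<Sum>\<iota>\<in>incr_tuples d n. \<Sum>i<d. proj f (Suc i) (X (\<iota> (Suc i)) \<omega>))"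
    unfolding sum.atLeast1_atMost_eq[folded One_nat_def] by (intro sum.cong refl) (auto simp: tup_def)
  also have "\<dots> = (\<Sum>i<d. \<Sum>\<iota>\<in>incr_tuples d n. proj f (Suc i) (X (\<iota> (Suc i)) \<omega>))"
    by (rule sum.swap)
  also have "\<dots> = (\<Sum>i<d. \<Sum>k<n. real ((k choose i) * ((n - Suc k) choose (d - Suc i))) * proj f (Suc i) (X (Suc k) \<omega>))"
    by (intro sum.cong refl sum_incr_tuples_by_value) auto
  also have "\<dots> = (\<Sum>k<n. \<Sum>i<d. real ((k choose i) * ((n - Suc k) choose (d - Suc i))) * proj f (Suc i) (X (Suc k) \<omega>))"
    by (rule sum.swap)
  also have "\<dots> = real n ^ (d - 1) * (\<Sum>k<n. linear_part f n k (X (Suc k) \<omega>))"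
    unfolding linear_part_def sum_distrib_left using assms by (intro sum.cong refl) simp
  finally show ?thesis
    by (simp add: U_stat_tup rem_def sum_subtractf card_incr_tuples)
qed

text \<open>At most n^d tuples have at most d^4 n^(d-2) correlated partners each. The second moment
  is thus of order n^(2d-2), one power of n below the square of the normalisation n^(d-1/2).\<close>

lemma rem_second_moment:
  assumes f: "sqi f"
  shows "integrable M (\<lambda>\<omega>. (\<Sum>\<iota>\<in>incr_tuples d n. rem f (tup \<iota> \<omega>))\<^sup>2)"
    and "n > 0 \<Longrightarrow> expectation (\<lambda>\<omega>. (\<Sum>\<iota>\<in>incr_tuples d n. rem f (tup \<iota> \<omega>))\<^sup>2)
      \<le> real d ^ 4 * (\<integral>y. (rem f y)\<^sup>2 \<partial>Q) * (real n ^ (d - 1))\<^sup>2"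
proof -
  let ?T = "incr_tuples d n"
  let ?R = "\<lambda>\<iota> \<kappa>. \<not> card (\<iota> ` {1..d} \<inter> \<kappa> ` {1..d}) \<le> 1"
  have zero: "expectation (\<lambda>\<omega>. rem f (tup \<iota> \<omega>) * rem f (tup \<kappa> \<omega>)) = 0"
    if T: "\<iota> \<in> ?T" "\<kappa> \<in> ?T" and le1: "\<not> ?R \<iota> \<kappa>" for \<iota> \<kappa>
  proof -
    have fin: "finite (\<iota> ` {1..d} \<inter> \<kappa> ` {1..d})" by simp
    \<comment> \<open>Tuples use the indices from 1 on, so the observation \<open>X 0\<close> is
      free for the decoupling.\<close>
    have pos: "0 \<notin> \<iota> ` {1..d}" "0 \<notin> \<kappa> ` {1..d}"
      using incr_tuples_PiE[OF T(1)] incr_tuples_PiE[OF T(2)] by (force simp: PiE_iff)+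
    consider "\<iota> ` {1..d} \<inter> \<kappa> ` {1..d} = {}" | x where "\<iota> ` {1..d} \<inter> \<kappa> ` {1..d} = {x}"
      using le1 fin by (metis card_0_eq card_1_singletonE le_neq_implies_less less_one)
    then show ?thesis
    proof cases
      case 1
      then show ?thesis
        using T by (intro integral_tup_mult_disjoint sqi_rem integral_rem f incr_tuples_inj_on)
    next
      case 2
      then have "x \<in> \<iota> ` {1..d}" "x \<in> \<kappa> ` {1..d}" by auto
      then obtain i j where ij: "i \<in> {1..d}" "j \<in> {1..d}" "x = \<iota> i" "x = \<kappa> j" by blast
      show ?thesis
        using T 2 ij pos
        by (intro integral_tup_mult_degenerate[OF sqi_rem[OF f] ij(1,2) rem_degenerate[OF f ij(1,2)]] incr_tuples_inj_on) auto
    qed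
  qed
  \<comment> \<open>The separate value at \<open>n = 0\<close> avoids a division by zero;
    integrability is claimed there as well.\<close>
  define N where "N = (if n = 0 then real (card ?T) else real d ^ 4 * real n ^ d / (real n)\<^sup>2)"
  have N: "real (card {\<kappa> \<in> ?T. ?R \<iota> \<kappa>}) \<le> N" for \<iota>
  proof (cases "n = 0")
    case True
    then show ?thesis by (auto simp: N_def intro!: card_mono)
  next
    case False
    have "real (card {\<kappa> \<in> ?T. ?R \<iota> \<kappa>} * n\<^sup>2) \<le> real (d ^ 4 * n ^ d)"
      using card_incr_tuples_meeting_twice[of d n \<iota>] by (simp only: of_nat_le_iff)
    then show ?thesis using False by (simp add: N_def divide_simps)
  qed
  note * = second_moment_sum_tup[where R = ?R, OF sqi_rem[OF f] finite_incr_tuples incr_tuples_inj_on zero N]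
  show "integrable M (\<lambda>\<omega>. (\<Sum>\<iota>\<in>?T. rem f (tup \<iota> \<omega>))\<^sup>2)" by (rule *(1))
  assume n: "n > 0"
  have "expectation (\<lambda>\<omega>. (\<Sum>\<iota>\<in>?T. rem f (tup \<iota> \<omega>))\<^sup>2) \<le> real (card ?T) * N * (\<integral>y. (rem f y)\<^sup>2 \<partial>Q)" by (rule *(2))
  also have "\<dots> \<le> real n ^ d * N * (\<integral>y. (rem f y)\<^sup>2 \<partial>Q)"
  proof (intro mult_right_mono)
    have "n choose d \<le> (n choose d) * fact d" by simp
    also have "\<dots> \<le> n ^ d" by (rule binomial_fact_pow)
    finally show "real (card ?T) \<le> real n ^ d"
      by (simp add: card_incr_tuples flip: of_nat_power)
  qed (simp_all add: N_def)
  also have "\<dots> = real d ^ 4 * (\<integral>y. (rem f y)\<^sup>2 \<partial>Q) * (real n ^ (d - 1))\<^sup>2"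
  proof -
    have "real n ^ d = real n * real n ^ (d - 1)" using d_pos by (cases d) auto
    then show ?thesis using n by (simp add: N_def power2_eq_square)
  qed
  finally show "expectation (\<lambda>\<omega>. (\<Sum>\<iota>\<in>?T. rem f (tup \<iota> \<omega>))\<^sup>2)
      \<le> real d ^ 4 * (\<integral>y. (rem f y)\<^sup>2 \<partial>Q) * (real n ^ (d - 1))\<^sup>2" .
qed

text \<open>Weights between 0 and 1 allow one majorant for all \<open>linear_part f n k\<close>, the
  sum of the absolute projections.\<close>

lemma weight_bounds:
  assumes "k < n" "i < d"
  shows "0 \<le> real (k choose i) * real ((n - Suc k) choose (d - Suc i)) / real n ^ (d - 1)"
    and "real (k choose i) * real ((n - Suc k) choose (d - Suc i)) / real n ^ (d - 1) \<le> 1"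
proof -
  have le: "real (x choose p) \<le> real n ^ p" if "x \<le> n" for x p
  proof -
    have "x choose p \<le> (x choose p) * fact p" by simp
    also have "\<dots> \<le> x ^ p" by (rule binomial_fact_pow)
    also have "\<dots> \<le> n ^ p" using that by (rule power_mono) simp
    finally show ?thesis by (simp flip: of_nat_power)
  qed
  have "real (k choose i) * real ((n - Suc k) choose (d - Suc i)) \<le> real n ^ i * real n ^ (d - Suc i)"
    using assms by (intro mult_mono le) auto
  also have "\<dots> = real n ^ (d - 1)" using assms by (simp add: One_nat_def flip: power_add)
  finally show "real (k choose i) * real ((n - Suc k) choose (d - Suc i)) / real n ^ (d - 1) \<le> 1"
    using assms by (simp add: divide_simps)
qed simp

lemma proj_X:
  assumes f: "sqi f" and ij: "i \<in> {1..d}" "j \<in> {1..d}"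
  shows "expectation (\<lambda>\<omega>. proj f i (X k \<omega>)) = 0"
    and "integrable M (\<lambda>\<omega>. proj f i (X k \<omega>))"
    and "integrable M (\<lambda>\<omega>. proj f i (X k \<omega>) * proj f j (X k \<omega>))"
    and "expectation (\<lambda>\<omega>. proj f i (X k \<omega>) * proj f j (X k \<omega>)) = expectation (\<lambda>\<omega>. proj f i (X 0 \<omega>) * proj f j (X 0 \<omega>))"
proof -
  have 1: "1 \<in> {1..d}" using d_pos by simp
  note [measurable] = measurable_proj[OF sqi_measurable[OF f] ij(1)] measurable_proj[OF sqi_measurable[OF f] ij(2)]
  have m: "(\<lambda>z. proj f i z * proj f j z) \<in> borel_measurable S" by measurable
  note A = integral_proj_X[of "proj f i", OF measurable_proj[OF sqi_measurable[OF f] ij(1)]]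
  note B = integral_proj_X[OF m]
  show "expectation (\<lambda>\<omega>. proj f i (X k \<omega>)) = 0"
    using A(1)[of k] A(3) integral_proj[OF f ij(1) 1] by simp
  show "integrable M (\<lambda>\<omega>. proj f i (X k \<omega>))"
    using A(2)[of k] A(4) sqi_integrable[OF sqi_proj[OF f ij(1) 1]] by simp
  show "integrable M (\<lambda>\<omega>. proj f i (X k \<omega>) * proj f j (X k \<omega>))"
    using B(2)[of k] B(4) sqi_mult[OF sqi_proj[OF f ij(1) 1] sqi_proj[OF f ij(2) 1]] by simp
  show "expectation (\<lambda>\<omega>. proj f i (X k \<omega>) * proj f j (X k \<omega>)) = expectation (\<lambda>\<omega>. proj f i (X 0 \<omega>) * proj f j (X 0 \<omega>))"
    by (rule B(1))
qed

lemma U_cov_eq: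
  assumes f: "sqi f" and ij: "i \<in> {1..d}" "j \<in> {1..d}"
  shows "U_cov M d f X i j = expectation (\<lambda>\<omega>. proj f i (X 0 \<omega>) * proj f j (X 0 \<omega>))"
proof -
  have X0: "X 0 \<omega> \<in> space S" if "\<omega> \<in> space M" for \<omega>
    using measurable_space[OF measurable_X that] .
  have eq: "U_proj M d f X k (X 0 \<omega>) = proj f k (X 0 \<omega>)" if "k \<in> {1..d}" "\<omega> \<in> space M" for k \<omega>
    using that X0 sqi_measurable[OF f] by (intro U_proj_eq) auto
  have E: "expectation (\<lambda>\<omega>. U_proj M d f X k (X 0 \<omega>)) = 0" if "k \<in> {1..d}" for k
  proof -
    have "expectation (\<lambda>\<omega>. U_proj M d f X k (X 0 \<omega>)) = expectation (\<lambda>\<omega>. proj f k (X 0 \<omega>))"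
      by (intro Bochner_Integration.integral_cong refl eq that)
    then show ?thesis using proj_X(1)[OF f that that, of 0] by simp
  qed
  show ?thesis
    unfolding U_cov_def cov_def E[OF ij(1)] E[OF ij(2)]
    by (intro Bochner_Integration.integral_cong) (simp_all add: eq[OF ij(1)] eq[OF ij(2)])
qed

lemma linear_part_sum_square:
  assumes f: "sqi f"
  defines "w \<equiv> \<lambda>n i k. real (k choose i) * real ((n - Suc k) choose (d - Suc i)) / real n ^ (d - 1)"
  shows "integrable M (\<lambda>\<omega>. (linear_part f n k (X m \<omega>))\<^sup>2)"
    and "expectation (\<lambda>\<omega>. (linear_part f n k (X m \<omega>))\<^sup>2) =
      (\<Sum>i<d. \<Sum>j<d. w n i k * w n j k * U_cov M d f X (Suc i) (Suc j))"
    and "expectation (\<lambda>\<omega>. linear_part f n k (X m \<omega>)) = 0"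
proof -
  let ?p = "\<lambda>i \<omega>. proj f (Suc i) (X m \<omega>)"
  have eq: "(linear_part f n k (X m \<omega>))\<^sup>2 = (\<Sum>i<d. \<Sum>j<d. w n i k * w n j k * (?p i \<omega> * ?p j \<omega>))" for \<omega>
    unfolding linear_part_def w_def power2_eq_square sum_product by (intro sum.cong refl) (simp add: mult_ac)
  have int: "integrable M (\<lambda>\<omega>. w n i k * w n j k * (?p i \<omega> * ?p j \<omega>))" if "i < d" "j < d" for i j
    using that by (intro integrable_mult_right proj_X(3)[OF f]) auto
  show "integrable M (\<lambda>\<omega>. (linear_part f n k (X m \<omega>))\<^sup>2)"
    unfolding eq by (intro Bochner_Integration.integrable_sum int) auto
  have "expectation (\<lambda>\<omega>. (linear_part f n k (X m \<omega>))\<^sup>2) = (\<Sum>i<d. expectation (\<lambda>\<omega>. \<Sum>j<d. w n i k * w n j k * (?p i \<omega> * ?p j \<omega>)))"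
    unfolding eq by (intro Bochner_Integration.integral_sum Bochner_Integration.integrable_sum int) auto
  also have "\<dots> = (\<Sum>i<d. \<Sum>j<d. expectation (\<lambda>\<omega>. w n i k * w n j k * (?p i \<omega> * ?p j \<omega>)))"
    by (intro sum.cong refl Bochner_Integration.integral_sum int) auto
  also have "\<dots> = (\<Sum>i<d. \<Sum>j<d. w n i k * w n j k * U_cov M d f X (Suc i) (Suc j))"
  proof (intro sum.cong refl)
    fix i j assume "i \<in> {..<d}" "j \<in> {..<d}"
    then have ij: "Suc i \<in> {1..d}" "Suc j \<in> {1..d}" by auto
    show "expectation (\<lambda>\<omega>. w n i k * w n j k * (?p i \<omega> * ?p j \<omega>)) = w n i k * w n j k * U_cov M d f X (Suc i) (Suc j)"
      unfolding U_cov_eq[OF f ij] proj_X(4)[OF f ij, of m, symmetric] by (rule integral_mult_right_zero)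
  qed
  finally show "expectation (\<lambda>\<omega>. (linear_part f n k (X m \<omega>))\<^sup>2) =
      (\<Sum>i<d. \<Sum>j<d. w n i k * w n j k * U_cov M d f X (Suc i) (Suc j))" .
  have "expectation (\<lambda>\<omega>. linear_part f n k (X m \<omega>)) = (\<Sum>i<d. expectation (\<lambda>\<omega>. w n i k * ?p i \<omega>))"
    unfolding linear_part_def w_def using f
    by (intro Bochner_Integration.integral_sum integrable_mult_right proj_X(2)) auto
  also have "\<dots> = (\<Sum>i<d. w n i k * expectation (?p i))" by simp
  also have "\<dots> = 0" using f by (intro sum.neutral) (auto intro!: proj_X(1))
  finally show "expectation (\<lambda>\<omega>. linear_part f n k (X m \<omega>)) = 0" .
qed

lemma measurable_linear_part:
  assumes "sqi f" shows "linear_part f n k \<in> borel_measurable S"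
  unfolding linear_part_def[abs_def] using assms
  by (intro borel_measurable_sum borel_measurable_times borel_measurable_const measurable_proj sqi_measurable) auto

text \<open>Lets both indices start at 0 and writes the factorials through \<open>d - 1\<close>,
  which is the \<open>e\<close> of \<open>sum_weights_tendsto\<close>.\<close>

lemma U_sigma2_eq:
  "U_sigma2 M d f X = (\<Sum>i<d. \<Sum>j<d. fact (i + j) * fact (2 * (d - 1) - i - j) /
     (fact i * fact j * fact (d - 1 - i) * fact (d - 1 - j) * fact (2 * (d - 1) + 1)) * U_cov M d f X (Suc i) (Suc j))"
proof -
  have "2 * d - Suc i - Suc j = 2 * (d - 1) - i - j" "d - Suc i = d - 1 - i" "2 * d - 1 = 2 * (d - 1) + 1" for i j
    using d_pos by auto
  then show ?thesis
    unfolding U_sigma2_def sum.atLeast1_atMost_eq[folded One_nat_def] by simp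
qed

text \<open>The mean square of \<open>linear_part\<close> is a quadratic form in the weights with
  the covariances as coefficients; averaging the products of weights over \<open>k\<close> yields
  the factorial coefficients of \<open>U_sigma2\<close>.\<close>

lemma linear_part_average_variance:
  assumes f: "sqi f"
  shows "(\<lambda>n. (\<Sum>k<n. expectation (\<lambda>\<omega>. (linear_part f n k (X (Suc k) \<omega>))\<^sup>2)) / real n) \<longlonglongrightarrow> U_sigma2 M d f X"
proof -
  define w where "w n i k = real (k choose i) * real ((n - Suc k) choose (d - 1 - i)) / real n ^ (d - 1)" for n i k
  have w: "real (k choose i) * real ((n - Suc k) choose (d - Suc i)) / real n ^ (d - 1) = w n i k" for n i k
    by (simp add: w_def One_nat_def)
  have "(\<Sum>k<n. expectation (\<lambda>\<omega>. (linear_part f n k (X (Suc k) \<omega>))\<^sup>2)) / real n =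
     (\<Sum>i<d. \<Sum>j<d. (\<Sum>k<n. w n i k * w n j k) / real n * U_cov M d f X (Suc i) (Suc j))" for n
  proof -
    have "(\<Sum>k<n. expectation (\<lambda>\<omega>. (linear_part f n k (X (Suc k) \<omega>))\<^sup>2)) =
       (\<Sum>k<n. \<Sum>i<d. \<Sum>j<d. w n i k * w n j k * U_cov M d f X (Suc i) (Suc j))"
      by (intro sum.cong refl) (simp only: linear_part_sum_square(2)[OF f] w)
    also have "\<dots> = (\<Sum>i<d. \<Sum>k<n. \<Sum>j<d. w n i k * w n j k * U_cov M d f X (Suc i) (Suc j))"
      by (rule sum.swap)
    also have "\<dots> = (\<Sum>i<d. \<Sum>j<d. \<Sum>k<n. w n i k * w n j k * U_cov M d f X (Suc i) (Suc j))"
      by (intro sum.cong refl sum.swap)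
    finally show ?thesis by (simp add: sum_divide_distrib sum_distrib_right)
  qed
  moreover have "(\<lambda>n. \<Sum>i<d. \<Sum>j<d. (\<Sum>k<n. w n i k * w n j k) / real n * U_cov M d f X (Suc i) (Suc j)) \<longlonglongrightarrow> U_sigma2 M d f X"
    unfolding U_sigma2_eq w_def
    by (intro tendsto_sum tendsto_mult tendsto_const sum_weights_tendsto) auto
  ultimately show ?thesis by simp
qed

text \<open>Not visible in the formula: \<open>U_sigma2\<close> is a limit of averages of second
  moments.\<close>

lemma U_sigma2_nonneg: "sqi f \<Longrightarrow> U_sigma2 M d f X \<ge> 0"
  by (rule LIMSEQ_le_const[OF linear_part_average_variance]) (auto intro!: exI[of _ 0] divide_nonneg_nonneg sum_nonneg)

lemma char_linear_part_tendsto: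
  assumes f: "sqi f"
  shows "(\<lambda>n. char (distr M borel (\<lambda>\<omega>. (1 / sqrt (real n)) * (\<Sum>k<n. linear_part f n k (X (Suc k) \<omega>)))) t)
    \<longlonglongrightarrow> complex_of_real (exp (- (U_sigma2 M d f X * t\<^sup>2 / 2)))"
proof -
  \<comment> \<open>\<open>G\<close> dominates every \<open>linear_part\<close> and is
    square-integrable along \<open>X\<close>, since products of projections are integrable;
    \<open>G (X 0 \<omega>)\<close> becomes the \<open>F\<close> of the limit theorem.\<close>
  define G where "G z = (\<Sum>i<d. \<bar>proj f (Suc i) z\<bar>)" for z
  have Gm [measurable]: "G \<in> borel_measurable S"
    unfolding G_def[abs_def] using f
    by (intro borel_measurable_sum borel_measurable_abs measurable_proj sqi_measurable) auto
  note [measurable] = measurable_linear_part[OF f]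
  have LG: "\<bar>linear_part f n k z\<bar> \<le> G z" if "k < n" for n k z
    unfolding linear_part_def G_def
  proof (intro order.trans[OF sum_abs] sum_mono)
    fix i assume "i \<in> {..<d}"
    then have "i < d" by simp
    from weight_bounds[OF \<open>k < n\<close> this]
    show "\<bar>real (k choose i) * real ((n - Suc k) choose (d - Suc i)) / real n ^ (d - 1) * proj f (Suc i) z\<bar> \<le> \<bar>proj f (Suc i) z\<bar>"
      unfolding abs_mult[of "_ / _"] by (intro mult_left_le_one_le) auto
  qed
  have G0: "G z \<ge> 0" for z by (simp add: G_def sum_nonneg)
  have G2: "integrable M (\<lambda>\<omega>. (G (X m \<omega>))\<^sup>2)" for m
  proof -
    have "integrable M (\<lambda>\<omega>. \<Sum>i<d. \<Sum>j<d. \<bar>proj f (Suc i) (X m \<omega>) * proj f (Suc j) (X m \<omega>)\<bar>)"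
      using f by (intro Bochner_Integration.integrable_sum integrable_abs proj_X(3)) auto
    then show ?thesis by (simp add: G_def power2_eq_square sum_product abs_mult)
  qed
  have L2: "integrable M (\<lambda>\<omega>. (linear_part f n k (X m \<omega>))\<^sup>2)" for n k m
    by (rule linear_part_sum_square(1)[OF f])
  have imin: "integrable M (\<lambda>\<omega>. min (6 * (Y \<omega>)\<^sup>2) (s * \<bar>Y \<omega>\<bar> ^ 3))"
    if "integrable M (\<lambda>\<omega>. (Y \<omega>)\<^sup>2)" "s \<ge> 0" "Y \<in> borel_measurable M" for Y :: "'a \<Rightarrow> real" and s
  proof (rule Bochner_Integration.integrable_bound)
    show "integrable M (\<lambda>\<omega>. 6 * (Y \<omega>)\<^sup>2)" using that by auto
    show "(\<lambda>\<omega>. min (6 * (Y \<omega>)\<^sup>2) (s * \<bar>Y \<omega>\<bar> ^ 3)) \<in> borel_measurable M" using that by measurable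
  qed (use that in \<open>auto simp: min_def\<close>)
  show ?thesis
  proof (rule char_normalized_sum_tendsto[where F = "\<lambda>\<omega>. G (X 0 \<omega>)" and B = "expectation (\<lambda>\<omega>. (G (X 0 \<omega>))\<^sup>2)"])
    fix n k :: nat and s :: real assume k: "k < n"
    have L: "(linear_part f n k (X (Suc k) \<omega>))\<^sup>2 \<le> (G (X (Suc k) \<omega>))\<^sup>2"
      "\<bar>linear_part f n k (X (Suc k) \<omega>)\<bar> ^ 3 \<le> \<bar>G (X (Suc k) \<omega>)\<bar> ^ 3" for \<omega>
      using LG[OF k] G0 by (auto simp: abs_le_square_iff[symmetric] intro!: power_mono)
    have "expectation (\<lambda>\<omega>. (linear_part f n k (X (Suc k) \<omega>))\<^sup>2) \<le> expectation (\<lambda>\<omega>. (G (X (Suc k) \<omega>))\<^sup>2)"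
      by (intro integral_mono L2 G2 L)
    also have "\<dots> = expectation (\<lambda>\<omega>. (G (X 0 \<omega>))\<^sup>2)"
      by (rule integral_proj_X(1)[of "\<lambda>z. (G z)\<^sup>2"]) measurable
    finally show "expectation (\<lambda>\<omega>. (linear_part f n k (X (Suc k) \<omega>))\<^sup>2) \<le> expectation (\<lambda>\<omega>. (G (X 0 \<omega>))\<^sup>2)" .
    show "expectation (\<lambda>\<omega>. min (6 * (linear_part f n k (X (Suc k) \<omega>))\<^sup>2) (s * \<bar>linear_part f n k (X (Suc k) \<omega>)\<bar> ^ 3))
      \<le> expectation (\<lambda>\<omega>. min (6 * (G (X 0 \<omega>))\<^sup>2) (s * \<bar>G (X 0 \<omega>)\<bar> ^ 3))" if s: "s \<ge> 0"
    proof -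
      have "expectation (\<lambda>\<omega>. min (6 * (linear_part f n k (X (Suc k) \<omega>))\<^sup>2) (s * \<bar>linear_part f n k (X (Suc k) \<omega>)\<bar> ^ 3))
        \<le> expectation (\<lambda>\<omega>. min (6 * (G (X (Suc k) \<omega>))\<^sup>2) (s * \<bar>G (X (Suc k) \<omega>)\<bar> ^ 3))"
      proof (rule integral_mono)
        show "integrable M (\<lambda>\<omega>. min (6 * (linear_part f n k (X (Suc k) \<omega>))\<^sup>2) (s * \<bar>linear_part f n k (X (Suc k) \<omega>)\<bar> ^ 3))"
          by (rule imin[OF L2 s]) measurable
        show "integrable M (\<lambda>\<omega>. min (6 * (G (X (Suc k) \<omega>))\<^sup>2) (s * \<bar>G (X (Suc k) \<omega>)\<bar> ^ 3))"
          by (rule imin[OF G2 s]) measurable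
        show "min (6 * (linear_part f n k (X (Suc k) \<omega>))\<^sup>2) (s * \<bar>linear_part f n k (X (Suc k) \<omega>)\<bar> ^ 3)
          \<le> min (6 * (G (X (Suc k) \<omega>))\<^sup>2) (s * \<bar>G (X (Suc k) \<omega>)\<bar> ^ 3)" for \<omega>
          by (rule min.mono; rule mult_left_mono; (rule L)?) (use s in auto)
      qed
      also have "\<dots> = expectation (\<lambda>\<omega>. min (6 * (G (X 0 \<omega>))\<^sup>2) (s * \<bar>G (X 0 \<omega>)\<bar> ^ 3))"
        by (rule integral_proj_X(1)[of "\<lambda>z. min (6 * (G z)\<^sup>2) (s * \<bar>G z\<bar> ^ 3)"]) measurable
      finally show ?thesis .
    qed
  next
    show "indep_vars (\<lambda>_. borel) (\<lambda>k \<omega>. linear_part f n k (X (Suc k) \<omega>)) {..<n}" for n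
      by (rule indep_vars_compose2[OF indep_X_reindex]) (auto intro: measurable_linear_part f)
  next
    show "(\<lambda>\<omega>. G (X 0 \<omega>)) \<in> borel_measurable M" by measurable
  qed (rule L2 G2 linear_part_sum_square(3)[OF f] linear_part_average_variance[OF f])+
qed

text \<open>The sign is reversed so that a lower bound on U becomes an upper bound on the variable;
  the scale \<open>l\<close> is left free and fixed by the passage times.\<close>

theorem central_limit_U_stat:
  assumes f: "sqi f" and l: "l > 0"
  shows "weak_conv_m (\<lambda>n. distr M borel (\<lambda>\<omega>. (real (n choose d) * integral\<^sup>L Q f - U_stat d f X n \<omega>) / (l * (sqrt (real n) * real n ^ (d - 1)))))
    (normal_law 0 (U_sigma2 M d f X / l\<^sup>2))"
proof (rule levy_continuity)
  note [measurable] = measurable_linear_part[OF f] sqi_measurable[OF sqi_rem[OF f]] measurable_U_stat[OF sqi_measurable[OF f]]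
  define r where "r n = sqrt (real n) * real n ^ (d - 1)" for n
  define Z where "Z n \<omega> = (real (n choose d) * integral\<^sup>L Q f - U_stat d f X n \<omega>) / (l * r n)" for n \<omega>
  define W where "W n \<omega> = (1 / sqrt (real n)) * (\<Sum>k<n. linear_part f n k (X (Suc k) \<omega>))" for n \<omega>
  define R where "R n \<omega> = (\<Sum>\<iota>\<in>incr_tuples d n. rem f (tup \<iota> \<omega>))" for n \<omega>
  define K where "K = real d ^ 4 * (\<integral>y. (rem f y)\<^sup>2 \<partial>Q)"
  have [measurable]: "W n \<in> borel_measurable M" "Z n \<in> borel_measurable M" "R n \<in> borel_measurable M" for n
    unfolding W_def[abs_def] Z_def[abs_def] R_def[abs_def] by measurable
  have fold: "(\<lambda>\<omega>. (real (n choose d) * integral\<^sup>L Q f - U_stat d f X n \<omega>) / (l * (sqrt (real n) * real n ^ (d - 1)))) = Z n" for n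
    by (simp add: Z_def[abs_def] r_def)
  show "real_distribution (distr M borel (\<lambda>\<omega>. (real (n choose d) * integral\<^sup>L Q f - U_stat d f X n \<omega>) / (l * (sqrt (real n) * real n ^ (d - 1)))))" for n
    unfolding fold by simp
  show "real_distribution (normal_law 0 (U_sigma2 M d f X / l\<^sup>2))"
    using U_sigma2_nonneg[OF f] by (intro real_distribution_normal_law) simp
  fix t
  \<comment> \<open>The factor \<open>- 1 / l\<close> moves into the argument of the characteristic
    function; its sign disappears in \<open>t'\<^sup>2\<close>.\<close>
  define t' where "t' = - t / l"
  have diff: "norm (char (distr M borel (Z n)) t - char (distr M borel (W n)) t') \<le> \<bar>t'\<bar> * sqrt (K / real n)" if n: "n > 0" for n
  proof -
    have r: "r n > 0" using n by (simp add: r_def)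
    have "Z n = (\<lambda>\<omega>. (- 1 / l) * (W n \<omega> + R n \<omega> / r n))"
    proof
      fix \<omega>
      have "Z n \<omega> = (- 1 / l) * ((U_stat d f X n \<omega> - real (n choose d) * integral\<^sup>L Q f) / r n)"
        using l r by (simp add: Z_def field_simps)
      also have "U_stat d f X n \<omega> - real (n choose d) * integral\<^sup>L Q f = r n * W n \<omega> + R n \<omega>"
        unfolding U_stat_decomposition[OF n] R_def W_def r_def using n by simp
      also have "(r n * W n \<omega> + R n \<omega>) / r n = W n \<omega> + R n \<omega> / r n" using r by (simp add: add_divide_distrib)
      finally show "Z n \<omega> = (- 1 / l) * (W n \<omega> + R n \<omega> / r n)" .
    qed
    then have "char (distr M borel (Z n)) t = char (distr M borel (\<lambda>\<omega>. W n \<omega> + R n \<omega> / r n)) t'"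
      by (simp only:) (subst char_distr_scale, auto simp: t'_def)
    moreover have "norm (char (distr M borel (\<lambda>\<omega>. W n \<omega> + R n \<omega> / r n)) t' - char (distr M borel (W n)) t')
      \<le> \<bar>t'\<bar> * sqrt (expectation (\<lambda>\<omega>. (R n \<omega> / r n)\<^sup>2))"
      using rem_second_moment(1)[OF f, of n] by (intro norm_char_distr_add_diff_le) (auto simp: power_divide R_def[symmetric])
    moreover have "expectation (\<lambda>\<omega>. (R n \<omega> / r n)\<^sup>2) \<le> K / real n"
    proof -
      have "expectation (\<lambda>\<omega>. (R n \<omega> / r n)\<^sup>2) = expectation (\<lambda>\<omega>. (R n \<omega>)\<^sup>2) / (r n)\<^sup>2"
        by (simp add: power_divide)
      also have "\<dots> \<le> K * (real n ^ (d - 1))\<^sup>2 / (r n)\<^sup>2"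
        using rem_second_moment(2)[OF f n] by (intro divide_right_mono) (auto simp: K_def R_def)
      also have "\<dots> = K / real n" using n by (simp add: r_def power_mult_distrib)
      finally show ?thesis .
    qed
    ultimately show ?thesis
      by (simp only:) (meson abs_ge_zero mult_left_mono order.trans real_sqrt_le_mono)
  qed
  have "(\<lambda>n. char (distr M borel (Z n)) t - char (distr M borel (W n)) t') \<longlonglongrightarrow> 0"
  proof (rule Lim_null_comparison)
    have "(\<lambda>n. \<bar>t'\<bar> * sqrt (K / real n)) \<longlonglongrightarrow> \<bar>t'\<bar> * sqrt 0"
      by (intro tendsto_intros lim_const_over_n)
    then show "(\<lambda>n. \<bar>t'\<bar> * sqrt (K / real n)) \<longlonglongrightarrow> 0" by simp
  qed (use diff in \<open>auto intro!: eventually_mono[OF eventually_gt_at_top[of 0]]\<close>)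
  moreover have "(\<lambda>n. char (distr M borel (W n)) t') \<longlonglongrightarrow> complex_of_real (exp (- (U_sigma2 M d f X * t'\<^sup>2 / 2)))"
    using char_linear_part_tendsto[OF f] unfolding W_def[abs_def] .
  ultimately have "(\<lambda>n. char (distr M borel (Z n)) t) \<longlonglongrightarrow> complex_of_real (exp (- (U_sigma2 M d f X * t'\<^sup>2 / 2)))"
    by (rule Lim_transform[rotated])
  also have "complex_of_real (exp (- (U_sigma2 M d f X * t'\<^sup>2 / 2))) = char (normal_law 0 (U_sigma2 M d f X / l\<^sup>2)) t"
    using U_sigma2_nonneg[OF f] by (subst char_normal_law) (auto simp: t'_def power_divide)
  finally show "(\<lambda>n. char (distr M borel (\<lambda>\<omega>. (real (n choose d) * integral\<^sup>L Q f - U_stat d f X n \<omega>) / (l * (sqrt (real n) * real n ^ (d - 1))))) t)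
      \<longlonglongrightarrow> char (normal_law 0 (U_sigma2 M d f X / l\<^sup>2)) t"
    unfolding fold .
qed

end

section \<open>Passage times\<close>

lemma ex_isCont_between:
  fixes F :: "real \<Rightarrow> real"
  assumes "mono F" "a < b"
  obtains c where "a < c" "c < b" "isCont F c"
  using open_minus_countable[OF mono_ctble_discont[OF assms(1)], of "{a<..<b}"] assms(2)
  by (auto simp: dense)

text \<open>Continuity points \<open>c\<close> close to \<open>t\<close> on either side absorb the
  moving threshold \<open>s\<close>, the shift \<open>\<eta>\<close> and the strict inequality. The
  error \<open>b\<close> may depend on \<open>\<eta>\<close>, because \<open>\<eta>\<close> is fixed
  before the limit along \<open>F\<close> is taken.\<close>

lemma (in prob_space) weak_conv_m_imp_tendsto_sandwich:
  fixes Z :: "nat \<Rightarrow> 'a \<Rightarrow> real" and m :: "'i \<Rightarrow> nat" and p s :: "'i \<Rightarrow> real"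
  assumes Z [measurable]: "\<And>n. Z n \<in> borel_measurable M"
    and conv: "weak_conv_m (\<lambda>n. distr M borel (Z n)) \<nu>" and \<nu>: "real_distribution \<nu>"
    and m: "filterlim m sequentially F" and s: "(s \<longlongrightarrow> t) F" and t: "isCont (cdf \<nu>) t"
    and le: "\<And>\<eta>. \<eta> > 0 \<Longrightarrow> \<exists>b. (b \<longlongrightarrow> 0) F \<and>
       eventually (\<lambda>x. p x \<le> prob {\<omega> \<in> space M. Z (m x) \<omega> < s x + \<eta>} + b x) F"
    and ge: "\<And>\<eta>. \<eta> > 0 \<Longrightarrow> \<exists>b. (b \<longlongrightarrow> 0) F \<and>
       eventually (\<lambda>x. prob {\<omega> \<in> space M. Z (m x) \<omega> < s x - \<eta>} - b x \<le> p x) F"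
  shows "(p \<longlongrightarrow> cdf \<nu> t) F"
proof (rule order_tendstoI)
  interpret \<nu>: real_distribution \<nu> by fact
  have mono: "mono (cdf \<nu>)" by (intro monoI \<nu>.cdf_nondecreasing)
  have lim: "((\<lambda>x. prob {\<omega> \<in> space M. Z (m x) \<omega> \<le> c}) \<longlongrightarrow> cdf \<nu> c) F" if "isCont (cdf \<nu>) c" for c
  proof -
    have "cdf (distr M borel (Z n)) c = prob {\<omega> \<in> space M. Z n \<omega> \<le> c}" for n
      by (auto simp: cdf_def measure_distr intro!: arg_cong[where f = prob])
    moreover have "(\<lambda>n. cdf (distr M borel (Z n)) c) \<longlonglongrightarrow> cdf \<nu> c"
      using conv that by (simp add: weak_conv_m_def weak_conv_def)
    ultimately have "(\<lambda>n. prob {\<omega> \<in> space M. Z n \<omega> \<le> c}) \<longlonglongrightarrow> cdf \<nu> c" by (simp only:)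
    then show ?thesis using m by (rule filterlim_compose)
  qed
  have near: "eventually P (at t) \<Longrightarrow> \<exists>\<delta>>0. \<forall>c. c \<noteq> t \<and> \<bar>c - t\<bar> < \<delta> \<longrightarrow> P c" for P
    by (auto simp: eventually_at dist_real_def)
  {
    fix a assume "a < cdf \<nu> t"
    then have "eventually (\<lambda>c. a < cdf \<nu> c) (at t)"
      using t by (auto simp: isCont_def order_tendsto_iff)
    then obtain \<delta> where \<delta>: "\<delta> > 0" "\<And>c. c \<noteq> t \<Longrightarrow> \<bar>c - t\<bar> < \<delta> \<Longrightarrow> a < cdf \<nu> c" using near by metis
    \<comment> \<open>Half of the distance from \<open>c\<close> to \<open>t\<close> is spent on
      \<open>\<eta>\<close>, the other half on the convergence of \<open>s\<close>.\<close>
    obtain c where c: "t - \<delta> < c" "c < t" "isCont (cdf \<nu>) c"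
      using ex_isCont_between[OF mono, of "t - \<delta>" t] \<delta> by auto
    obtain b where b: "(b \<longlongrightarrow> 0) F"
      "eventually (\<lambda>x. prob {\<omega> \<in> space M. Z (m x) \<omega> < s x - (t - c) / 2} - b x \<le> p x) F"
      using ge[of "(t - c) / 2"] c by auto
    have "((\<lambda>x. prob {\<omega> \<in> space M. Z (m x) \<omega> \<le> c} - b x) \<longlongrightarrow> cdf \<nu> c - 0) F"
      by (intro tendsto_intros lim c b)
    then have "eventually (\<lambda>x. a < prob {\<omega> \<in> space M. Z (m x) \<omega> \<le> c} - b x) F"
      using \<delta>(2)[of c] c by (intro order_tendstoD) auto
    moreover have "eventually (\<lambda>x. (t + c) / 2 < s x) F" using s c by (intro order_tendstoD) auto
    ultimately show "eventually (\<lambda>x. a < p x) F"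
      using b(2)
    proof eventually_elim
      case (elim x)
      have "prob {\<omega> \<in> space M. Z (m x) \<omega> \<le> c} \<le> prob {\<omega> \<in> space M. Z (m x) \<omega> < s x - (t - c) / 2}"
        using elim(2) by (intro finite_measure_mono) (auto simp: field_simps)
      then show ?case using elim by linarith
    qed
  }
  {
    fix a assume "cdf \<nu> t < a"
    then have "eventually (\<lambda>c. cdf \<nu> c < a) (at t)"
      using t by (auto simp: isCont_def order_tendsto_iff)
    then obtain \<delta> where \<delta>: "\<delta> > 0" "\<And>c. c \<noteq> t \<Longrightarrow> \<bar>c - t\<bar> < \<delta> \<Longrightarrow> cdf \<nu> c < a" using near by metis
    obtain c where c: "t < c" "c < t + \<delta>" "isCont (cdf \<nu>) c"
      using ex_isCont_between[OF mono, of t "t + \<delta>"] \<delta> by auto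
    obtain b where b: "(b \<longlongrightarrow> 0) F"
      "eventually (\<lambda>x. p x \<le> prob {\<omega> \<in> space M. Z (m x) \<omega> < s x + (c - t) / 2} + b x) F"
      using le[of "(c - t) / 2"] c by auto
    have "((\<lambda>x. prob {\<omega> \<in> space M. Z (m x) \<omega> \<le> c} + b x) \<longlongrightarrow> cdf \<nu> c + 0) F"
      by (intro tendsto_intros lim c b)
    then have "eventually (\<lambda>x. prob {\<omega> \<in> space M. Z (m x) \<omega> \<le> c} + b x < a) F"
      using \<delta>(2)[of c] c by (intro order_tendstoD) auto
    moreover have "eventually (\<lambda>x. s x < (t + c) / 2) F" using s c by (intro order_tendstoD) auto
    ultimately show "eventually (\<lambda>x. p x < a) F"
      using b(2)
    proof eventually_elim
      case (elim x)
      have "prob {\<omega> \<in> space M. Z (m x) \<omega> < s x + (c - t) / 2} \<le> prob {\<omega> \<in> space M. Z (m x) \<omega> \<le> c}"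
        using elim(2) by (intro finite_measure_mono) (auto simp: field_simps)
      then show ?case using elim by linarith
    qed
  }
qed

section \<open>Passage times as events\<close>

lemma N_plus_le_iff: "N_plus U x \<omega> \<le> enat m \<longleftrightarrow> (\<exists>n\<le>m. U n \<omega> > x)"
proof
  assume "N_plus U x \<omega> \<le> enat m"
  show "\<exists>n\<le>m. U n \<omega> > x"
  proof (rule ccontr)
    assume "\<not> ?thesis"
    then have "enat (Suc m) \<le> N_plus U x \<omega>"
      unfolding N_plus_def by (intro Inf_greatest) (auto simp: not_le[symmetric] Suc_le_eq)
    also note \<open>N_plus U x \<omega> \<le> enat m\<close>
    finally show False by simp
  qed
next
  assume "\<exists>n\<le>m. U n \<omega> > x"
  then obtain n where "n \<le> m" "U n \<omega> > x" by auto
  then have "N_plus U x \<omega> \<le> enat n" unfolding N_plus_def by (intro Inf_lower) auto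
  also have "\<dots> \<le> enat m" using \<open>n \<le> m\<close> by simp
  finally show "N_plus U x \<omega> \<le> enat m" .
qed

text \<open>Infinite values are included: if \<open>U n \<omega> \<le> x\<close> for infinitely many
  \<open>n\<close>, both sides are false.\<close>

lemma N_minus_le_iff: "N_minus U x \<omega> \<le> enat m \<longleftrightarrow> (\<forall>n\<ge>Suc m. U n \<omega> > x)"
  unfolding N_minus_def Sup_le_iff by (auto simp: not_le[symmetric] Suc_le_eq)

text \<open>Nonnegativity of \<open>A + t * B\<close> makes \<open>nat\<close> faithful on the
  floor; for \<open>N = \<infinity>\<close> both sides are false.\<close>

lemma normalized_enat_le_iff:
  assumes "B > 0" "0 \<le> A + t * B"
  shows "(ereal_of_enat N - ereal A) / ereal B \<le> ereal t \<longleftrightarrow> N \<le> enat (nat \<lfloor>A + t * B\<rfloor>)"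
proof (cases N)
  case (enat k)
  have "(ereal_of_enat N - ereal A) / ereal B \<le> ereal t \<longleftrightarrow> (real k - A) / B \<le> t"
    using assms by (simp add: enat)
  also have "\<dots> \<longleftrightarrow> real k \<le> A + t * B" using assms by (simp add: divide_simps algebra_simps)
  also have "\<dots> \<longleftrightarrow> k \<le> nat \<lfloor>A + t * B\<rfloor>" using assms by (simp add: le_nat_iff le_floor_iff)
  finally show ?thesis by (simp add: enat)
qed (use assms in simp)

text \<open>In the application \<open>q x\<close> is x^(1/(2d)), so \<open>m\<close> is the centre
  \<kappa> q^2 shifted by t q. The difference of \<open>d\<close>-th powers factors into m -
  \<kappa> q^2 and a sum of \<open>d\<close> terms, each asymptotic to the (d-1)-st power of
  \<open>m\<close>.\<close>

lemma power_difference_tendsto: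
  fixes q :: "'i \<Rightarrow> real" and m :: "'i \<Rightarrow> nat"
  assumes q: "filterlim q at_top F" and \<kappa>: "\<kappa> > 0"
    and m: "eventually (\<lambda>x. \<bar>real (m x) - (\<kappa> * (q x)\<^sup>2 + t * q x)\<bar> \<le> 1) F"
  shows "filterlim m sequentially F"
    and "((\<lambda>x. (real (m x) ^ d - (\<kappa> * (q x)\<^sup>2) ^ d) / (sqrt (real (m x)) * real (m x) ^ (d - 1))) \<longlongrightarrow> real d * t / sqrt \<kappa>) F"
proof -
  have ev: "eventually (\<lambda>x. q x > 0) F" using q by (simp add: filterlim_at_top_dense)
  have iq: "((\<lambda>x. 1 / q x) \<longlongrightarrow> 0) F"
    by (intro tendsto_divide_0[OF tendsto_const] filterlim_at_top_imp_at_infinity q)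
  have dev: "((\<lambda>x. (real (m x) - \<kappa> * (q x)\<^sup>2) / q x) \<longlongrightarrow> t) F"
  proof (rule Lim_transform[OF tendsto_const])
    show "((\<lambda>x. (real (m x) - \<kappa> * (q x)\<^sup>2) / q x - t) \<longlongrightarrow> 0) F"
    proof (rule Lim_null_comparison[OF _ iq])
      show "eventually (\<lambda>x. norm ((real (m x) - \<kappa> * (q x)\<^sup>2) / q x - t) \<le> 1 / q x) F"
        using m ev
      proof eventually_elim
        case (elim x)
        have "(real (m x) - \<kappa> * (q x)\<^sup>2) / q x - t = (real (m x) - (\<kappa> * (q x)\<^sup>2 + t * q x)) / q x"
          using elim by (simp add: field_simps)
        then show ?case using elim by (simp add: divide_right_mono)
      qed
    qed
  qed
  have ratio: "((\<lambda>x. real (m x) / (q x)\<^sup>2) \<longlongrightarrow> \<kappa>) F"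
  proof -
    have "((\<lambda>x. (real (m x) - \<kappa> * (q x)\<^sup>2) / q x * (1 / q x) + \<kappa>) \<longlongrightarrow> t * 0 + \<kappa>) F"
      by (intro tendsto_intros dev iq)
    moreover have "eventually (\<lambda>x. (real (m x) - \<kappa> * (q x)\<^sup>2) / q x * (1 / q x) + \<kappa> = real (m x) / (q x)\<^sup>2) F"
      using ev by eventually_elim (simp add: field_simps power2_eq_square)
    ultimately show ?thesis by (simp add: tendsto_cong)
  qed
  have "filterlim (\<lambda>x. real (m x) / (q x)\<^sup>2 * (q x)\<^sup>2) at_top F"
    by (rule filterlim_tendsto_pos_mult_at_top[OF ratio \<kappa>]) (intro filterlim_pow_at_top q, simp)
  moreover have "eventually (\<lambda>x. real (m x) / (q x)\<^sup>2 * (q x)\<^sup>2 = real (m x)) F"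
    using ev by eventually_elim simp
  ultimately have m_top: "filterlim (\<lambda>x. real (m x)) at_top F"
    by (rule filterlim_cong[THEN iffD1, OF refl refl, rotated])
  then show "filterlim m sequentially F"
    by (simp add: filterlim_sequentially_iff_filterlim_real)
  have evm: "eventually (\<lambda>x. real (m x) > 0) F"
    using m_top unfolding filterlim_at_top_dense by blast
  \<comment> \<open>Everything is expressed through (m - \<kappa> q^2) / q and m / q^2, whose limits
    are t and \<kappa>.\<close>
  have "((\<lambda>x. (real (m x) - \<kappa> * (q x)\<^sup>2) / q x / sqrt (real (m x) / (q x)\<^sup>2) *
      (\<Sum>i<d. (\<kappa> / (real (m x) / (q x)\<^sup>2)) ^ (d - Suc i))) \<longlongrightarrow> t / sqrt \<kappa> * (\<Sum>i<d. (\<kappa> / \<kappa>) ^ (d - Suc i))) F"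
    using \<kappa> by (intro tendsto_intros dev ratio) auto
  moreover have "eventually (\<lambda>x. (real (m x) - \<kappa> * (q x)\<^sup>2) / q x / sqrt (real (m x) / (q x)\<^sup>2) *
      (\<Sum>i<d. (\<kappa> / (real (m x) / (q x)\<^sup>2)) ^ (d - Suc i)) =
      (real (m x) ^ d - (\<kappa> * (q x)\<^sup>2) ^ d) / (sqrt (real (m x)) * real (m x) ^ (d - 1))) F"
    using ev evm
  proof eventually_elim
    case (elim x)
    let ?A = "\<kappa> * (q x)\<^sup>2"
    have "(\<Sum>i<d. (\<kappa> / (real (m x) / (q x)\<^sup>2)) ^ (d - Suc i)) = (\<Sum>i<d. ?A ^ (d - Suc i) * real (m x) ^ i) / real (m x) ^ (d - 1)"
      unfolding sum_divide_distrib
    proof (intro sum.cong refl)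
      fix i assume "i \<in> {..<d}"
      then have "d - 1 = (d - Suc i) + i" by auto
      then have "real (m x) ^ (d - 1) = real (m x) ^ (d - Suc i) * real (m x) ^ i" by (simp only: power_add)
      then show "(\<kappa> / (real (m x) / (q x)\<^sup>2)) ^ (d - Suc i) = ?A ^ (d - Suc i) * real (m x) ^ i / real (m x) ^ (d - 1)"
        using elim by (simp add: power_divide)
    qed
    moreover have "(real (m x) - ?A) / q x / sqrt (real (m x) / (q x)\<^sup>2) = (real (m x) - ?A) / sqrt (real (m x))"
      using elim by (simp add: real_sqrt_divide)
    ultimately show ?case by (simp only: power_diff_sumr2 times_divide_times_eq)
  qed
  ultimately show "((\<lambda>x. (real (m x) ^ d - (\<kappa> * (q x)\<^sup>2) ^ d) / (sqrt (real (m x)) * real (m x) ^ (d - 1))) \<longlongrightarrow> real d * t / sqrt \<kappa>) F"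
    using \<kappa> by (simp add: tendsto_cong mult.commute)
qed

text \<open>Replacing \<open>fact d\<close> times the binomial by the power costs O(n^(d-1)), below
  the scale n^(d-1/2). The condition on \<open>\<kappa> ^ d\<close> turns \<mu>/d! times (\<kappa>
  q^2)^d into q^(2d), and \<open>l\<close> is the constant for which the limit is exactly
  \<open>t\<close>.\<close>

lemma threshold_tendsto:
  fixes q :: "'i \<Rightarrow> real" and m :: "'i \<Rightarrow> nat"
  assumes q: "filterlim q at_top F" and \<kappa>: "\<kappa> > 0" and d: "d \<ge> 1" and \<mu>: "\<mu> > 0" and \<kappa>d: "\<kappa> ^ d = fact d / \<mu>"
    and m: "eventually (\<lambda>x. \<bar>real (m x) - (\<kappa> * (q x)\<^sup>2 + t * q x)\<bar> \<le> 1) F"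
  defines "l \<equiv> \<mu> / fact d * real d / sqrt \<kappa>"
  shows "((\<lambda>x. (real (m x choose d) * \<mu> - (q x) ^ (2 * d)) / (l * (sqrt (real (m x)) * real (m x) ^ (d - 1)))) \<longlongrightarrow> t) F"
proof -
  let ?r = "\<lambda>n. sqrt (real n) * real n ^ (d - 1)"
  have l: "l > 0" using \<mu> \<kappa> d by (simp add: l_def)
  note m_seq = power_difference_tendsto(1)[OF q \<kappa> m]
  have "(\<lambda>n. (fact d * real (n choose d) - real n ^ d) / ?r n) \<longlonglongrightarrow> 0"
  proof (rule Lim_null_comparison)
    show "(\<lambda>n. (real d)\<^sup>2 / sqrt (real n)) \<longlonglongrightarrow> 0" by real_asymp
    show "eventually (\<lambda>n. norm ((fact d * real (n choose d) - real n ^ d) / ?r n) \<le> (real d)\<^sup>2 / sqrt (real n)) sequentially"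
      using eventually_gt_at_top[of 0]
    proof eventually_elim
      case (elim n)
      have nd: "real n ^ d = real n * real n ^ (d - 1)" using d by (cases d) auto
      have "(fact d * real (n choose d) - real n ^ d) / ?r n = sqrt (real n) * (fact d * real (n choose d) / real n ^ d - 1)"
      proof -
        have "(P - s * s * q) / (s * q) = s * (P / (s * s * q) - 1)" if "s > 0" "q > 0" for P s q :: real
          using that by (simp add: field_simps)
        from this[of "sqrt (real n)" "real n ^ (d - 1)" "fact d * real (n choose d)"] elim nd
        show ?thesis by simp
      qed
      also have "norm \<dots> = sqrt (real n) * \<bar>fact d * real (n choose d) / real n ^ d - 1\<bar>" by (simp add: abs_mult)
      also have "\<dots> \<le> sqrt (real n) * ((real d)\<^sup>2 / real n)"
        using fact_mult_choose_approx(2)[of n n d] elim by (intro mult_left_mono) auto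
      also have "\<dots> = (real d)\<^sup>2 / sqrt (real n)" using elim by (simp add: field_simps)
      finally show ?case .
    qed
  qed
  note tendsto_mult[OF tendsto_const tendsto_add[OF filterlim_compose[OF this m_seq] power_difference_tendsto(2)[OF q \<kappa> m, of d]]]
  then have "((\<lambda>x. \<mu> / fact d / l * ((fact d * real (m x choose d) - real (m x) ^ d) / ?r (m x) +
      (real (m x) ^ d - (\<kappa> * (q x)\<^sup>2) ^ d) / ?r (m x))) \<longlongrightarrow> \<mu> / fact d / l * (0 + real d * t / sqrt \<kappa>)) F"
    .
  also have "\<mu> / fact d / l * (0 + real d * t / sqrt \<kappa>) = t"
    using \<mu> \<kappa> d by (simp add: l_def)
  also have "(\<lambda>x. \<mu> / fact d / l * ((fact d * real (m x choose d) - real (m x) ^ d) / ?r (m x) +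
      (real (m x) ^ d - (\<kappa> * (q x)\<^sup>2) ^ d) / ?r (m x))) =
    (\<lambda>x. (real (m x choose d) * \<mu> - (q x) ^ (2 * d)) / (l * ?r (m x)))"
  proof
    fix x
    have "\<mu> / fact d * ((fact d * real (m x choose d) - real (m x) ^ d) + (real (m x) ^ d - (\<kappa> * (q x)\<^sup>2) ^ d))
      = real (m x choose d) * \<mu> - (q x) ^ (2 * d)"
      using \<mu> by (simp add: power_mult_distrib \<kappa>d power_mult[symmetric] field_simps)
    then show "\<mu> / fact d / l * ((fact d * real (m x choose d) - real (m x) ^ d) / ?r (m x) +
      (real (m x) ^ d - (\<kappa> * (q x)\<^sup>2) ^ d) / ?r (m x)) = (real (m x choose d) * \<mu> - (q x) ^ (2 * d)) / (l * ?r (m x))"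
      unfolding add_divide_distrib[symmetric] times_divide_times_eq by (simp only:)
  qed
  finally show ?thesis .
qed

section \<open>Transfer of the central limit theorem to passage times\<close>

context iid_sequence
begin

text \<open>\<open>m\<close> is fixed only up to an error of 1, so that a floor can be inserted for
  \<open>N_plus\<close> and its successor for \<open>N_minus\<close>.\<close>

lemma passage_probabilities_tendsto:
  fixes q :: "real \<Rightarrow> real" and m :: "real \<Rightarrow> nat" and \<kappa> t :: real
  assumes f: "sqi f" and \<mu>: "integral\<^sup>L Q f > 0"
    and q: "filterlim q at_top at_top" and \<kappa>: "\<kappa> > 0" "\<kappa> ^ d = fact d / integral\<^sup>L Q f"
    and m: "eventually (\<lambda>x. \<bar>real (m x) - (\<kappa> * (q x)\<^sup>2 + t * q x)\<bar> \<le> 1) at_top"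
    and qx: "eventually (\<lambda>x. q x ^ (2 * d) = x) at_top"
  defines "l \<equiv> integral\<^sup>L Q f / fact d * real d / sqrt \<kappa>"
  defines "\<nu> \<equiv> normal_law 0 (U_sigma2 M d f X / l\<^sup>2)"
  assumes t: "isCont (cdf \<nu>) t"
  shows "((\<lambda>x. prob {\<omega> \<in> space M. \<exists>n\<le>m x. U_stat d f X n \<omega> > x}) \<longlongrightarrow> cdf \<nu> t) at_top"
    and "((\<lambda>x. prob {\<omega> \<in> space M. \<forall>n\<ge>m x. U_stat d f X n \<omega> > x}) \<longlongrightarrow> cdf \<nu> t) at_top"
proof -
  let ?U = "U_stat d f X"
  let ?r = "\<lambda>n. sqrt (real n) * real n ^ (d - 1)"
  define Z where "Z n \<omega> = (real (n choose d) * integral\<^sup>L Q f - ?U n \<omega>) / (l * ?r n)" for n \<omega>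
  define s where "s x = (real (m x choose d) * integral\<^sup>L Q f - x) / (l * ?r (m x))" for x
  have l: "l > 0" using \<mu> \<kappa> d_pos by (simp add: l_def)
  have [measurable]: "?U n \<in> borel_measurable M" for n
    by (intro measurable_U_stat sqi_measurable f)
  have Z [measurable]: "Z n \<in> borel_measurable M" for n
    unfolding Z_def[abs_def] by measurable
  have conv: "weak_conv_m (\<lambda>n. distr M borel (Z n)) \<nu>"
    using central_limit_U_stat[OF f l] by (simp add: Z_def[abs_def] \<nu>_def)
  have \<nu>: "real_distribution \<nu>"
    unfolding \<nu>_def using U_sigma2_nonneg[OF f] by (intro real_distribution_normal_law) simp
  have m_seq: "filterlim m sequentially at_top" by (rule power_difference_tendsto(1)[OF q \<kappa>(1) m])
  have "((\<lambda>x. (real (m x choose d) * integral\<^sup>L Q f - q x ^ (2 * d)) / (l * ?r (m x))) \<longlongrightarrow> t) at_top"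
    unfolding l_def by (rule threshold_tendsto[OF q \<kappa>(1) d_pos \<mu> \<kappa>(2) m])
  moreover have "eventually (\<lambda>x. (real (m x choose d) * integral\<^sup>L Q f - q x ^ (2 * d)) / (l * ?r (m x)) = s x) at_top"
    using qx by eventually_elim (simp add: s_def)
  ultimately have s: "(s \<longlongrightarrow> t) at_top" by (simp add: tendsto_cong)
  have m_pos: "eventually (\<lambda>x. m x > 0) at_top"
    using m_seq eventually_gt_at_top[of 0] by (simp add: filterlim_iff)
  \<comment> \<open>\<open>s x\<close> is the level \<open>x\<close> in the normalisation of
    \<open>Z\<close>. Shifting it by \<open>\<eta>\<close> shifts the level by the slack of almost
    monotonicity with \<epsilon> = \<eta> l.\<close>
  have less_iff: "Z (m x) \<omega> < s x + \<eta> \<longleftrightarrow> ?U (m x) \<omega> > x - \<eta> * l * ?r (m x)" if "m x > 0" for x \<omega> \<eta>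
  proof -
    have r: "l * ?r (m x) > 0" using l that by simp
    have "s x + \<eta> = (real (m x choose d) * integral\<^sup>L Q f - x + \<eta> * (l * ?r (m x))) / (l * ?r (m x))"
    proof -
      have "\<eta> * (l * ?r (m x)) / (l * ?r (m x)) = \<eta>"
        using r by (intro nonzero_mult_div_cancel_right) linarith
      then show ?thesis unfolding s_def add_divide_distrib by (simp only:)
    qed
    moreover have "a / D < b / D \<longleftrightarrow> a < b" if "D > 0" for a b D :: real
      using that by (simp add: divide_less_cancel)
    ultimately have "Z (m x) \<omega> < s x + \<eta> \<longleftrightarrow>
        real (m x choose d) * integral\<^sup>L Q f - ?U (m x) \<omega> < real (m x choose d) * integral\<^sup>L Q f - x + \<eta> * (l * ?r (m x))"
      unfolding Z_def using r by (simp only:)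
    also have "\<dots> \<longleftrightarrow> ?U (m x) \<omega> > x - \<eta> * l * ?r (m x)"
      unfolding mult.assoc by (rule iffI) linarith+
    finally show ?thesis .
  qed
  have early: "((\<lambda>x. prob {\<omega> \<in> space M. \<exists>n\<le>m x. ?U n \<omega> > ?U (m x) \<omega> + \<eta> * l * sqrt (real (m x)) * real (m x) ^ (d - 1)}) \<longlongrightarrow> 0) at_top"
    if "\<eta> > 0" for \<eta>
    using that l by (intro filterlim_compose[OF no_early_excess[OF f \<mu>] m_seq]) simp
  have late: "((\<lambda>x. prob {\<omega> \<in> space M. \<exists>n\<ge>m x. ?U n \<omega> < ?U (m x) \<omega> - \<eta> * l * sqrt (real (m x)) * real (m x) ^ (d - 1)}) \<longlongrightarrow> 0) at_top"
    if "\<eta> > 0" for \<eta>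
    using that l by (intro filterlim_compose[OF no_late_descent[OF f \<mu>] m_seq]) simp
  show "((\<lambda>x. prob {\<omega> \<in> space M. \<exists>n\<le>m x. ?U n \<omega> > x}) \<longlongrightarrow> cdf \<nu> t) at_top"
  proof (rule weak_conv_m_imp_tendsto_sandwich[OF Z conv \<nu> m_seq s t])
    fix \<eta> :: real assume \<eta>: "\<eta> > 0"
    \<comment> \<open>If some \<open>n \<le> m x\<close> exceeds the level \<open>x\<close> while U
      at \<open>m x\<close> is at most \<open>x\<close> minus the slack, an early excess has
      occurred. For the converse bound \<open>m x\<close> itself is the witness.\<close>
    show "\<exists>b. (b \<longlongrightarrow> 0) at_top \<and> (\<forall>\<^sub>F x in at_top. prob {\<omega> \<in> space M. \<exists>n\<le>m x. ?U n \<omega> > x}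
       \<le> prob {\<omega> \<in> space M. Z (m x) \<omega> < s x + \<eta>} + b x)"
    proof (intro exI conjI, rule early[OF \<eta>], use m_pos in eventually_elim)
      case (elim x)
      show ?case
        using elim by (intro order.trans[OF finite_measure_mono measure_Un_le]) (auto simp: less_iff mult.assoc not_less)
    qed
    show "\<exists>b. (b \<longlongrightarrow> 0) at_top \<and> (\<forall>\<^sub>F x in at_top. prob {\<omega> \<in> space M. Z (m x) \<omega> < s x - \<eta>} - b x
       \<le> prob {\<omega> \<in> space M. \<exists>n\<le>m x. ?U n \<omega> > x})"
    proof (rule exI[of _ "\<lambda>_. 0"], intro conjI tendsto_const, use m_pos in eventually_elim)
      case (elim x)
      have "\<eta> * l * ?r (m x) \<ge> 0" using \<eta> l by simp
      then have "prob {\<omega> \<in> space M. Z (m x) \<omega> < s x - \<eta>} \<le> prob {\<omega> \<in> space M. \<exists>n\<le>m x. ?U n \<omega> > x}"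
        using less_iff[OF elim, of _ "- \<eta>"]
        by (intro finite_measure_mono) (auto intro!: exI[of _ "m x"])
      then show ?case by simp
    qed
  qed
  show "((\<lambda>x. prob {\<omega> \<in> space M. \<forall>n\<ge>m x. ?U n \<omega> > x}) \<longlongrightarrow> cdf \<nu> t) at_top"
  proof (rule weak_conv_m_imp_tendsto_sandwich[OF Z conv \<nu> m_seq s t])
    fix \<eta> :: real assume \<eta>: "\<eta> > 0"
    show "\<exists>b. (b \<longlongrightarrow> 0) at_top \<and> (\<forall>\<^sub>F x in at_top. prob {\<omega> \<in> space M. \<forall>n\<ge>m x. ?U n \<omega> > x}
       \<le> prob {\<omega> \<in> space M. Z (m x) \<omega> < s x + \<eta>} + b x)"
    proof (rule exI[of _ "\<lambda>_. 0"], intro conjI tendsto_const, use m_pos in eventually_elim)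
      case (elim x)
      have "\<eta> * l * ?r (m x) \<ge> 0" using \<eta> l by simp
      then have "prob {\<omega> \<in> space M. \<forall>n\<ge>m x. ?U n \<omega> > x} \<le> prob {\<omega> \<in> space M. Z (m x) \<omega> < s x + \<eta>}"
        using less_iff[OF elim, of _ \<eta>] by (intro finite_measure_mono) force+
      then show ?case by simp
    qed
    show "\<exists>b. (b \<longlongrightarrow> 0) at_top \<and> (\<forall>\<^sub>F x in at_top. prob {\<omega> \<in> space M. Z (m x) \<omega> < s x - \<eta>} - b x
       \<le> prob {\<omega> \<in> space M. \<forall>n\<ge>m x. ?U n \<omega> > x})"
    proof (intro exI conjI, rule late[OF \<eta>], use m_pos in eventually_elim)
      case (elim x)
      let ?B = "{\<omega> \<in> space M. \<exists>n\<ge>m x. ?U n \<omega> < ?U (m x) \<omega> - \<eta> * l * sqrt (real (m x)) * real (m x) ^ (d - 1)}"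
      \<comment> \<open>Here U at \<open>m x\<close> exceeds \<open>x\<close> plus the slack, so a
        later value of at most \<open>x\<close> is a late descent.\<close>
      have "prob {\<omega> \<in> space M. Z (m x) \<omega> < s x - \<eta>} \<le> prob ({\<omega> \<in> space M. \<forall>n\<ge>m x. ?U n \<omega> > x} \<union> ?B)"
      proof (rule finite_measure_mono)
        show "{\<omega> \<in> space M. Z (m x) \<omega> < s x - \<eta>} \<subseteq> {\<omega> \<in> space M. \<forall>n\<ge>m x. ?U n \<omega> > x} \<union> ?B"
          using less_iff[OF elim, of _ "- \<eta>"] by (force simp: mult.assoc not_less)
      qed measurable
      also have "\<dots> \<le> prob {\<omega> \<in> space M. \<forall>n\<ge>m x. ?U n \<omega> > x} + prob ?B"
        by (rule measure_Un_le) measurable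
      finally show ?case by simp
    qed
  qed
qed

end

theorem theorem3p8:
  fixes M :: "'a measure" and S :: "'s measure"
    and X :: "nat \<Rightarrow> 'a \<Rightarrow> 's"
    and d :: nat and f :: "(nat \<Rightarrow> 's) \<Rightarrow> real"
    and \<mu> \<sigma>2 :: real
  assumes "prob_space M"
    and "iid M S X"
    and "d \<ge> 1"
    and "f \<in> borel_measurable (Pi\<^sub>M {1..d} (\<lambda>_. S))"
    and "integrable M (\<lambda>\<omega>. (f (\<lambda>k\<in>{1..d}. X k \<omega>))\<^sup>2)"
    and "\<mu> = U_mean M d f X"
    and "\<sigma>2 = U_sigma2 M d f X"
    and "\<mu> > 0"
  shows "conv_in_distr M
           (\<lambda>x \<omega>. (ereal_of_enat (N_minus (U_stat d f X) x \<omega>)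
                     - ereal ((fact d / \<mu>) powr (1 / real d) * x powr (1 / real d)))
                   / ereal (x powr (1 / (2 * real d))))
           (normal_law 0 ((fact d / \<mu>) powr (2 + 1 / real d) / (real d)\<^sup>2 * \<sigma>2)) at_top
         \<and> conv_in_distr M
           (\<lambda>x \<omega>. (ereal_of_enat (N_plus (U_stat d f X) x \<omega>)
                     - ereal ((fact d / \<mu>) powr (1 / real d) * x powr (1 / real d)))
                   / ereal (x powr (1 / (2 * real d))))
           (normal_law 0 ((fact d / \<mu>) powr (2 + 1 / real d) / (real d)\<^sup>2 * \<sigma>2)) at_top"
proof -
  interpret prob_space M by fact
  interpret iid_sequence M S X d by unfold_locales fact+
  let ?U = "U_stat d f X"
  define \<kappa> where "\<kappa> = (fact d / \<mu>) powr (1 / real d)"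
  define q where "q x = x powr (1 / (2 * real d))" for x :: real
  define l where "l = \<mu> / fact d * real d / sqrt \<kappa>"
  define \<nu> where "\<nu> = normal_law 0 ((fact d / \<mu>) powr (2 + 1 / real d) / (real d)\<^sup>2 * \<sigma>2)"
  have dpos: "real d > 0" using assms(3) by simp
  have \<mu>Q: "\<mu> = integral\<^sup>L Q f" using assms(4,6) by (simp only: U_mean_eq)
  have f: "sqi f"
  proof -
    have m2: "(\<lambda>y. (f y)\<^sup>2) \<in> borel_measurable PS" using assms(4) by (rule borel_measurable_power)
    have "integrable M (\<lambda>\<omega>. (f (tup (\<lambda>k. k) \<omega>))\<^sup>2)" using assms(5) by (simp only: tup_def)
    then have "integrable Q (\<lambda>y. (f y)\<^sup>2)" using integrable_tup[OF m2, of "\<lambda>k. k"] by simp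
    then show ?thesis using assms(4) by (simp only: sqi_def simp_thms)
  qed
  have \<kappa>: "\<kappa> > 0" using assms(8) by (simp add: \<kappa>_def)
  have \<kappa>d: "\<kappa> ^ d = fact d / \<mu>"
    using assms(8) dpos by (simp add: \<kappa>_def powr_power)
  have q_top: "filterlim q at_top at_top"
    unfolding q_def using dpos by real_asymp
  have q_pos: "q x > 0" if "x > 0" for x using that by (simp add: q_def)
  have q2: "(q x)\<^sup>2 = x powr (1 / real d)" "q x ^ (2 * d) = x" if "x > 0" for x
    using that dpos by (simp_all add: q_def powr_power)
  \<comment> \<open>With \<kappa> = (d!/\<mu>)^(1/d), the inverse square of \<open>l\<close> is
    (d!/\<mu>)^2 \<kappa> / d^2, the factor of \<sigma>^2 in the limit law.\<close>
  have \<nu>_eq: "\<nu> = normal_law 0 (U_sigma2 M d f X / l\<^sup>2)"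
  proof -
    have "(fact d / \<mu>) powr (2 + 1 / real d) = (fact d / \<mu>)\<^sup>2 * \<kappa>"
      using assms(8) by (simp add: powr_add \<kappa>_def powr_numeral)
    then have "(fact d / \<mu>) powr (2 + 1 / real d) / (real d)\<^sup>2 * \<sigma>2 = U_sigma2 M d f X / l\<^sup>2"
      using \<kappa> assms(7,8) dpos by (simp add: l_def power_divide power_mult_distrib field_simps)
    then show ?thesis by (simp add: \<nu>_def)
  qed
  \<comment> \<open>For fixed \<open>t\<close> the quadratic term eventually dominates, so that
    \<open>nat\<close> in \<open>k\<close> below truncates nothing.\<close>
  have y_pos: "eventually (\<lambda>x. \<kappa> * (q x)\<^sup>2 + t * q x \<ge> 0) at_top" for t
  proof -
    have "eventually (\<lambda>x. q x \<ge> \<bar>t\<bar> / \<kappa>) at_top" using q_top by (simp add: filterlim_at_top)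
    then show ?thesis using eventually_gt_at_top[of 0]
    proof eventually_elim
      case (elim x)
      then have "\<kappa> * q x + t \<ge> 0" using \<kappa> by (simp add: divide_simps mult.commute split: if_splits)
      then have "(\<kappa> * q x + t) * q x \<ge> 0" using q_pos[OF elim(2)] by simp
      then show ?case by (simp add: power2_eq_square algebra_simps)
    qed
  qed
  define k where "k t x = nat \<lfloor>\<kappa> * (q x)\<^sup>2 + t * q x\<rfloor>" for t x
  \<comment> \<open>The floor and its successor are both within 1 of the target; the successor
    enters because \<open>N_minus\<close> being at most \<open>k t x\<close> concerns the indices
    from \<open>Suc (k t x)\<close> on.\<close>
  have k: "eventually (\<lambda>x. \<bar>real (k t x) - (\<kappa> * (q x)\<^sup>2 + t * q x)\<bar> \<le> 1 \<and>
      \<bar>real (Suc (k t x)) - (\<kappa> * (q x)\<^sup>2 + t * q x)\<bar> \<le> 1) at_top" for t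
    using y_pos[of t]
  proof eventually_elim
    case (elim x)
    then have "real (k t x) = of_int \<lfloor>\<kappa> * (q x)\<^sup>2 + t * q x\<rfloor>" by (simp add: k_def)
    then show ?case
      using floor_correct[of "\<kappa> * (q x)\<^sup>2 + t * q x"] by (simp only: of_nat_Suc) linarith
  qed
  have q_inv: "eventually (\<lambda>x. q x ^ (2 * d) = x) at_top"
    using eventually_gt_at_top[of 0] by eventually_elim (rule q2)
  have event: "eventually (\<lambda>x. measure M {\<omega> \<in> space M. (ereal_of_enat (N x \<omega>)
        - ereal (\<kappa> * x powr (1 / real d))) / ereal (x powr (1 / (2 * real d))) \<le> ereal t} =
      prob {\<omega> \<in> space M. N x \<omega> \<le> enat (k t x)}) at_top" for N :: "real \<Rightarrow> 'a \<Rightarrow> enat" and t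
    using y_pos[of t] eventually_gt_at_top[of 0]
  proof eventually_elim
    case (elim x)
    then show ?case
      using normalized_enat_le_iff[OF q_pos[OF elim(2)] elim(1)]
      unfolding k_def q_def[symmetric] q2(1)[OF elim(2), symmetric] by simp
  qed
  have pass: "((\<lambda>x. prob {\<omega> \<in> space M. \<exists>n\<le>k t x. ?U n \<omega> > x}) \<longlongrightarrow> cdf \<nu> t) at_top"
    "((\<lambda>x. prob {\<omega> \<in> space M. \<forall>n\<ge>Suc (k t x). ?U n \<omega> > x}) \<longlongrightarrow> cdf \<nu> t) at_top"
    if "isCont (cdf \<nu>) t" for t
  proof -
    have c: "isCont (cdf (normal_law 0 (U_sigma2 M d f X / (integral\<^sup>L Q f / fact d * real d / sqrt \<kappa>)\<^sup>2))) t"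
      using that unfolding \<nu>_eq l_def \<mu>Q .
    have k1: "eventually (\<lambda>x. \<bar>real (k t x) - (\<kappa> * (q x)\<^sup>2 + t * q x)\<bar> \<le> 1) at_top"
      and k2: "eventually (\<lambda>x. \<bar>real (Suc (k t x)) - (\<kappa> * (q x)\<^sup>2 + t * q x)\<bar> \<le> 1) at_top"
      using k[of t] by (auto elim: eventually_mono)
    note \<mu>' = assms(8)[unfolded \<mu>Q] and \<kappa>' = \<kappa>d[unfolded \<mu>Q]
    show "((\<lambda>x. prob {\<omega> \<in> space M. \<exists>n\<le>k t x. ?U n \<omega> > x}) \<longlongrightarrow> cdf \<nu> t) at_top"
      unfolding \<nu>_eq l_def \<mu>Q by (rule passage_probabilities_tendsto(1)[OF f \<mu>' q_top \<kappa> \<kappa>' k1 q_inv c])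
    show "((\<lambda>x. prob {\<omega> \<in> space M. \<forall>n\<ge>Suc (k t x). ?U n \<omega> > x}) \<longlongrightarrow> cdf \<nu> t) at_top"
      unfolding \<nu>_eq l_def \<mu>Q by (rule passage_probabilities_tendsto(2)[OF f \<mu>' q_top \<kappa> \<kappa>' k2 q_inv c])
  qed
  show ?thesis
    unfolding conv_in_distr_def \<nu>_def[symmetric] \<kappa>_def[symmetric]
  proof (intro conjI allI impI)
    fix t assume t: "isCont (cdf \<nu>) t"
    show "((\<lambda>x. measure M {\<omega> \<in> space M. (ereal_of_enat (N_minus ?U x \<omega>)
        - ereal (\<kappa> * x powr (1 / real d))) / ereal (x powr (1 / (2 * real d))) \<le> ereal t}) \<longlongrightarrow> cdf \<nu> t) at_top"
      using pass(2)[OF t] unfolding tendsto_cong[OF event[of "N_minus ?U" t]] N_minus_le_iff .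
    show "((\<lambda>x. measure M {\<omega> \<in> space M. (ereal_of_enat (N_plus ?U x \<omega>)
        - ereal (\<kappa> * x powr (1 / real d))) / ereal (x powr (1 / (2 * real d))) \<le> ereal t}) \<longlongrightarrow> cdf \<nu> t) at_top"
      using pass(1)[OF t] unfolding tendsto_cong[OF event[of "N_plus ?U" t]] N_plus_le_iff .
  qed
qed

end
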